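(* Let $\hat W_n=\arg\min_{W\in\Theta_s}U_n(W)$. Then, as $n\to\infty$, $\sqrt n(\hat W_n-W^0)$ converges in law to $\mathcal N(0,I_0^{-1})$, where $I_0$ is the matrix whose component $(k,l)$ is $$\mathrm{tr}\left(\Gamma_0^{-1}E\left(\frac{\partial F_{W^0}(Z)}{\partial W_k}\frac{\partial F_{W^0}(Z)}{\partial W_l}^T\right)\right).$$
   Context: Model. $(Y_t,Z_t)_{t\in\mathbb N}$ is an i.i.d. sequence of random vectors, each with the same law as a generic pair $(Y,Z)$, where $Y_t$ is $d$-dimensional, $Z_t$ is $L$-dimensional, and $Y_t=F_{W^0}(Z_t)+\varepsilon_t$, where $(\varepsilon_t)$ is an i.i.d. centered noise with unknown invertible covariance matrix $\Gamma_0$. It is assumed that the square of the noise and the cube of $Z$ are integrable: $E\|\varepsilon_t\|^2<\infty$ and $E\|Z\|^3<\infty$. MLP functions. $F_W=(F_W^1,\dots,F_W^d)^T$ is the function represented by a one-hidden-layer multilayer perceptron (MLP) with $H$ hidden units and weight vector $W$ (the $a_{ij}$ and $w_{jk}$): $F_W^i(z)=\sum_{j=1}^H a_{ij}\tanh\left(\sum_{k=1}^L w_{jk}z_k+w_{j0}\right)+a_{i0}$. $\frac{\partial F_W(z)}{\partial W_k}$ denotes the $d$-dimensional vector of partial derivatives of the components of $F_W(z)$ with respect to the weight $W_k$. Parameter set and identifiability. The parameter set $\Theta_s\subset\mathbb R^s$ is compact. Two weight vectors are considered equivalent if one is obtained from the other by a transformation in the finite group generated by sign changes of hidden units (flipping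 the sign of all incoming and outgoing weights of a unit) and permutations of hidden units; parameters are considered in the quotient space by this group. In this space the model is assumed identifiable: the true model belongs to the considered family and the MLPs considered have no redundant units, so that $W^0$ is the only parameter representing the true function. The assumptions are taken to be such that the limiting Hessian matrix $2I_0$ of $U_n$ at $W^0$ is positive definite. Cost function. $U_n(W):=\log\det\left(\frac1n\sum_{t=1}^n (Y_t-F_W(Z_t))(Y_t-F_W(Z_t))^T\right)$.
   Formalization: W^0 is also assumed to be an interior point of the parameter set in the quotient space (the claim fails e.g. for Θ_s={W^0}); the noise ε_t is read as independent of Z_t, and Ŵ_n−W^0 is taken at the representative of Ŵ_n closest to W^0. *)

theory Defs
  imports "HOL-Probability.Probability"
begin

section \<open>One-hidden-layer perceptrons\<close>

text \<open>The types 'd, 'h, 'l index the outputs, the hidden units and the inputs.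
  The weights are
    \<^item> \<open>W $ Inl (i, Some j)\<close> = $a_{ij}$ and \<open>W $ Inl (i, None)\<close> = $a_{i0}$,
    \<^item> \<open>W $ Inr (j, Some k)\<close> = $w_{jk}$ and \<open>W $ Inr (j, None)\<close> = $w_{j0}$,
  so a weight vector lives in $R^s$ with $s = d(H+1) + H(L+1)$.\<close>

type_synonym ('d, 'h, 'l) weight_index = "('d \<times> 'h option) + ('h \<times> 'l option)"

type_synonym ('d, 'h, 'l) weights = "real ^ ('d, 'h, 'l) weight_index"

definition mlp ::
  "('d::finite, 'h::finite, 'l::finite) weights \<Rightarrow> real ^ 'l \<Rightarrow> real ^ 'd" where
  "mlp W z = (\<chi> i.
     (\<Sum>j\<in>UNIV. W $ Inl (i, Some j) *
        tanh ((\<Sum>k\<in>UNIV. W $ Inr (j, Some k) * z $ k) + W $ Inr (j, None)))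
     + W $ Inl (i, None))"

definition mlp_partial ::
  "('d::finite, 'h::finite, 'l::finite) weights \<Rightarrow> ('d, 'h, 'l) weight_index
     \<Rightarrow> real ^ 'l \<Rightarrow> real ^ 'd" where
  "mlp_partial W k z = (\<chi> i. deriv (\<lambda>t. mlp (W + t *\<^sub>R axis k 1) z $ i) 0)"

section \<open>Symmetries of the parametrization\<close>

definition flip_unit ::
  "'h \<Rightarrow> ('d::finite, 'h::finite, 'l::finite) weights \<Rightarrow> ('d, 'h, 'l) weights" where
  "flip_unit j W = (\<chi> p. case p of
       Inl (i, m) \<Rightarrow> if m = Some j then - W $ p else W $ p
     | Inr (j', m) \<Rightarrow> if j' = j then - W $ p else W $ p)"

definition permute_units ::
  "('h \<Rightarrow> 'h) \<Rightarrow> ('d::finite, 'h::finite, 'l::finite) weights \<Rightarrow> ('d, 'h, 'l) weights" where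
  "permute_units \<pi> W = (\<chi> p. case p of
       Inl (i, m) \<Rightarrow> W $ Inl (i, map_option \<pi> m)
     | Inr (j, m) \<Rightarrow> W $ Inr (\<pi> j, m))"

text \<open>Both families of generators are closed under inverses, so closing them under
  composition already yields the generated group.\<close>

inductive_set mlp_symmetries ::
  "(('d::finite, 'h::finite, 'l::finite) weights \<Rightarrow> ('d, 'h, 'l) weights) set" where
  id: "id \<in> mlp_symmetries"
| flip: "g \<in> mlp_symmetries \<Longrightarrow> flip_unit j \<circ> g \<in> mlp_symmetries"
| permute: "g \<in> mlp_symmetries \<Longrightarrow> bij \<pi> \<Longrightarrow> permute_units \<pi> \<circ> g \<in> mlp_symmetries"

definition mlp_equiv ::
  "('d::finite, 'h::finite, 'l::finite) weights \<Rightarrow> ('d, 'h, 'l) weights \<Rightarrow> bool" where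
  "mlp_equiv V W \<longleftrightarrow> (\<exists>g\<in>mlp_symmetries. W = g V)"

text \<open>The union of the equivalence classes that meet \<open>\<Theta>\<close>, i.e. the preimage in $R^s$ of
  the image of \<open>\<Theta>\<close> in the quotient space.\<close>

definition mlp_saturation ::
  "('d::finite, 'h::finite, 'l::finite) weights set \<Rightarrow> ('d, 'h, 'l) weights set" where
  "mlp_saturation \<Theta> = {W. \<exists>V\<in>\<Theta>. mlp_equiv V W}"

text \<open>A difference of two equivalence classes is read off from the representatives that
  realise the quotient distance.\<close>

definition closest_representative ::
  "('d::finite, 'h::finite, 'l::finite) weights \<Rightarrow> ('d, 'h, 'l) weights \<Rightarrow> bool" where
  "closest_representative W\<^sub>0 W \<longleftrightarrow> (\<forall>V. mlp_equiv W V \<longrightarrow> dist W W\<^sub>0 \<le> dist V W\<^sub>0)"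

section \<open>The cost function\<close>

definition outer :: "real ^ 'm \<Rightarrow> real ^ 'n \<Rightarrow> real ^ 'n ^ 'm" where
  "outer u v = (\<chi> i j. u $ i * v $ j)"

text \<open>Values in \<^typ>\<open>ereal\<close>: the empirical covariance matrix may be singular (always, if
  $n < d$), and then $\log 0 = -\infty$, whereas \<open>ln 0 = 0\<close> on the reals.\<close>

definition mlp_cost ::
  "(nat \<Rightarrow> real ^ 'd) \<Rightarrow> (nat \<Rightarrow> real ^ 'l) \<Rightarrow> nat
     \<Rightarrow> ('d::finite, 'h::finite, 'l::finite) weights \<Rightarrow> ereal" where
  "mlp_cost y z n W =
     (let D = det ((1 / real n) *\<^sub>R
                (\<Sum>t=1..n. outer (y t - mlp W (z t)) (y t - mlp W (z t))))
      in if D > 0 then ereal (ln D) else - \<infinity>)"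

section \<open>Probabilistic notions\<close>

definition iid :: "'w measure \<Rightarrow> (nat \<Rightarrow> 'w \<Rightarrow> 'a::topological_space) \<Rightarrow> bool" where
  "iid M X \<longleftrightarrow> prob_space.indep_vars M (\<lambda>_. borel) X UNIV
     \<and> (\<forall>s t. distr M borel (X s) = distr M borel (X t))"

text \<open>\<^term>\<open>prob_space.indep_var\<close> would force both variables to have the same type.\<close>

definition independent_rvs ::
  "'w measure \<Rightarrow> ('w \<Rightarrow> 'a::topological_space) \<Rightarrow> ('w \<Rightarrow> 'b::topological_space) \<Rightarrow> bool" where
  "independent_rvs M X Y \<longleftrightarrow> X \<in> borel_measurable M \<and> Y \<in> borel_measurable M
     \<and> prob_space.indep_set M (sets (vimage_algebra (space M) X borel))
                              (sets (vimage_algebra (space M) Y borel))"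

definition covariance_matrix :: "'w measure \<Rightarrow> ('w \<Rightarrow> real ^ 'n) \<Rightarrow> real ^ 'n ^ 'n" where
  "covariance_matrix M X =
     (let m = (LINT \<omega>|M. X \<omega>) in LINT \<omega>|M. outer (X \<omega> - m) (X \<omega> - m))"

definition positive_definite :: "real ^ 'n ^ 'n \<Rightarrow> bool" where
  "positive_definite A \<longleftrightarrow> transpose A = A \<and> (\<forall>x. x \<noteq> 0 \<longrightarrow> 0 < x \<bullet> (A *v x))"

text \<open>Defined by its Lebesgue density, hence meaningful for positive definite \<open>\<Sigma>\<close> only.\<close>

definition multivariate_normal :: "real ^ 'n \<Rightarrow> real ^ 'n ^ 'n \<Rightarrow> (real ^ 'n) measure" where
  "multivariate_normal m \<Sigma> = density lborel (\<lambda>x. ennreal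
     (exp (- ((x - m) \<bullet> (matrix_inv \<Sigma> *v (x - m))) / 2)
        / sqrt ((2 * pi) ^ CARD('n) * det \<Sigma>)))"

definition converges_in_law ::
  "'w measure \<Rightarrow> (nat \<Rightarrow> 'w \<Rightarrow> 'a::topological_space) \<Rightarrow> 'a measure \<Rightarrow> bool" where
  "converges_in_law M X \<mu> \<longleftrightarrow>
     (\<forall>f :: 'a \<Rightarrow> real. continuous_on UNIV f \<and> bounded (range f) \<longrightarrow>
        (\<lambda>n. LINT x|distr M borel (X n). f x) \<longlonglongrightarrow> (LINT x|\<mu>. f x))"

section \<open>The information matrix\<close>

definition mlp_information ::
  "'w measure \<Rightarrow> ('w \<Rightarrow> real ^ 'l) \<Rightarrow> real ^ 'd ^ 'd
     \<Rightarrow> ('d::finite, 'h::finite, 'l::finite) weights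
     \<Rightarrow> real ^ ('d, 'h, 'l) weight_index ^ ('d, 'h, 'l) weight_index" where
  "mlp_information M Z \<Gamma> W = (\<chi> k l. trace (matrix_inv \<Gamma> **
     (LINT \<omega>|M. outer (mlp_partial W k (Z \<omega>)) (mlp_partial W l (Z \<omega>)))))"

end

theory Submission
  imports Defs
begin

text \<open>As the logarithm is monotone, only the determinant of the empirical residual covariance
  \<open>S\<^sub>n\<close> matters. Write \<open>\<xi>\<^sub>n\<close> for the normalised sum of the scores
  \<open>\<Sum>\<^sub>i\<^sub>j P\<^sub>i\<^sub>j \<epsilon>\<^sub>i \<partial>\<^sub>k F\<^sub>j(Z)\<close>, where \<open>P\<close> is the inverse of \<open>\<Gamma>\<^sub>0\<close>; its covariance is \<open>I\<^sub>0\<close>.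
  Strict differentiability of the determinant at \<open>\<Gamma>\<^sub>0\<close> gives, uniformly on a small ball,
  \<open>(det S\<^sub>n(W\<^sub>0 + \<delta>) - det S\<^sub>n(W\<^sub>0)) / det \<Gamma>\<^sub>0 = - 2 \<xi>\<^sub>n \<bullet> \<delta> / sqrt n + \<delta> \<bullet> I\<^sub>0 \<delta>\<close> up to an arbitrarily small
  multiple of \<open>|\<delta>| / sqrt n + |\<delta>|\<^sup>2\<close>. In the cross term of noise and regression function
  the third-order Taylor remainder is bounded by \<open>|\<epsilon>| (1 + |Z|)\<^sup>3 |\<delta>|\<^sup>3\<close>, which is where
  the cube of \<open>Z\<close> has to be integrable, and the second-order part averages to zero by a uniform weak
  law. Completing the square, a consistent minimiser satisfies
  \<open>sqrt n (W\<^sub>n - W\<^sub>0) = I\<^sub>0\<^sup>-\<^sup>1 \<xi>\<^sub>n + o(1)\<close> in probability. Consistency comes from the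
  uniform weak law and from \<open>det (\<Gamma>\<^sub>0 + A) > det \<Gamma>\<^sub>0\<close> for positive semidefinite \<open>A \<noteq> 0\<close>. The
  limit law is identified by the expectations of \<open>cos (u \<bullet> x + b)\<close>, which reduces the central limit
  theorem to dimension one.\<close>

section \<open>Convergence in law through cosines\<close>

text \<open>The estimator is known only as a minimiser, so values of the criterion are compared and
  no score equation is solved. In the scale h = sqrt n * \<delta> the error |\<delta>| / sqrt n +
  |\<delta>|^2 is (|h| + |h|^2) / n; a small multiple of it is absorbed by the positive definite
  form, and the rate of convergence comes out of the same inequality as the limit. This requires an
  expansion on a ball whose radius does not depend on n. The obstacle there is the cross term of
  noise and regression function: bounding its second-order part by absolute values would leave a
  term of order |\<delta>|^2 without a small factor. That part is homogeneous of degree two, so a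
  law of large numbers uniform over the unit ball of directions controls it at every scale. The
  product of the regression increment with itself behaves differently: its error is first order
  times second order, which is already of order |\<delta>|^3. The symmetries of the network are
  isometries that leave its function unchanged; this is why nearest representatives can stand for
  points of the quotient.\<close>

inductive trig_polynomial :: "('a::euclidean_space \<Rightarrow> real) \<Rightarrow> bool" where
  cos: "trig_polynomial (\<lambda>x. c * cos (u \<bullet> x + b))"
| add: "trig_polynomial f \<Longrightarrow> trig_polynomial g \<Longrightarrow> trig_polynomial (\<lambda>x. f x + g x)"

lemma trig_polynomial_const: "trig_polynomial (\<lambda>x. c)"
  using trig_polynomial.cos[of c 0 0] by simp

lemma trig_polynomial_sum:
  assumes "finite I" "\<And>i. i \<in> I \<Longrightarrow> trig_polynomial (f i)"
  shows "trig_polynomial (\<lambda>x. \<Sum>i\<in>I. f i x)"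
  using assms
proof (induction I rule: finite_induct)
  case empty
  then show ?case using trig_polynomial_const[of 0] by simp
next
  case (insert i I)
  then show ?case by (simp add: trig_polynomial.add)
qed

text \<open>The free phase \<open>b\<close> makes every sine a cosine, so the product-to-sum formula
  stays inside the class, with frequencies \<open>u - u'\<close> and \<open>u + u'\<close>. Closure
  under products is what turns polynomials in sines into trigonometric polynomials.\<close>

lemma trig_polynomial_mult:
  assumes "trig_polynomial f" "trig_polynomial g"
  shows "trig_polynomial (\<lambda>x. f x * g x)"
  using assms(1)
proof induction
  case (cos c u b)
  show ?case
    using assms(2)
  proof induction
    case (cos c' u' b')
    have "(\<lambda>x. c * cos (u \<bullet> x + b) * (c' * cos (u' \<bullet> x + b')))
       = (\<lambda>x. (c * c' / 2) * cos ((u - u') \<bullet> x + (b - b')) + (c * c' / 2) * cos ((u + u') \<bullet> x + (b + b')))"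
    proof
      fix x
      have a: "(u - u') \<bullet> x + (b - b') = (u \<bullet> x + b) - (u' \<bullet> x + b')"
              "(u + u') \<bullet> x + (b + b') = (u \<bullet> x + b) + (u' \<bullet> x + b')"
        by (simp_all add: inner_diff_left inner_add_left)
      show "c * cos (u \<bullet> x + b) * (c' * cos (u' \<bullet> x + b')) =
         (c * c' / 2) * cos ((u - u') \<bullet> x + (b - b')) + (c * c' / 2) * cos ((u + u') \<bullet> x + (b + b'))"
        unfolding a cos_diff cos_add by (simp add: field_simps)
    qed
    then show ?case by (simp only: trig_polynomial.intros)
  next
    case (add f g)
    then show ?case by (simp only: distrib_left trig_polynomial.add)
  qed
next
  case (add f g)
  then show ?case by (simp only: distrib_right trig_polynomial.add)
qed

lemma trig_polynomial_bounded_continuous: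
  assumes "trig_polynomial f"
  shows "continuous_on UNIV f \<and> bounded (range f)"
  using assms
proof induction
  case (cos c u b)
  have "\<bar>c * cos (u \<bullet> x + b)\<bar> \<le> \<bar>c\<bar>" for x
    by (simp add: abs_mult mult_left_le)
  then show ?case
    by (auto intro!: continuous_intros boundedI[of _ "\<bar>c\<bar>"])
next
  case (add f g)
  then show ?case by (auto intro!: continuous_intros bounded_plus_comp)
qed

lemma integrable_bounded_continuous:
  fixes f :: "'b::topological_space \<Rightarrow> real"
  assumes "prob_space M" "sets M = sets borel" "continuous_on UNIV f" "bounded (range f)"
  shows "integrable M f"
proof -
  interpret prob_space M by fact
  obtain B where "\<And>x. \<bar>f x\<bar> \<le> B" using assms(4) by (auto simp: bounded_iff)
  moreover have "f \<in> borel_measurable M"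
    using borel_measurable_continuous_onI[OF assms(3)] measurable_cong_sets[OF assms(2) refl] by auto
  ultimately show ?thesis by (intro integrable_const_bound[of _ B]) auto
qed

text \<open>Every continuous function agrees on a large box with one that factors through
  \<open>x \<mapsto> (sin (x\<^sub>i / R))\<^sub>i\<close>, and a polynomial in these sines is a trigonometric polynomial; hence the
  approximation is uniform on the whole space although only compactness of the cube is used.\<close>

lemma trig_polynomial_approximation:
  fixes f :: "'a::euclidean_space \<Rightarrow> real"
  assumes f: "continuous_on UNIV f" and B: "\<And>x. \<bar>f x\<bar> \<le> B" and "e > 0" "K > 0"
  obtains p where "trig_polynomial p" "\<And>x. \<bar>p x\<bar> \<le> B + e"
    "\<And>x. (\<And>b. b \<in> Basis \<Longrightarrow> \<bar>x \<bullet> b\<bar> \<le> K) \<Longrightarrow> \<bar>p x - f x\<bar> \<le> e"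
proof -
  define s where "s x = (\<Sum>b\<in>Basis. sin ((x \<bullet> b) / K) *\<^sub>R b)" for x :: 'a
  define h where "h y = f (\<Sum>b\<in>Basis. (K * arcsin (y \<bullet> b)) *\<^sub>R b)" for y :: 'a
  let ?C = "cbox (- One) One :: 'a set"
  have "continuous_on ?C h"
    unfolding h_def
    by (intro continuous_on_compose2[OF f] continuous_intros) (auto simp: mem_box)
  then obtain g where g: "real_polynomial_function g" "\<And>x. x \<in> ?C \<Longrightarrow> \<bar>h x - g x\<bar> < e"
    using Stone_Weierstrass_real_polynomial_function[of ?C h e] \<open>e > 0\<close> by auto
  have sC: "s x \<in> ?C" for x
    by (simp add: s_def mem_box inner_sum_left_Basis)
  have trig: "trig_polynomial (\<lambda>x. g (s x))"
    using g(1)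
  proof induction
    case (linear f)
    \<comment> \<open>The phase - pi/2 turns each cosine into the sine of a scaled
      coordinate.\<close>
    have "trig_polynomial (\<lambda>x. \<Sum>b\<in>Basis. f b * cos ((1/K) *\<^sub>R b \<bullet> x + (- pi/2)))"
      by (intro trig_polynomial_sum trig_polynomial.cos) auto
    moreover have "f (s x) = (\<Sum>b\<in>Basis. f b * cos ((1/K) *\<^sub>R b \<bullet> x + (- pi/2)))" for x
      unfolding s_def linear_sum[OF bounded_linear.linear[OF linear]]
      by (intro sum.cong)
         (simp_all add: linear_scale[OF bounded_linear.linear[OF linear]] cos_diff inner_commute mult.commute)
    ultimately show ?case by simp
  next
    case (const c) then show ?case by (rule trig_polynomial_const)
  next
    case (add f g) then show ?case by (intro trig_polynomial.add)
  next
    case (mult f g) then show ?case by (intro trig_polynomial_mult)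
  qed
  show ?thesis
  proof (rule that[OF trig])
    fix x
    \<comment> \<open>\<open>s x\<close> never leaves the cube and every value of \<open>h\<close>
      is a value of \<open>f\<close>, so the bound also holds outside the box.\<close>
    have "\<bar>h (s x) - g (s x)\<bar> < e" using g(2) sC by blast
    moreover have "\<bar>h (s x)\<bar> \<le> B" unfolding h_def by (rule B)
    ultimately show "\<bar>g (s x)\<bar> \<le> B + e" by linarith
  next
    fix x :: 'a assume x: "\<And>b. b \<in> Basis \<Longrightarrow> \<bar>x \<bullet> b\<bar> \<le> K"
    have "K * arcsin (s x \<bullet> b) = x \<bullet> b" if b: "b \<in> Basis" for b
    proof -
      \<comment> \<open>Inside the box the scaled coordinate lies in [-1, 1], within the interval
        [-pi/2, pi/2] on which \<open>arcsin\<close> inverts \<open>sin\<close>.\<close>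
      have "\<bar>(x \<bullet> b) / K\<bar> \<le> 1" using x[OF b] \<open>K > 0\<close> by simp
      moreover have "1 \<le> pi / 2" using pi_gt3 by simp
      ultimately have "- (pi/2) \<le> (x \<bullet> b) / K" "(x \<bullet> b) / K \<le> pi / 2" by linarith+
      then have "arcsin (sin ((x \<bullet> b) / K)) = (x \<bullet> b) / K" by (rule arcsin_sin)
      then show ?thesis using \<open>K > 0\<close> b by (simp add: s_def inner_sum_left_Basis)
    qed
    then have "h (s x) = f x" unfolding h_def by (simp add: euclidean_representation)
    then show "\<bar>g (s x) - f x\<bar> \<le> e" using g(2)[OF sC[of x]] by (simp add: abs_minus_commute)
  qed
qed

text \<open>Real and imaginary part are the phases 0 and - pi/2 of one family of cosines;
  convergence of expected cosines thus gives convergence of the characteristic functions of all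
  one-dimensional projections.\<close>

lemma (in prob_space) char_eq_cos_sin:
  fixes X :: "'a \<Rightarrow> 'b::real_inner"
  assumes [measurable]: "(\<lambda>\<omega>. u \<bullet> X \<omega>) \<in> borel_measurable M"
  shows "char (distr M borel (\<lambda>\<omega>. u \<bullet> X \<omega>)) t =
    Complex (LINT \<omega>|M. cos ((t *\<^sub>R u) \<bullet> X \<omega> + 0)) (LINT \<omega>|M. cos ((t *\<^sub>R u) \<bullet> X \<omega> + (-pi/2)))"
proof -
  have c: "integrable M (\<lambda>\<omega>. cos (t * (u \<bullet> X \<omega>)))" "integrable M (\<lambda>\<omega>. sin (t * (u \<bullet> X \<omega>)))"
    by (auto intro!: integrable_const_bound[of _ 1])
  have "char (distr M borel (\<lambda>\<omega>. u \<bullet> X \<omega>)) t = (CLINT \<omega>|M. iexp (t * (u \<bullet> X \<omega>)))"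
    by (simp add: char_def integral_distr)
  also have "\<dots> = (CLINT \<omega>|M. complex_of_real (cos (t * (u \<bullet> X \<omega>))) + \<i> * complex_of_real (sin (t * (u \<bullet> X \<omega>))))"
    by (intro Bochner_Integration.integral_cong) (simp_all only: exp_Euler cos_of_real sin_of_real)
  also have "\<dots> = of_real (LINT \<omega>|M. cos (t * (u \<bullet> X \<omega>))) + \<i> * of_real (LINT \<omega>|M. sin (t * (u \<bullet> X \<omega>)))"
    using c by (subst Bochner_Integration.integral_add) simp_all
  finally show ?thesis by (simp add: complex_eq_iff cos_diff)
qed

lemma real_distribution_marginal_tail:
  fixes \<mu> :: "real measure"
  assumes "real_distribution \<mu>" "e > 0"
  obtains K where "K > 0" "measure \<mu> {x. K \<le> \<bar>x\<bar>} < e"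
proof -
  interpret real_distribution \<mu> by fact
  have "(\<lambda>n. measure \<mu> {x. real n \<le> \<bar>x\<bar>}) \<longlonglongrightarrow> measure \<mu> (\<Inter>n. {x. real n \<le> \<bar>x\<bar>})"
    by (intro finite_Lim_measure_decseq) (auto simp: decseq_def)
  moreover have "(\<Inter>n. {x::real. real n \<le> \<bar>x\<bar>}) = {}"
    using reals_Archimedean2 by (auto simp flip: not_less)
  ultimately have "(\<lambda>n. measure \<mu> {x. real n \<le> \<bar>x\<bar>}) \<longlonglongrightarrow> 0" by simp
  then have "eventually (\<lambda>n. measure \<mu> {x. real n \<le> \<bar>x\<bar>} < e) sequentially"
    using \<open>e > 0\<close> by (rule order_tendstoD)
  then obtain N where N: "\<And>n. n \<ge> N \<Longrightarrow> measure \<mu> {x. real n \<le> \<bar>x\<bar>} < e"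
    by (auto simp: eventually_sequentially)
  show ?thesis using N[of "Suc N"] by (intro that[of "real (Suc N)"]) auto
qed

theorem weak_limit_tail:
  fixes \<mu> :: "nat \<Rightarrow> real measure"
  assumes "\<And>n. real_distribution (\<mu> n)" "real_distribution \<nu>" "weak_conv_m \<mu> \<nu>" "e > 0"
  obtains K where "K > 0" "\<forall>\<^sub>F n in sequentially. measure (\<mu> n) {x. K \<le> \<bar>x\<bar>} < e"
    "measure \<nu> {x. K \<le> \<bar>x\<bar>} < e"
proof -
  obtain K where K: "K > 0" "measure \<nu> {x. K \<le> \<bar>x\<bar>} < e"
    using real_distribution_marginal_tail[OF assms(2,4)] by metis
  interpret \<nu>: real_distribution \<nu> by fact
  interpret \<mu>: real_distribution "\<mu> n" for n by fact
  \<comment> \<open>A continuous ramp between the indicators of |x| \<ge> K + 1 and |x| \<ge> K.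
    Weak convergence tests continuous functions only, so a tail bound at \<open>K\<close> for the
    limit becomes one at \<open>K + 1\<close> for the sequence.\<close>
  define g where "g x = max 0 (min 1 (\<bar>x\<bar> - K))" for x :: real
  have [measurable]: "g \<in> borel_measurable borel" unfolding g_def by measurable
  have "(\<lambda>n. integral\<^sup>L (\<mu> n) g) \<longlonglongrightarrow> integral\<^sup>L \<nu> g"
    by (rule weak_conv_imp_integral_bdd_continuous_conv[of \<mu> \<nu> g 1])
       (use assms in \<open>auto simp: g_def[abs_def] intro!: continuous_intros\<close>)
  moreover have gint: "integrable \<nu> g" "integrable (\<mu> n) g" for n
    by (auto intro!: \<nu>.integrable_const_bound[of _ 1] \<mu>.integrable_const_bound[of _ 1] simp: g_def)
  have "integral\<^sup>L \<nu> g \<le> (LINT x|\<nu>. indicator {x. K \<le> \<bar>x\<bar>} x)"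
    by (intro integral_mono gint \<nu>.integrable_const_bound[of _ 1])
       (auto simp: g_def indicator_def)
  then have "integral\<^sup>L \<nu> g < e" using K(2) by simp
  ultimately have ev: "eventually (\<lambda>n. integral\<^sup>L (\<mu> n) g < e) sequentially"
    by (intro order_tendstoD)
  have le: "measure (\<mu> n) {x. K + 1 \<le> \<bar>x\<bar>} \<le> integral\<^sup>L (\<mu> n) g" for n
  proof -
    have "(LINT x|\<mu> n. indicator {x. K + 1 \<le> \<bar>x\<bar>} x) \<le> integral\<^sup>L (\<mu> n) g"
      by (intro integral_mono gint \<mu>.integrable_const_bound[of _ 1])
         (auto simp: g_def indicator_def)
    then show ?thesis by simp
  qed
  have "measure \<nu> {x. K + 1 \<le> \<bar>x\<bar>} \<le> measure \<nu> {x. K \<le> \<bar>x\<bar>}"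
    by (intro \<nu>.finite_measure_mono) auto
  then have 2: "measure \<nu> {x. K + 1 \<le> \<bar>x\<bar>} < e" using K(2) by simp
  have 1: "\<forall>\<^sub>F n in sequentially. measure (\<mu> n) {x. K + 1 \<le> \<bar>x\<bar>} < e"
    using ev by (rule eventually_mono) (rule le_less_trans[OF le])
  show ?thesis by (rule that[OF _ 1 2]) (use K(1) in simp)
qed

text \<open>A Cramer-Wold argument. Levy's theorem applied to the coordinates supplies tightness; on
  a box carrying almost all mass a test function is then replaced by a globally bounded
  trigonometric polynomial, whose expectations converge by hypothesis.\<close>

theorem converges_in_law_cos:
  fixes X :: "nat \<Rightarrow> 'w \<Rightarrow> 'a::euclidean_space"
  assumes M: "prob_space M" and X[measurable]: "\<And>n. X n \<in> borel_measurable M"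
    and mu: "prob_space \<mu>" and sets_mu[simp, measurable_cong]: "sets \<mu> = sets borel"
    and conv: "\<And>u b. (\<lambda>n. LINT \<omega>|M. cos (u \<bullet> X n \<omega> + b)) \<longlonglongrightarrow> (LINT x|\<mu>. cos (u \<bullet> x + b))"
  shows "converges_in_law M X \<mu>"
  unfolding converges_in_law_def
proof (intro allI impI)
  fix f :: "'a \<Rightarrow> real" assume f: "continuous_on UNIV f \<and> bounded (range f)"
  interpret M: prob_space M by fact
  interpret mu: prob_space \<mu> by fact
  interpret Xn: prob_space "distr M borel (X n)" for n by (rule M.prob_space_distr) simp
  obtain B where B: "\<And>x. \<bar>f x\<bar> \<le> B" using f by (auto simp: bounded_iff)
  have "B \<ge> 0" using B[of 0] by linarith
  have fm[measurable]: "f \<in> borel_measurable borel"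
    using f by (intro borel_measurable_continuous_onI) auto
  have marg: "weak_conv_m (\<lambda>n. distr M borel (\<lambda>\<omega>. u \<bullet> X n \<omega>)) (distr \<mu> borel (\<lambda>x. u \<bullet> x))" for u
  proof (rule levy_continuity)
    show "real_distribution (distr M borel (\<lambda>\<omega>. u \<bullet> X n \<omega>))" for n
      by (intro M.real_distribution_distr) measurable
    show "real_distribution (distr \<mu> borel (\<lambda>x. u \<bullet> x))"
      by (intro mu.real_distribution_distr) measurable
    show "(\<lambda>n. char (distr M borel (\<lambda>\<omega>. u \<bullet> X n \<omega>)) t) \<longlonglongrightarrow> char (distr \<mu> borel (\<lambda>x. u \<bullet> x)) t" for t
    proof -
      have 1: "char (distr M borel (\<lambda>\<omega>. u \<bullet> X n \<omega>)) t =
        Complex (LINT \<omega>|M. cos ((t *\<^sub>R u) \<bullet> X n \<omega> + 0)) (LINT \<omega>|M. cos ((t *\<^sub>R u) \<bullet> X n \<omega> + (-pi/2)))" for n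
        by (rule M.char_eq_cos_sin) measurable
      have 2: "char (distr \<mu> borel (\<lambda>x. u \<bullet> x)) t =
        Complex (LINT x|\<mu>. cos ((t *\<^sub>R u) \<bullet> x + 0)) (LINT x|\<mu>. cos ((t *\<^sub>R u) \<bullet> x + (-pi/2)))"
        by (rule mu.char_eq_cos_sin) measurable
      show ?thesis unfolding 1 2 by (intro tendsto_Complex conv)
    qed
  qed
  have tp: "(\<lambda>n. LINT \<omega>|M. p (X n \<omega>)) \<longlonglongrightarrow> (LINT x|\<mu>. p x)" if "trig_polynomial p" for p
    using that
  proof induction
    case (cos c u b)
    then show ?case using tendsto_mult_left[OF conv[of u b], of c] by simp
  next
    case (add f g)
    note bc = add.hyps[THEN trig_polynomial_bounded_continuous]
    have [measurable]: "f \<in> borel_measurable borel" "g \<in> borel_measurable borel"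
      using bc by (auto intro: borel_measurable_continuous_onI)
    have "integrable (distr M borel (X n)) f" "integrable (distr M borel (X n)) g" for n
      using bc by (auto intro!: integrable_bounded_continuous Xn.prob_space_axioms)
    then have "integrable M (\<lambda>\<omega>. f (X n \<omega>))" "integrable M (\<lambda>\<omega>. g (X n \<omega>))" for n
      by (simp_all add: integrable_distr_eq)
    moreover have "integrable \<mu> f" "integrable \<mu> g"
      using bc by (auto intro!: integrable_bounded_continuous mu.prob_space_axioms)
    ultimately show ?case using tendsto_add[OF add.IH] by simp
  qed
  show "(\<lambda>n. LINT x|distr M borel (X n). f x) \<longlonglongrightarrow> (LINT x|\<mu>. f x)"
  proof (rule LIMSEQ_I)
    fix r :: real assume "r > 0"
    define e where "e = min 1 (r / 8)"
    have e: "e > 0" "e \<le> 1" "e \<le> r / 8" using \<open>r > 0\<close> by (auto simp: e_def)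
    \<comment> \<open>With one tail of mass \<open>k\<close> per coordinate, the box misses mass at
      most \<open>DIM('a) * k\<close>; multiplied by the bound \<open>2 * (B + 1)\<close> on the
      integrand this is r / 16.\<close>
    define k where "k = r / (32 * (B + 1) * real DIM('a))"
    have k: "k > 0" using \<open>r > 0\<close> \<open>B \<ge> 0\<close> by (simp add: k_def)
    have "\<forall>b::'a. \<exists>K. K > 0 \<and> (\<forall>\<^sub>F n in sequentially. measure M {\<omega>\<in>space M. K \<le> \<bar>X n \<omega> \<bullet> b\<bar>} < k) \<and>
      measure \<mu> {x\<in>space \<mu>. K \<le> \<bar>x \<bullet> b\<bar>} < k"
    proof
      fix b :: 'a
      obtain K where K: "K > 0"
        "\<forall>\<^sub>F n in sequentially. measure (distr M borel (\<lambda>\<omega>. b \<bullet> X n \<omega>)) {x. K \<le> \<bar>x\<bar>} < k"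
        "measure (distr \<mu> borel (\<lambda>x. b \<bullet> x)) {x. K \<le> \<bar>x\<bar>} < k"
        by (rule weak_limit_tail[OF _ _ marg k]) (auto intro!: M.real_distribution_distr mu.real_distribution_distr)
      have "measure (distr M borel (\<lambda>\<omega>. b \<bullet> X n \<omega>)) {x. K \<le> \<bar>x\<bar>} = measure M {\<omega>\<in>space M. K \<le> \<bar>X n \<omega> \<bullet> b\<bar>}" for n
        by (subst measure_distr) (auto simp: vimage_def Int_def inner_commute conj_commute)
      moreover have "measure (distr \<mu> borel (\<lambda>x. b \<bullet> x)) {x. K \<le> \<bar>x\<bar>} = measure \<mu> {x\<in>space \<mu>. K \<le> \<bar>x \<bullet> b\<bar>}"
        by (subst measure_distr) (auto simp: vimage_def Int_def inner_commute conj_commute)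
      ultimately show "\<exists>K. K > 0 \<and> (\<forall>\<^sub>F n in sequentially. measure M {\<omega>\<in>space M. K \<le> \<bar>X n \<omega> \<bullet> b\<bar>} < k) \<and>
        measure \<mu> {x\<in>space \<mu>. K \<le> \<bar>x \<bullet> b\<bar>} < k" using K by auto
    qed
    from choice[OF this] obtain K where K: "\<And>b::'a. K b > 0"
      "\<And>b. \<forall>\<^sub>F n in sequentially. measure M {\<omega>\<in>space M. K b \<le> \<bar>X n \<omega> \<bullet> b\<bar>} < k"
      "\<And>b. measure \<mu> {x\<in>space \<mu>. K b \<le> \<bar>x \<bullet> b\<bar>} < k" by blast
    define L where "L = Max (K ` Basis)"
    have L: "K b \<le> L" if "b \<in> Basis" for b using that by (auto simp: L_def)
    have "L > 0" using less_le_trans[OF K(1) L[OF SOME_Basis]] .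
    define A where "A = {x::'a. \<forall>b\<in>Basis. \<bar>x \<bullet> b\<bar> \<le> L}"
    have "closed A" 
    proof -
      have "A = (\<Inter>b\<in>Basis. {x. \<bar>x \<bullet> b\<bar> \<le> L})" by (auto simp: A_def)
      then show ?thesis by (auto intro!: closed_INT closed_Collect_le continuous_intros)
    qed
    then have [measurable]: "A \<in> sets borel" by simp
    obtain p where p: "trig_polynomial p" "\<And>x. \<bar>p x\<bar> \<le> B + e" "\<And>x. x \<in> A \<Longrightarrow> \<bar>p x - f x\<bar> \<le> e"
      by (rule trig_polynomial_approximation[OF conjunct1[OF f] B e(1) \<open>L > 0\<close>]) (simp add: A_def)
    note pc = trig_polynomial_bounded_continuous[OF p(1)]
    have [measurable]: "p \<in> borel_measurable borel"
      using pc by (auto intro: borel_measurable_continuous_onI)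
    \<comment> \<open>Stated for any law with small tails, since it is applied to the limit and to
      the law of \<open>X n\<close>. Outside the box the integrand is at most 2 B + e with e \<le>
      1. Two such errors and the r / 8 from convergence for \<open>p\<close> stay below r.\<close>
    have bnd: "\<bar>(LINT x|N. p x) - (LINT x|N. f x)\<bar> \<le> 3 * r / 8"
      if N: "prob_space N" "sets N = sets borel" and tail: "\<And>b. b \<in> Basis \<Longrightarrow> measure N {x\<in>space N. K b \<le> \<bar>x \<bullet> b\<bar>} < k" for N
    proof -
      interpret N: prob_space N by fact
      have sN: "space N = UNIV" using sets_eq_imp_space_eq[OF N(2)] by simp
      note [measurable_cong] = N(2)
      have ip: "integrable N p" "integrable N f"
        using pc f N(2) by (auto intro!: integrable_bounded_continuous N.prob_space_axioms)
      have setb: "{x\<in>space N. K b \<le> \<bar>x \<bullet> b\<bar>} \<in> sets N" for b by measurable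
      have setU: "(\<Union>b\<in>Basis. {x\<in>space N. K b \<le> \<bar>x \<bullet> b\<bar>}) \<in> sets N"
        by (rule sets.finite_UN) (simp_all only: finite_Basis setb)
      have "measure N (- A) \<le> measure N (\<Union>b\<in>Basis. {x\<in>space N. K b \<le> \<bar>x \<bullet> b\<bar>})"
      proof (intro N.finite_measure_mono)
        show "- A \<subseteq> (\<Union>b\<in>Basis. {x\<in>space N. K b \<le> \<bar>x \<bullet> b\<bar>})"
        proof
          fix x assume "x \<in> - A"
          then obtain b where b: "b \<in> Basis" "L < \<bar>x \<bullet> b\<bar>" by (auto simp: A_def not_le)
          then show "x \<in> (\<Union>b\<in>Basis. {x\<in>space N. K b \<le> \<bar>x \<bullet> b\<bar>})"
            using L[OF b(1)] by (intro UN_I[OF b(1)]) (simp add: sN)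
        qed
      qed (rule setU)
      also have "\<dots> \<le> (\<Sum>b\<in>Basis. measure N {x\<in>space N. K b \<le> \<bar>x \<bullet> b\<bar>})"
        by (rule N.finite_measure_subadditive_finite) (use setb in \<open>simp_all add: image_subset_iff\<close>)
      also have "\<dots> \<le> (\<Sum>b\<in>(Basis::'a set). k)" using tail by (intro sum_mono) (simp add: less_imp_le)
      also have "\<dots> = DIM('a) * k" by simp
      finally have mA: "measure N (- A) \<le> DIM('a) * k" .
      have "\<bar>(LINT x|N. p x) - (LINT x|N. f x)\<bar> = \<bar>LINT x|N. p x - f x\<bar>"
        using ip by simp
      also have "\<dots> \<le> (LINT x|N. \<bar>p x - f x\<bar>)" by (rule integral_abs_bound)
      also have "\<dots> \<le> (LINT x|N. e + (2 * (B + 1)) * indicator (- A) x)"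
      proof (intro integral_mono)
        show "integrable N (\<lambda>x. e + (2 * (B + 1)) * indicator (- A) x)"
          by (intro Bochner_Integration.integrable_add integrable_mult_right N.integrable_const integrable_real_indicator)
             (auto simp: N.emeasure_eq_measure)
        show "\<bar>p x - f x\<bar> \<le> e + 2 * (B + 1) * indicator (- A) x" for x
          using p(2)[of x] p(3)[of x] B[of x] e \<open>B \<ge> 0\<close> by (cases "x \<in> A") auto
      qed (use ip in auto)
      also have "\<dots> = e + 2 * (B + 1) * measure N (- A)"
        by (subst Bochner_Integration.integral_add) (use N.prob_space in \<open>auto simp: sN N.emeasure_eq_measure\<close>)
      also have "\<dots> \<le> e + 2 * (B + 1) * (DIM('a) * k)"
        using mA \<open>B \<ge> 0\<close> by (intro add_left_mono mult_left_mono) auto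
      also have "\<dots> = e + r / 16" 
      proof -
        have "2 * c * (d * (r / (32 * c * d))) = r / 16" if "c \<noteq> 0" "d \<noteq> 0" for c d :: real
          using that by (simp add: field_simps)
        from this[of "B + 1" "real DIM('a)"] show ?thesis using \<open>B \<ge> 0\<close> by (simp add: k_def)
      qed
      finally show ?thesis using e \<open>r > 0\<close> by linarith
    qed
    have b1: "\<bar>(LINT x|\<mu>. p x) - (LINT x|\<mu>. f x)\<bar> \<le> 3 * r / 8"
      using K(3) by (intro bnd mu) auto
    have "\<forall>\<^sub>F n in sequentially. \<forall>b\<in>Basis. measure M {\<omega>\<in>space M. K b \<le> \<bar>X n \<omega> \<bullet> b\<bar>} < k"
      using K(2) by (simp add: eventually_ball_finite_distrib)
    moreover have "\<forall>\<^sub>F n in sequentially. \<bar>(LINT \<omega>|M. p (X n \<omega>)) - (LINT x|\<mu>. p x)\<bar> < r / 8"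
      using tendstoD[OF tp[OF p(1)], of "r / 8"] \<open>r > 0\<close> by (simp add: dist_real_def)
    ultimately have "\<forall>\<^sub>F n in sequentially. norm ((LINT x|distr M borel (X n). f x) - (LINT x|\<mu>. f x)) < r"
    proof eventually_elim
      case (elim n)
      have "\<bar>(LINT x|distr M borel (X n). p x) - (LINT x|distr M borel (X n). f x)\<bar> \<le> 3 * r / 8"
      proof (rule bnd)
        fix b :: 'a assume "b \<in> Basis"
        have "measure (distr M borel (X n)) {x\<in>space (distr M borel (X n)). K b \<le> \<bar>x \<bullet> b\<bar>} = measure M {\<omega>\<in>space M. K b \<le> \<bar>X n \<omega> \<bullet> b\<bar>}"
          by (subst measure_distr) (auto simp: vimage_def Int_def conj_commute)
        then show "measure (distr M borel (X n)) {x\<in>space (distr M borel (X n)). K b \<le> \<bar>x \<bullet> b\<bar>} < k"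
          using elim(1) \<open>b \<in> Basis\<close> by simp
      qed (use Xn.prob_space_axioms in auto)
      moreover have "(LINT x|distr M borel (X n). p x) = (LINT \<omega>|M. p (X n \<omega>))"
        by (simp add: integral_distr)
      ultimately show ?case using b1 elim(2) \<open>r > 0\<close> unfolding real_norm_def by linarith
    qed
    then show "\<exists>no. \<forall>n\<ge>no. norm ((LINT x|distr M borel (X n). f x) - (LINT x|\<mu>. f x)) < r"
      by (simp add: eventually_sequentially)
  qed
qed

section \<open>Linear changes of variables and Gaussian vectors\<close>

text \<open>Fubini with the coordinate \<open>m\<close> innermost: as \<open>n\<close> is another
  coordinate, the shear acts on each fibre as a translation by a constant, and one-dimensional
  Lebesgue measure is translation invariant.\<close>

lemma nn_integral_lborel_shear:
  fixes f :: "'a::euclidean_space \<Rightarrow> ennreal"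
  assumes [measurable]: "f \<in> borel_measurable borel" and m: "m \<in> Basis" and n: "n \<in> Basis" and "m \<noteq> n"
  shows "(\<integral>\<^sup>+x. f (x + (c * (x \<bullet> n)) *\<^sub>R m) \<partial>lborel) = (\<integral>\<^sup>+x. f x \<partial>lborel)"
proof -
  interpret product_sigma_finite "\<lambda>_::'a. lborel :: real measure" ..
  let ?B = "Basis - {m} :: 'a set"
  have B: "Basis = insert m ?B" using m by auto
  define E where "E g = (\<Sum>b\<in>Basis. g b *\<^sub>R b)" for g :: "'a \<Rightarrow> real"
  have En: "E g \<bullet> n = g n" for g using n by (simp add: E_def inner_sum_left_Basis)
  have Eu: "E (g(m := y)) = y *\<^sub>R m + (\<Sum>b\<in>?B. g b *\<^sub>R b)" for g y
    using m unfolding E_def by (subst B, subst sum.insert) auto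
  have shift: "E (g(m := y)) + c *\<^sub>R m = E (g(m := c + y))" for g y c
    unfolding Eu by (simp add: algebra_simps)
  have [measurable]: "E \<in> borel_measurable (Pi\<^sub>M Basis (\<lambda>_. lborel))"
    unfolding E_def by measurable
  have pull: "(\<integral>\<^sup>+x. h x \<partial>lborel) = (\<integral>\<^sup>+g. \<integral>\<^sup>+y. h (E (g(m := y))) \<partial>lborel \<partial>Pi\<^sub>M ?B (\<lambda>_. lborel))"
    if [measurable]: "h \<in> borel_measurable borel" for h :: "'a \<Rightarrow> ennreal"
  proof -
    have "(\<integral>\<^sup>+x. h x \<partial>lborel) = (\<integral>\<^sup>+g. h (E g) \<partial>Pi\<^sub>M Basis (\<lambda>_. lborel))"
      by (subst lborel_eq) (simp add: nn_integral_distr E_def[symmetric])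
    also have "\<dots> = (\<integral>\<^sup>+g. \<integral>\<^sup>+y. h (E (g(m := y))) \<partial>lborel \<partial>Pi\<^sub>M ?B (\<lambda>_. lborel))"
      using m by (subst B, subst product_nn_integral_insert) (auto simp: insert_absorb)
    finally show ?thesis .
  qed
  have "(\<integral>\<^sup>+x. f (x + (c * (x \<bullet> n)) *\<^sub>R m) \<partial>lborel) =
     (\<integral>\<^sup>+g. \<integral>\<^sup>+y. f (E (g(m := c * g n + 1 * y))) \<partial>lborel \<partial>Pi\<^sub>M ?B (\<lambda>_. lborel))"
    using \<open>m \<noteq> n\<close> by (subst pull) (auto simp: En shift)
  also have "\<dots> = (\<integral>\<^sup>+g. \<integral>\<^sup>+y. f (E (g(m := y))) \<partial>lborel \<partial>Pi\<^sub>M ?B (\<lambda>_. lborel))"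
  proof (rule nn_integral_cong)
    fix g assume "g \<in> space (Pi\<^sub>M ?B (\<lambda>_. lborel :: real measure))"
    have [measurable]: "(\<lambda>y. f (E (g(m := y)))) \<in> borel_measurable borel"
      unfolding Eu by measurable
    show "(\<integral>\<^sup>+y. f (E (g(m := c * g n + 1 * y))) \<partial>lborel) = (\<integral>\<^sup>+y. f (E (g(m := y))) \<partial>lborel)"
      using nn_integral_real_affine[of "\<lambda>y. f (E (g(m := y)))" 1 "c * g n"] by simp
  qed
  also have "\<dots> = (\<integral>\<^sup>+x. f x \<partial>lborel)" by (rule pull[symmetric]) simp
  finally show ?thesis .
qed

lemma matrix_vector_mult_diagonal:
  fixes A :: "real ^ 'n ^ 'n"
  assumes "\<And>i j. i \<noteq> j \<Longrightarrow> A $ i $ j = 0"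
  shows "A *v x = (\<chi> i. A $ i $ i * x $ i)"
proof -
  have "(\<Sum>j\<in>UNIV. A $ i $ j * x $ j) = (\<Sum>j\<in>{i}. A $ i $ j * x $ j)" for i
    by (rule sum.mono_neutral_right) (use assms in auto)
  then show ?thesis by (simp add: matrix_vector_mult_def vec_eq_iff)
qed

lemma prod_Basis_vec:
  "(\<Prod>b\<in>(Basis :: (real ^ 'n) set). f b) = (\<Prod>i\<in>UNIV. f (axis i 1))"
proof -
  have 1: "(Basis :: (real ^ 'n) set) = range (\<lambda>i::'n. axis i 1)" by (auto simp: Basis_vec_def)
  have 2: "inj (\<lambda>i::'n. axis i (1::real))" by (auto simp: inj_on_def axis_eq_axis)
  show ?thesis unfolding 1 by (subst prod.reindex[OF 2]) simp
qed

text \<open>Change of variables by decomposition into elementary matrices: diagonal matrices scale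
  the coordinates, swaps permute them, and transvections are shears.\<close>

theorem nn_integral_lborel_matrix:
  fixes A :: "real ^ 'n ^ 'n"
  assumes "det A \<noteq> 0" "f \<in> borel_measurable borel"
  shows "(\<integral>\<^sup>+x. f x \<partial>lborel) = ennreal \<bar>det A\<bar> * (\<integral>\<^sup>+x. f (A *v x) \<partial>lborel)"
proof -
  have [measurable]: "(*v) A \<in> borel_measurable borel" for A :: "real ^ 'n ^ 'n"
    by (rule borel_measurable_continuous_onI[OF linear_continuous_on[OF matrix_vector_mul_bounded_linear]])
  \<comment> \<open>The nonzero determinant is a premise inside the induction predicate: matrices
    with a zero row are then vacuous, and a product hands the premise to both factors.\<close>
  define P where "P A \<longleftrightarrow> (det A \<noteq> 0 \<longrightarrow> (\<forall>f\<in>borel_measurable borel.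
    (\<integral>\<^sup>+x. f x \<partial>lborel) = ennreal \<bar>det A\<bar> * (\<integral>\<^sup>+x. f (A *v x) \<partial>lborel)))" for A :: "real ^ 'n ^ 'n"
  have PD: "(\<integral>\<^sup>+x. f x \<partial>lborel) = ennreal \<bar>det A\<bar> * (\<integral>\<^sup>+x. f (A *v x) \<partial>lborel)"
    if "P A" "det A \<noteq> 0" "f \<in> borel_measurable borel" for A f
    using that(1)[unfolded P_def, rule_format, OF that(2,3)] .
  have "P A"
  proof (rule induct_matrix_elementary[where P = P])
    fix A B :: "real ^ 'n ^ 'n" assume A: "P A" and B: "P B"
    show "P (A ** B)"
      unfolding P_def
    proof (intro impI ballI)
      fix f :: "real ^ 'n \<Rightarrow> ennreal" assume d: "det (A ** B) \<noteq> 0" and [measurable]: "f \<in> borel_measurable borel"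
      have "(\<integral>\<^sup>+x. f x \<partial>lborel) = ennreal \<bar>det A\<bar> * (\<integral>\<^sup>+x. f (A *v x) \<partial>lborel)"
        using d by (intro PD[OF A]) (simp_all add: det_mul)
      also have "(\<integral>\<^sup>+x. f (A *v x) \<partial>lborel) = ennreal \<bar>det B\<bar> * (\<integral>\<^sup>+x. f (A *v (B *v x)) \<partial>lborel)"
      proof -
        have "(\<lambda>x. f (A *v x)) \<in> borel_measurable borel" by measurable
        moreover have "det B \<noteq> 0" using d by (simp add: det_mul)
        ultimately show ?thesis by (intro PD[OF B])
      qed
      finally show "(\<integral>\<^sup>+x. f x \<partial>lborel) = ennreal \<bar>det (A ** B)\<bar> * (\<integral>\<^sup>+x. f ((A ** B) *v x) \<partial>lborel)"
        by (simp add: det_mul abs_mult ennreal_mult matrix_vector_mul_assoc mult.assoc)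
    qed
  next
    fix A :: "real ^ 'n ^ 'n" and i assume "row i A = 0"
    then show "P A" by (simp add: P_def det_zero_row)
  next
    fix A :: "real ^ 'n ^ 'n" assume diag: "\<And>i j. i \<noteq> j \<Longrightarrow> A $ i $ j = 0"
    show "P A"
      unfolding P_def
    proof (intro impI ballI)
      fix f :: "real ^ 'n \<Rightarrow> ennreal" assume d: "det A \<noteq> 0" and [measurable]: "f \<in> borel_measurable borel"
      define c where "c b = (A *v b) \<bullet> b" for b
      have cA: "c (axis i 1) = A $ i $ i" for i
        by (simp add: c_def matrix_vector_mult_diagonal[OF diag] inner_axis)
      have detA: "det A = (\<Prod>b\<in>Basis. c b)"
        by (simp add: det_diagonal[OF diag] prod_Basis_vec cA)
      have T: "0 + (\<Sum>j\<in>Basis. (c j * (x \<bullet> j)) *\<^sub>R j) = A *v x" for x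
      proof (rule euclidean_eqI)
        fix b :: "real ^ 'n" assume b: "b \<in> Basis"
        then obtain i where i: "b = axis i 1" by (auto simp: Basis_vec_def)
        have "(0 + (\<Sum>j\<in>Basis. (c j * (x \<bullet> j)) *\<^sub>R j)) \<bullet> b = c b * (x \<bullet> b)"
          using b by (simp add: inner_sum_left_Basis)
        also have "\<dots> = (A *v x) \<bullet> b"
          unfolding i by (simp add: cA inner_axis matrix_vector_mult_diagonal[OF diag])
        finally show "(0 + (\<Sum>j\<in>Basis. (c j * (x \<bullet> j)) *\<^sub>R j)) \<bullet> b = (A *v x) \<bullet> b" .
      qed
      have "lborel = density (distr lborel borel (\<lambda>x. 0 + (\<Sum>j\<in>Basis. (c j * (x \<bullet> j)) *\<^sub>R j))) (\<lambda>_. (\<Prod>j\<in>Basis. \<bar>c j\<bar>))"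
        using d by (intro lborel_affine_euclidean) (auto simp: detA)
      then have l: "lborel = density (distr lborel borel ((*v) A)) (\<lambda>_. ennreal \<bar>det A\<bar>)"
        unfolding T by (simp add: detA abs_prod)
      show "(\<integral>\<^sup>+x. f x \<partial>lborel) = ennreal \<bar>det A\<bar> * (\<integral>\<^sup>+x. f (A *v x) \<partial>lborel)"
        by (subst l) (simp add: nn_integral_density nn_integral_distr nn_integral_cmult)
    qed
  next
    fix m n :: 'n assume "m \<noteq> n"
    let ?p = "Transposition.transpose m n"
    define S where "S = (\<chi> i j. (mat 1 :: real ^ 'n ^ 'n) $ i $ ?p j)"
    have p: "?p permutes UNIV" by (simp add: permutes_swap_id)
    have Sv: "S *v x = (\<chi> i. x $ ?p i)" for x
    proof -
      have "(\<Sum>j\<in>UNIV. (if i = ?p j then 1 else 0) * x $ j) = x $ ?p i" for i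
      proof -
        have "(i = ?p j) = (j = ?p i)" for j by (metis transpose_involutory)
        then show ?thesis by (simp add: if_distrib[of "\<lambda>z. z * _"] cong: if_cong)
      qed
      then show ?thesis by (simp add: S_def matrix_vector_mult_def mat_def vec_eq_iff)
    qed
    have dS: "\<bar>det S\<bar> = 1"
      unfolding S_def by (subst det_permute_columns[OF p]) (simp add: sign_def)
    \<comment> \<open>Lebesgue measure is determined by the volumes of boxes. The swap is its own
      inverse, so the preimage of a box is the box with swapped corners, which has the same side
      lengths.\<close>
    have l: "lborel = distr lborel borel ((*v) S)"
    proof (rule lborel_eqI)
      fix l u :: "real ^ 'n" assume le: "\<And>b. b \<in> Basis \<Longrightarrow> l \<bullet> b \<le> u \<bullet> b"
      have le': "l $ i \<le> u $ i" for i using le[of "axis i 1"] by (simp add: inner_axis)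
      have pp: "?p (?p i) = i" for i by simp
      have "(*v) S -` box l u = box (S *v l) (S *v u)"
        by (auto simp: Sv mem_box_cart) (metis pp)+
      then have "emeasure (distr lborel borel ((*v) S)) (box l u) = emeasure lborel (box (S *v l) (S *v u))"
        by (simp add: emeasure_distr)
      also have "\<dots> = (\<Prod>b\<in>Basis. (S *v u - S *v l) \<bullet> b)"
        by (rule emeasure_lborel_box) (auto simp: Basis_vec_def Sv inner_axis le')
      also have "(\<Prod>b\<in>Basis. (S *v u - S *v l) \<bullet> b) = (\<Prod>i\<in>UNIV. u $ ?p i - l $ ?p i)"
        by (simp add: prod_Basis_vec inner_axis Sv)
      also have "\<dots> = (\<Prod>i\<in>UNIV. u $ i - l $ i)"
        by (rule prod.permute[OF p, unfolded comp_def, symmetric])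
      also have "\<dots> = (\<Prod>b\<in>Basis. (u - l) \<bullet> b)"
        by (simp add: prod_Basis_vec inner_axis)
      finally show "emeasure (distr lborel borel ((*v) S)) (box l u) = (\<Prod>b\<in>Basis. (u - l) \<bullet> b)" .
    qed simp
    have "P S"
      unfolding P_def dS
    proof (intro impI ballI)
      fix f :: "real ^ 'n \<Rightarrow> ennreal" assume [measurable]: "f \<in> borel_measurable borel"
      show "(\<integral>\<^sup>+x. f x \<partial>lborel) = ennreal 1 * (\<integral>\<^sup>+x. f (S *v x) \<partial>lborel)"
        by (subst l) (simp add: nn_integral_distr)
    qed
    then show "P (\<chi> i j. mat 1 $ i $ ?p j)" by (simp only: S_def)
  next
    fix m n :: 'n and c :: real assume "m \<noteq> n"
    define S where "S = (\<chi> i j. if i = m \<and> j = n then c else (of_bool (i = j) :: real))"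
    have "S = (\<chi> k. if k = m then row m (mat 1) + c *s row n (mat 1) else row k (mat 1))"
      using \<open>m \<noteq> n\<close> by (auto simp: S_def row_def vec_eq_iff mat_def)
    then have dS: "det S = 1"
      using det_row_operation[OF \<open>m \<noteq> n\<close>, of "mat 1" c] by simp
    have Sv: "S *v x = x + (c * (x \<bullet> axis n 1)) *\<^sub>R axis m 1" for x
    proof -
      have "(\<Sum>j\<in>UNIV. (if i = m \<and> j = n then c else of_bool (i = j)) * x $ j) =
        (\<Sum>j\<in>UNIV. (if j = i then x $ j else 0) + (if j = n then (if i = m then c * x $ j else 0) else 0))" for i
        using \<open>m \<noteq> n\<close> by (intro sum.cong) auto
      moreover have "x \<bullet> axis n 1 = x $ n" by (simp add: inner_axis)
      ultimately show ?thesis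
        by (auto simp: S_def matrix_vector_mult_def vec_eq_iff sum.distrib axis_def)
    qed
    have "P S"
      unfolding P_def dS Sv using \<open>m \<noteq> n\<close>
      by (auto simp: nn_integral_lborel_shear axis_eq_axis)
    then show "P (\<chi> i j. if i = m \<and> j = n then c else of_bool (i = j))" by (simp only: S_def)
  qed
  then show ?thesis using assms by (rule PD)
qed

section \<open>Normalising positive definite quadratic forms\<close>

lemma inner_matrix_vector_mult_left:
  fixes A :: "real ^ 'n ^ 'm"
  shows "(A *v x) \<bullet> y = x \<bullet> (transpose A *v y)"
  by (metis dot_lmul_matrix inner_commute transpose_matrix_vector)

lemma inner_matrix_vector_mult_commute:
  fixes A :: "real ^ 'n ^ 'n"
  assumes "transpose A = A"
  shows "x \<bullet> (A *v y) = y \<bullet> (A *v x)"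
  by (metis assms inner_commute inner_matrix_vector_mult_left)

text \<open>Gram-Schmidt for the inner product given by \<open>Q\<close>: \<open>p\<close> is the
  projection of the new vector on the span so far. If the vector equals \<open>p\<close> the family
  already suffices, otherwise the normalised difference is added.\<close>

lemma conjugate_basis_exists:
  fixes Q :: "real ^ 'n ^ 'n"
  assumes Q: "positive_definite Q" and "finite S"
  shows "\<exists>T. finite T \<and> (\<forall>s\<in>T. \<forall>t\<in>T. s \<bullet> (Q *v t) = of_bool (s = t)) \<and> S \<subseteq> span T"
  using assms(2)
proof (induction S rule: finite_induct)
  case empty
  then show ?case by (intro exI[of _ "{}"]) auto
next
  case (insert a S)
  have sym: "x \<bullet> (Q *v y) = y \<bullet> (Q *v x)" for x y
    using Q by (intro inner_matrix_vector_mult_commute) (simp add: positive_definite_def)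
  obtain T where T: "finite T" "\<And>s t. s \<in> T \<Longrightarrow> t \<in> T \<Longrightarrow> s \<bullet> (Q *v t) = of_bool (s = t)" "S \<subseteq> span T"
    using insert.IH by auto
  define p where "p = (\<Sum>t\<in>T. (t \<bullet> (Q *v a)) *\<^sub>R t)"
  have p: "p \<in> span T" unfolding p_def by (intro span_sum span_scale span_base)
  show ?case
  proof (cases "a - p = 0")
    case True
    then have "insert a S \<subseteq> span T" using p T(3) by simp
    then show ?thesis using T by blast
  next
    case False
    define r where "r = (a - p) \<bullet> (Q *v (a - p))"
    have "r > 0" using Q False by (simp add: positive_definite_def r_def)
    define b where "b = (1 / sqrt r) *\<^sub>R (a - p)"
    have orth: "s \<bullet> (Q *v (a - p)) = 0" if "s \<in> T" for s
    proof -
      have "s \<bullet> (Q *v p) = (\<Sum>t\<in>T. (t \<bullet> (Q *v a)) * (s \<bullet> (Q *v t)))"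
        unfolding p_def
        by (simp add: linear_sum[OF matrix_vector_mul_linear] inner_sum_right matrix_vector_mult_scaleR)
      also have "\<dots> = (\<Sum>t\<in>T. if t = s then t \<bullet> (Q *v a) else 0)"
        using that T(2) by (intro sum.cong) auto
      also have "\<dots> = s \<bullet> (Q *v a)" using that T(1) by simp
      finally show ?thesis by (simp add: matrix_vector_mult_diff_distrib inner_diff_right)
    qed
    have ob: "s \<bullet> (Q *v b) = 0" "b \<bullet> (Q *v s) = 0" if "s \<in> T" for s
      using orth[OF that] by (simp_all add: b_def matrix_vector_mult_scaleR sym[of "a - p"])
    have bb: "b \<bullet> (Q *v b) = 1"
    proof -
      have "b \<bullet> (Q *v b) = (1 / sqrt r) * (1 / sqrt r) * r"
        by (simp add: b_def matrix_vector_mult_scaleR r_def)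
      then show ?thesis using \<open>r > 0\<close> by simp
    qed
    have "b \<notin> T" using ob bb by auto
    have "a = sqrt r *\<^sub>R b + p" using \<open>r > 0\<close> by (simp add: b_def)
    moreover have "sqrt r *\<^sub>R b + p \<in> span (insert b T)"
      using span_mono[of T "insert b T"] p by (intro span_add[OF span_scale[OF span_base]]) auto
    ultimately have "a \<in> span (insert b T)" by simp
    moreover have "S \<subseteq> span (insert b T)" using T(3) span_mono[of T "insert b T"] by blast
    ultimately show ?thesis
      using T(1,2) ob bb \<open>b \<notin> T\<close> by (intro exI[of _ "insert b T"]) auto
  qed
qed

text \<open>The columns of \<open>B\<close> form a \<open>Q\<close>-orthonormal basis.
  \<open>B\<close> takes the place of an inverse square root of \<open>Q\<close>; later the inverse
  of \<open>Q\<close> is read off as B times its transpose.\<close>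

theorem positive_definite_factorization:
  fixes Q :: "real ^ 'n ^ 'n"
  assumes Q: "positive_definite Q"
  obtains B :: "real ^ 'n ^ 'n" where "transpose B ** Q ** B = mat 1"
proof -
  obtain T where T: "finite T" "\<And>s t. s \<in> T \<Longrightarrow> t \<in> T \<Longrightarrow> s \<bullet> (Q *v t) = of_bool (s = t)"
    and "Basis \<subseteq> span T"
    using conjugate_basis_exists[OF Q finite_Basis] by auto
  then have span: "span T = UNIV" by (metis span_Basis span_minimal subspace_span top.extremum_uniqueI)
  \<comment> \<open>Pairing a linear relation with one member isolates its coefficient. Independence
    fixes the cardinality, so that the basis can be indexed by the columns of a square
    matrix.\<close>
  have "independent T"
  proof
    assume "dependent T"
    then obtain u s where u: "s \<in> T" "u s \<noteq> 0" "(\<Sum>t\<in>T. u t *\<^sub>R t) = 0"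
      using T(1) by (auto simp: dependent_finite)
    have "0 = s \<bullet> (Q *v (\<Sum>t\<in>T. u t *\<^sub>R t))" by (simp add: u(3))
    also have "\<dots> = (\<Sum>t\<in>T. u t * (s \<bullet> (Q *v t)))"
      by (simp add: linear_sum[OF matrix_vector_mul_linear] inner_sum_right matrix_vector_mult_scaleR)
    also have "\<dots> = (\<Sum>t\<in>T. if t = s then u t else 0)"
      using u(1) T(2) by (intro sum.cong) auto
    also have "\<dots> = u s" using u(1) T(1) by simp
    finally show False using u(2) by simp
  qed
  then have "card T = CARD('n)"
    using span basis_card_eq_dim[of T UNIV] by (simp add: dim_UNIV)
  then obtain f :: "'n \<Rightarrow> real ^ 'n" where f: "bij_betw f UNIV T"
    using T(1) finite_same_card_bij[of "UNIV :: 'n set" T] by auto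
  define B where "B = (\<chi> i j. f j $ i)"
  have Bc: "column j B = f j" for j by (simp add: B_def column_def vec_eq_iff)
  have "(transpose B ** Q ** B) $ i $ j = f i \<bullet> (Q *v f j)" for i j
  proof -
    have "(transpose B ** Q ** B) $ i $ j = row i (transpose B) \<bullet> column j (Q ** B)"
      unfolding matrix_mul_assoc[symmetric]
      by (simp add: matrix_matrix_mult_def[of "transpose B"] inner_vec_def row_def column_def)
    also have "column j (Q ** B) = Q *v f j"
      by (simp add: Bc[symmetric] column_def matrix_matrix_mult_def matrix_vector_mult_def)
    finally show ?thesis by (simp add: row_transpose Bc)
  qed
  moreover have "f i \<bullet> (Q *v f j) = of_bool (i = j)" for i j
    using T(2)[of "f i" "f j"] f by (auto simp: bij_betw_def inj_on_def)
  ultimately have "transpose B ** Q ** B = mat 1" by (simp add: vec_eq_iff mat_def)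
  then show ?thesis by (rule that)
qed

section \<open>The standard Gaussian law and its linear images\<close>

definition std_gaussian_density :: "'a::euclidean_space \<Rightarrow> real" where
  "std_gaussian_density y = (\<Prod>b\<in>Basis. std_normal_density (y \<bullet> b))"

lemma std_gaussian_density_measurable [measurable]: "std_gaussian_density \<in> borel_measurable borel"
  unfolding std_gaussian_density_def by measurable

lemma std_gaussian_density_nonneg: "0 \<le> std_gaussian_density y"
  unfolding std_gaussian_density_def by (intro prod_nonneg) auto

lemma std_gaussian_density_eq:
  "std_gaussian_density (y::'a::euclidean_space) = exp (- (y \<bullet> y) / 2) / sqrt (2 * pi) ^ DIM('a)"
proof -
  have "std_gaussian_density y = (\<Prod>b\<in>(Basis::'a set). exp (- (y \<bullet> b)\<^sup>2 / 2) / sqrt (2 * pi))"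
    by (simp add: std_gaussian_density_def normal_density_def)
  also have "\<dots> = (\<Prod>b\<in>(Basis::'a set). exp (- (y \<bullet> b)\<^sup>2 / 2)) / sqrt (2 * pi) ^ DIM('a)"
    by (simp add: prod_dividef)
  also have "(\<Prod>b\<in>(Basis::'a set). exp (- (y \<bullet> b)\<^sup>2 / 2)) = exp (\<Sum>b\<in>(Basis::'a set). - (y \<bullet> b)\<^sup>2 / 2)"
    by (simp add: exp_sum)
  also have "(\<Sum>b\<in>(Basis::'a set). - (y \<bullet> b)\<^sup>2 / 2) = - (y \<bullet> y) / 2"
    by (simp add: euclidean_inner[of y y] sum_negf sum_divide_distrib[symmetric] power2_eq_square)
  finally show ?thesis .
qed

lemma std_gaussian_prob_space: "prob_space (density lborel (\<lambda>y::'a::euclidean_space. ennreal (std_gaussian_density y)))"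
proof
  have "(\<integral>\<^sup>+y. ennreal (std_gaussian_density (y::'a)) \<partial>lborel) =
    (\<integral>\<^sup>+y. (\<Prod>b\<in>Basis. ennreal (std_normal_density ((y::'a) \<bullet> b))) \<partial>lborel)"
    by (simp add: std_gaussian_density_def prod_ennreal)
  also have "\<dots> = (\<Prod>b\<in>(Basis::'a set). (\<integral>\<^sup>+x. ennreal (std_normal_density x) \<partial>lborel))"
    by (rule nn_integral_lborel_prod) auto
  also have "(\<integral>\<^sup>+x. ennreal (std_normal_density x) \<partial>lborel) = 1"
    using prob_space.emeasure_space_1[OF prob_space_normal_density[of 1 0]] by (simp add: emeasure_density)
  finally show "emeasure (density lborel (\<lambda>y::'a. ennreal (std_gaussian_density y)))
     (space (density lborel (\<lambda>y. ennreal (std_gaussian_density y)))) = 1"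
    by (simp add: emeasure_density)
qed

text \<open>With Lebesgue measure written as a product measure, the density and the exponential
  factor over the coordinates, and each factor is the one-dimensional characteristic
  function.\<close>

lemma std_gaussian_fourier:
  fixes v :: "'a::euclidean_space"
  shows "(CLINT y|density lborel (\<lambda>y. ennreal (std_gaussian_density y)). iexp (v \<bullet> y)) = exp (- (v \<bullet> v) / 2)"
proof -
  interpret product_sigma_finite "\<lambda>_::'a. lborel :: real measure" ..
  define E where "E g = (\<Sum>b\<in>Basis. g b *\<^sub>R b)" for g :: "'a \<Rightarrow> real"
  have [measurable]: "E \<in> borel_measurable (Pi\<^sub>M Basis (\<lambda>_. lborel))"
    unfolding E_def by measurable
  have En: "E g \<bullet> b = g b" if "b \<in> Basis" for g b using that by (simp add: E_def inner_sum_left_Basis)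
  have factors: "std_gaussian_density (E g) *\<^sub>R iexp (v \<bullet> E g) =
    (\<Prod>b\<in>Basis. std_normal_density (g b) *\<^sub>R iexp ((v \<bullet> b) * g b))" for g
  proof -
    have "v \<bullet> E g = (\<Sum>b\<in>Basis. (v \<bullet> b) * g b)"
      by (simp add: E_def inner_sum_right mult.commute)
    then have "iexp (v \<bullet> E g) = (\<Prod>b\<in>Basis. iexp ((v \<bullet> b) * g b))"
      by (simp add: exp_sum[symmetric] sum_distrib_left)
    then show ?thesis
      by (simp add: std_gaussian_density_def En scaleR_conv_of_real prod.distrib)
  qed
  have one: "(CLBINT x. std_normal_density x *\<^sub>R iexp (t * x)) = exp (- (t^2) / 2)" for t
  proof -
    have "char std_normal_distribution t = (CLBINT x. std_normal_density x *\<^sub>R iexp (t * x))"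
      unfolding char_def by (subst integral_density) auto
    then show ?thesis by (simp add: char_std_normal_distribution)
  qed
  have int: "complex_integrable lborel (\<lambda>x. std_normal_density x *\<^sub>R iexp (t * x))" for t
  proof -
    interpret prob_space std_normal_distribution by (rule prob_space_normal_density) simp
    have "complex_integrable std_normal_distribution (\<lambda>x. iexp (t * x))"
      by (intro integrable_const_bound[of _ 1]) auto
    then show ?thesis by (subst (asm) integrable_density) auto
  qed
  have "(CLINT y|density lborel (\<lambda>y. ennreal (std_gaussian_density y)). iexp (v \<bullet> y)) =
    (CLBINT y. std_gaussian_density y *\<^sub>R iexp (v \<bullet> y))"
    by (subst integral_density) (auto simp: std_gaussian_density_nonneg)
  also have "\<dots> = (CLINT g|Pi\<^sub>M Basis (\<lambda>_. lborel). std_gaussian_density (E g) *\<^sub>R iexp (v \<bullet> E g))"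
    by (subst lborel_eq, subst integral_distr) (auto simp: E_def[symmetric])
  also have "\<dots> = (CLINT g|Pi\<^sub>M Basis (\<lambda>_. lborel). (\<Prod>b\<in>Basis. std_normal_density (g b) *\<^sub>R iexp ((v \<bullet> b) * g b)))"
    unfolding factors ..
  also have "\<dots> = (\<Prod>b\<in>(Basis::'a set). (CLBINT x. std_normal_density x *\<^sub>R iexp ((v \<bullet> b) * x)))"
    by (rule product_integral_prod[OF finite_Basis int])
  also have "\<dots> = (\<Prod>b\<in>(Basis::'a set). complex_of_real (exp (- (v \<bullet> b)\<^sup>2 / 2)))"
    unfolding one ..
  also have "\<dots> = of_real (exp (\<Sum>b\<in>(Basis::'a set). - (v \<bullet> b)\<^sup>2 / 2))"
    by (simp add: exp_sum flip: of_real_prod)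
  also have "(\<Sum>b\<in>(Basis::'a set). - (v \<bullet> b)\<^sup>2 / 2) = - (v \<bullet> v) / 2"
    by (simp add: euclidean_inner[of v v] sum_negf sum_divide_distrib[symmetric] power2_eq_square)
  finally show ?thesis .
qed

lemma std_gaussian_cos:
  fixes v :: "'a::euclidean_space"
  shows "(LINT y|density lborel (\<lambda>y. ennreal (std_gaussian_density y)). cos (v \<bullet> y + b)) = cos b * exp (- (v \<bullet> v) / 2)"
proof -
  define N where "N = density lborel (\<lambda>y::'a. ennreal (std_gaussian_density y))"
  interpret prob_space N unfolding N_def by (rule std_gaussian_prob_space)
  have [measurable_cong, simp]: "sets N = sets borel" by (simp add: N_def)
  have i: "complex_integrable N (\<lambda>y. iexp (v \<bullet> y))"
    by (intro integrable_const_bound[of _ 1]) auto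
  have "cos (v \<bullet> y + b) = Re (iexp b * iexp (v \<bullet> y))" for y
    by (simp add: exp_add[symmetric] distrib_left[symmetric] flip: of_real_add)
       (simp add: Re_exp add.commute)
  then have "(LINT y|N. cos (v \<bullet> y + b)) = Re (CLINT y|N. iexp b * iexp (v \<bullet> y))"
    using i by (simp only: integral_Re integrable_mult_right)
  also have "\<dots> = Re (iexp b * of_real (exp (- (v \<bullet> v) / 2)))"
    using std_gaussian_fourier[of v] by (simp add: N_def)
  also have "\<dots> = cos b * exp (- (v \<bullet> v) / 2)" by (simp add: Re_exp)
  finally show ?thesis by (simp add: N_def)
qed

lemma matrix_inverse_unique:
  fixes A B :: "real ^ 'n ^ 'n"
  assumes "A ** B = mat 1"
  shows "matrix_inv A = B"
proof -
  have BA: "B ** A = mat 1" using assms by (rule matrix_left_right_inverse1)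
  have "A ** matrix_inv A = mat 1 \<and> matrix_inv A ** A = mat 1"
    unfolding matrix_inv_def by (rule someI[of _ B]) (use assms BA in auto)
  then have "matrix_inv A = matrix_inv A ** (A ** B)" "matrix_inv A ** A = mat 1" by (simp_all add: assms)
  then show ?thesis by (simp add: matrix_mul_assoc)
qed

lemma measurable_matrix_vector_mult [measurable]: "(*v) (A :: real ^ 'n ^ 'm) \<in> borel_measurable borel"
  by (rule borel_measurable_continuous_onI[OF linear_continuous_on[OF matrix_vector_mul_bounded_linear]])

text \<open>Substituting \<open>B *v y\<close> turns the exponent, a quadratic form in
  \<open>Q\<close>, into |y|^2, and the Jacobian |det B| cancels against the normalising
  constant.\<close>

theorem multivariate_normal_eq_distr:
  fixes B Q :: "real ^ 'n ^ 'n"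
  assumes B: "transpose B ** Q ** B = mat 1"
  shows "multivariate_normal 0 (matrix_inv Q) =
    distr (density lborel (\<lambda>y. ennreal (std_gaussian_density y))) borel ((*v) B)"
    and "matrix_inv Q = B ** transpose B"
proof -
  have 1: "B ** (transpose B ** Q) = mat 1" using matrix_left_right_inverse1[OF B] .
  \<comment> \<open>Hence the covariance has determinant (det B)^2, whose root in the normal density
    is exactly the Jacobian.\<close>
  have dd: "det B * det B * det Q = 1"
    using arg_cong[OF B, of det] by (simp add: det_mul det_transpose mult_ac)
  have 2: "(B ** transpose B) ** Q = mat 1" using 1 by (simp add: matrix_mul_assoc)
  have 3: "Q ** (B ** transpose B) = mat 1" using 2 by (rule matrix_left_right_inverse1)
  show inv: "matrix_inv Q = B ** transpose B" by (rule matrix_inverse_unique[OF 3])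
  have invinv: "matrix_inv (matrix_inv Q) = Q"
    unfolding inv by (rule matrix_inverse_unique[OF 2])
  have det: "det (matrix_inv Q) = (det B)\<^sup>2" "det B \<noteq> 0"
    using dd by (auto simp: inv det_mul det_transpose power2_eq_square)
  define g where "g x = exp (- (x \<bullet> (Q *v x)) / 2) / sqrt ((2 * pi) ^ CARD('n) * (det B)\<^sup>2)" for x :: "real ^ 'n"
  have mn: "multivariate_normal 0 (matrix_inv Q) = density lborel (\<lambda>x. ennreal (g x))"
    unfolding multivariate_normal_def invinv det g_def by simp
  have [measurable]: "g \<in> borel_measurable borel" unfolding g_def by measurable
  have gB: "\<bar>det B\<bar> * g (B *v y) = std_gaussian_density y" for y
  proof -
    have "(B *v y) \<bullet> (Q *v (B *v y)) = y \<bullet> ((transpose B ** Q ** B) *v y)"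
      by (simp add: inner_matrix_vector_mult_left flip: matrix_vector_mul_assoc)
    then have "(B *v y) \<bullet> (Q *v (B *v y)) = y \<bullet> y" by (simp add: B)
    then have "g (B *v y) = exp (- (y \<bullet> y) / 2) / (sqrt (2 * pi) ^ CARD('n) * \<bar>det B\<bar>)"
      by (simp only: g_def real_sqrt_mult[of "(2 * pi) ^ _"] real_sqrt_power[of "2 * pi"] real_sqrt_abs)
    then show ?thesis using det(2) by (simp add: std_gaussian_density_eq)
  qed
  show "multivariate_normal 0 (matrix_inv Q) =
    distr (density lborel (\<lambda>y. ennreal (std_gaussian_density y))) borel ((*v) B)"
  proof (rule measure_eqI)
    fix A assume "A \<in> sets (multivariate_normal 0 (matrix_inv Q))"
    then have [measurable]: "A \<in> sets borel" by (simp add: mn)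
    have "emeasure (multivariate_normal 0 (matrix_inv Q)) A = (\<integral>\<^sup>+x. ennreal (g x) * indicator A x \<partial>lborel)"
      by (simp add: mn emeasure_density)
    also have "\<dots> = ennreal \<bar>det B\<bar> * (\<integral>\<^sup>+y. ennreal (g (B *v y)) * indicator A (B *v y) \<partial>lborel)"
      by (rule nn_integral_lborel_matrix[OF det(2)]) measurable
    also have "\<dots> = (\<integral>\<^sup>+y. ennreal (std_gaussian_density y) * indicator A (B *v y) \<partial>lborel)"
      by (subst nn_integral_cmult[symmetric])
         (auto simp: gB[symmetric] ennreal_mult' mult.assoc)
    also have "\<dots> = emeasure (distr (density lborel (\<lambda>y. ennreal (std_gaussian_density y))) borel ((*v) B)) A"
    proof -
      have "(*v) B -` A \<in> sets borel" using measurable_sets[OF measurable_matrix_vector_mult, of A B] by simp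
      then show ?thesis by (simp add: emeasure_distr emeasure_density indicator_def of_bool_def if_distrib)
    qed
    finally show "emeasure (multivariate_normal 0 (matrix_inv Q)) A =
      emeasure (distr (density lborel (\<lambda>y. ennreal (std_gaussian_density y))) borel ((*v) B)) A" .
  qed (simp add: mn)
qed

text \<open>Parametrised by the inverse covariance because the limit law has the inverse of the
  information matrix as covariance. The exponent is the squared length of the transpose of
  \<open>B\<close> applied to \<open>u\<close>.\<close>

theorem multivariate_normal_inverse:
  fixes Q :: "real ^ 'n ^ 'n"
  assumes "positive_definite Q"
  shows "prob_space (multivariate_normal 0 (matrix_inv Q))"
    and "(LINT x|multivariate_normal 0 (matrix_inv Q). cos (u \<bullet> x + b)) = cos b * exp (- (u \<bullet> (matrix_inv Q *v u)) / 2)"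
proof -
  obtain B :: "real ^ 'n ^ 'n" where B: "transpose B ** Q ** B = mat 1" by (rule positive_definite_factorization[OF assms])
  note mn = multivariate_normal_eq_distr[OF B]
  show "prob_space (multivariate_normal 0 (matrix_inv Q))"
    unfolding mn(1) by (rule prob_space.prob_space_distr[OF std_gaussian_prob_space]) simp
  have "u \<bullet> (B *v y) = (transpose B *v u) \<bullet> y" for y
    using inner_matrix_vector_mult_left[of "transpose B" u y] by simp
  moreover have "(transpose B *v u) \<bullet> (transpose B *v u) = u \<bullet> (matrix_inv Q *v u)"
    unfolding mn(2) using inner_matrix_vector_mult_left[of "transpose B" u "transpose B *v u"]
    by (simp only: transpose_transpose matrix_vector_mul_assoc)
  ultimately show "(LINT x|multivariate_normal 0 (matrix_inv Q). cos (u \<bullet> x + b)) =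
     cos b * exp (- (u \<bullet> (matrix_inv Q *v u)) / 2)"
    unfolding mn(1) by (subst integral_distr) (auto simp: std_gaussian_cos)
qed

section \<open>The determinant near a positive definite matrix\<close>

text \<open>Both points vary near the base point. The determinant is compared at two empirical
  matrices, neither of which is \<Gamma>; an ordinary derivative at \<Gamma> would leave an error
  proportional to their distance from \<Gamma>, whereas an error proportional to their mutual
  distance is required.\<close>

definition has_strict_derivative :: "('a::real_normed_vector \<Rightarrow> real) \<Rightarrow> ('a \<Rightarrow> real) \<Rightarrow> 'a \<Rightarrow> bool" where
  "has_strict_derivative F F' x \<longleftrightarrow> bounded_linear F' \<and>
     (\<forall>e>0. \<exists>d>0. \<forall>y z. norm (y - x) < d \<longrightarrow> norm (z - x) < d \<longrightarrow>
        \<bar>F y - F z - F' (y - z)\<bar> \<le> e * norm (y - z))"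

lemma has_strict_derivativeD:
  assumes "has_strict_derivative F F' x" "e > 0"
  obtains d where "d > 0" "\<forall>y z. norm (y - x) < d \<longrightarrow> norm (z - x) < d \<longrightarrow>
        \<bar>F y - F z - F' (y - z)\<bar> \<le> e * norm (y - z)"
  using assms unfolding has_strict_derivative_def by blast

lemma has_strict_derivative_linear:
  assumes "bounded_linear F"
  shows "has_strict_derivative F F x"
  unfolding has_strict_derivative_def
  using assms by (auto simp: linear_diff[OF bounded_linear.linear[OF assms]] intro: exI[of _ 1])

lemma has_strict_derivative_const: "has_strict_derivative (\<lambda>_. c) (\<lambda>_. 0) x"
  unfolding has_strict_derivative_def by (auto intro: exI[of _ 1])

lemma has_strict_derivative_imp_has_derivative:
  assumes "has_strict_derivative F F' x"
  shows "(F has_derivative F') (at x)"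
proof (rule has_derivativeI_sandwich[of 1])
  show "bounded_linear F'" using assms by (simp add: has_strict_derivative_def)
next
  show "norm (F y - F x - F' (y - x)) / norm (y - x) \<le> norm (F y - F x - F' (y - x)) / norm (y - x)" for y by simp
next
  show "((\<lambda>y. norm (F y - F x - F' (y - x)) / norm (y - x)) \<longlongrightarrow> 0) (at x)"
  proof (rule LIM_I)
    fix r :: real assume "r > 0"
    then obtain d where d: "d > 0" "\<forall>y z. norm (y - x) < d \<longrightarrow> norm (z - x) < d \<longrightarrow>
        \<bar>F y - F z - F' (y - z)\<bar> \<le> (r / 2) * norm (y - z)"
      using has_strict_derivativeD[OF assms, of "r / 2"] by auto
    have "\<bar>F y - F x - F' (y - x)\<bar> / norm (y - x) < r" if "y \<noteq> x" "norm (y - x) < d" for y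
    proof -
      have "\<bar>F y - F x - F' (y - x)\<bar> / norm (y - x) \<le> r / 2"
        using d(2)[rule_format, of y x] d(1) that by (simp add: divide_le_eq)
      then show ?thesis using \<open>r > 0\<close> by linarith
    qed
    then show "\<exists>s>0. \<forall>y. y \<noteq> x \<and> norm (y - x) < s \<longrightarrow>
        norm (norm (F y - F x - F' (y - x)) / norm (y - x) - 0) < r"
      using d(1) by (intro exI[of _ d]) simp
  qed
qed simp

lemma has_strict_derivative_lipschitz:
  assumes "has_strict_derivative F F' x"
  obtains d K where "d > 0" "K > 0" "\<forall>h. \<bar>F' h\<bar> \<le> K * norm h"
    "\<forall>y z. norm (y - x) < d \<longrightarrow> norm (z - x) < d \<longrightarrow> \<bar>F y - F z\<bar> \<le> K * norm (y - z)"
proof -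
  have "bounded_linear F'" using assms by (simp add: has_strict_derivative_def)
  then obtain K where K: "K > 0" "\<forall>h. \<bar>F' h\<bar> \<le> K * norm h"
    using bounded_linear.pos_bounded[of F'] by (auto simp: mult.commute)
  obtain d where d: "d > 0" "\<forall>y z. norm (y - x) < d \<longrightarrow> norm (z - x) < d \<longrightarrow>
        \<bar>F y - F z - F' (y - z)\<bar> \<le> 1 * norm (y - z)"
    by (rule has_strict_derivativeD[OF assms, of 1]) auto
  show ?thesis
  proof (rule that[of d "K + 1"])
    have "\<bar>F' h\<bar> \<le> (K + 1) * norm h" for h
      using K(2)[rule_format, of h] norm_ge_zero[of h] unfolding distrib_right by linarith
    then show "\<forall>h. \<bar>F' h\<bar> \<le> (K + 1) * norm h" by blast
    have "\<bar>F y - F z\<bar> \<le> (K + 1) * norm (y - z)" if "norm (y - x) < d" "norm (z - x) < d" for y z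
      using d(2)[rule_format, OF that] K(2)[rule_format, of "y - z"] unfolding distrib_right by linarith
    then show "\<forall>y z. norm (y - x) < d \<longrightarrow> norm (z - x) < d \<longrightarrow> \<bar>F y - F z\<bar> \<le> (K + 1) * norm (y - z)" by blast
  qed (use d(1) K(1) in auto)
qed

lemma has_strict_derivative_add:
  assumes "has_strict_derivative F F' x" "has_strict_derivative G G' x"
  shows "has_strict_derivative (\<lambda>y. F y + G y) (\<lambda>h. F' h + G' h) x"
  unfolding has_strict_derivative_def
proof (intro conjI allI impI)
  show "bounded_linear (\<lambda>h. F' h + G' h)"
    using assms by (auto simp: has_strict_derivative_def intro: bounded_linear_add)
  fix e :: real assume "e > 0"
  then have e2: "e / 2 > 0" by simp
  obtain d where d: "d > 0" "\<forall>y z. norm (y - x) < d \<longrightarrow> norm (z - x) < d \<longrightarrow>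
        \<bar>F y - F z - F' (y - z)\<bar> \<le> (e / 2) * norm (y - z)"
    by (rule has_strict_derivativeD[OF assms(1) e2])
  obtain d' where d': "d' > 0" "\<forall>y z. norm (y - x) < d' \<longrightarrow> norm (z - x) < d' \<longrightarrow>
        \<bar>G y - G z - G' (y - z)\<bar> \<le> (e / 2) * norm (y - z)"
    by (rule has_strict_derivativeD[OF assms(2) e2])
  have "\<bar>F y + G y - (F z + G z) - (F' (y - z) + G' (y - z))\<bar> \<le> e * norm (y - z)"
    if "norm (y - x) < min d d'" "norm (z - x) < min d d'" for y z
  proof -
    have "e * norm (y - z) = (e / 2) * norm (y - z) + (e / 2) * norm (y - z)" by simp
    moreover have "norm (y - x) < d" "norm (z - x) < d" "norm (y - x) < d'" "norm (z - x) < d'"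
      using that by simp_all
    ultimately show ?thesis using d(2)[rule_format, of y z] d'(2)[rule_format, of y z] by linarith
  qed
  then show "\<exists>d>0. \<forall>y z. norm (y - x) < d \<longrightarrow> norm (z - x) < d \<longrightarrow>
     \<bar>F y + G y - (F z + G z) - (F' (y - z) + G' (y - z))\<bar> \<le> e * norm (y - z)"
    using d(1) d'(1) by (intro exI[of _ "min d d'"]) auto
qed

lemma has_strict_derivative_mult:
  assumes F: "has_strict_derivative F F' x" and G: "has_strict_derivative G G' x"
  shows "has_strict_derivative (\<lambda>y. F y * G y) (\<lambda>h. F' h * G x + F x * G' h) x"
  unfolding has_strict_derivative_def
proof (intro conjI allI impI)
  show "bounded_linear (\<lambda>h. F' h * G x + F x * G' h)"
    using assms unfolding has_strict_derivative_def
    by (intro bounded_linear_add bounded_linear_mult_const bounded_linear_const_mult) auto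
  fix e :: real assume "e > 0"
  obtain dF K where K: "dF > 0" "K > 0" "\<forall>h. \<bar>F' h\<bar> \<le> K * norm h"
    "\<forall>y z. norm (y - x) < dF \<longrightarrow> norm (z - x) < dF \<longrightarrow> \<bar>F y - F z\<bar> \<le> K * norm (y - z)"
    by (rule has_strict_derivative_lipschitz[OF F])
  obtain dG L where L: "dG > 0" "L > 0" "\<forall>h. \<bar>G' h\<bar> \<le> L * norm h"
    "\<forall>y z. norm (y - x) < dG \<longrightarrow> norm (z - x) < dG \<longrightarrow> \<bar>G y - G z\<bar> \<le> L * norm (y - z)"
    by (rule has_strict_derivative_lipschitz[OF G])
  define a where "a = \<bar>F x\<bar> + 1"
  define b where "b = \<bar>G x\<bar> + 1"
  have ab: "a > 0" "b > 0" by (simp_all add: a_def b_def)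
  define eF where "eF = e / (4 * b)"
  define eG where "eG = e / (4 * a)"
  have eFG: "eF > 0" "eG > 0" using \<open>e > 0\<close> ab by (simp_all add: eF_def eG_def)
  obtain d1 where d1: "d1 > 0" "\<forall>y z. norm (y - x) < d1 \<longrightarrow> norm (z - x) < d1 \<longrightarrow>
        \<bar>F y - F z - F' (y - z)\<bar> \<le> eF * norm (y - z)"
    by (rule has_strict_derivativeD[OF F eFG(1)])
  obtain d2 where d2: "d2 > 0" "\<forall>y z. norm (y - x) < d2 \<longrightarrow> norm (z - x) < d2 \<longrightarrow>
        \<bar>G y - G z - G' (y - z)\<bar> \<le> eG * norm (y - z)"
    by (rule has_strict_derivativeD[OF G eFG(2)])
  \<comment> \<open>The increment of the product splits into four terms. The bounds 1 / K and 1 / L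
    keep \<open>F z\<close> and \<open>G y\<close> below \<open>a\<close> and \<open>b\<close>, so
    the two linearisation errors cost e / 4 each; the last bound makes each of the two mixed terms
    cost at most e / 4.\<close>
  define d where "d = Min {dF, dG, d1, d2, 1 / K, 1 / L, e / (4 * K * L)}"
  have d: "d > 0" using K L d1 d2 \<open>e > 0\<close> by (simp add: d_def)
  have dle: "d \<le> dF" "d \<le> dG" "d \<le> d1" "d \<le> d2" "d \<le> 1 / K" "d \<le> 1 / L" "d \<le> e / (4 * K * L)"
    unfolding d_def by (rule Min_le; simp)+
  have "\<bar>F y * G y - F z * G z - (F' (y - z) * G x + F x * G' (y - z))\<bar> \<le> e * norm (y - z)"
    if y: "norm (y - x) < d" and z: "norm (z - x) < d" for y z
  proof -
    let ?n = "norm (y - z)"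
    have "\<bar>G y - G x\<bar> \<le> L * norm (y - x)" by (rule L(4)[rule_format]) (use y dle L(1) in auto)
    also have "\<dots> \<le> L * d" using y L(2) by (intro mult_left_mono) auto
    finally have Gyx: "\<bar>G y - G x\<bar> \<le> L * d" .
    have "\<bar>F z - F x\<bar> \<le> K * norm (z - x)" by (rule K(4)[rule_format]) (use z dle K(1) in auto)
    also have "\<dots> \<le> K * d" using z K(2) by (intro mult_left_mono) auto
    finally have Fzx: "\<bar>F z - F x\<bar> \<le> K * d" .
    have Ld: "L * d \<le> 1" "K * d \<le> 1" using dle K(2) L(2) by (simp_all add: pos_le_divide_eq mult.commute)
    have KLd: "K * L * d \<le> e / 4" using dle(7) K(2) L(2) by (simp add: pos_le_divide_eq mult_ac)
    have Gy: "\<bar>G y\<bar> \<le> b" and Fz: "\<bar>F z\<bar> \<le> a" using Gyx Fzx Ld by (auto simp: a_def b_def)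
    have t1: "\<bar>(F y - F z - F' (y - z)) * G y\<bar> \<le> (eF * ?n) * b"
      unfolding abs_mult using d1(2)[rule_format, of y z] y z dle Gy by (intro mult_mono) auto
    have t2: "\<bar>F z * (G y - G z - G' (y - z))\<bar> \<le> a * (eG * ?n)"
      unfolding abs_mult using d2(2)[rule_format, of y z] y z dle Fz ab by (intro mult_mono) auto
    have t3: "\<bar>F' (y - z) * (G y - G x)\<bar> \<le> (K * ?n) * (L * d)"
      unfolding abs_mult using K Gyx by (intro mult_mono) auto
    have t4: "\<bar>(F z - F x) * G' (y - z)\<bar> \<le> (K * d) * (L * ?n)"
      unfolding abs_mult using L Fzx K d by (intro mult_mono) auto
    have "F y * G y - F z * G z - (F' (y - z) * G x + F x * G' (y - z)) =
      (F y - F z - F' (y - z)) * G y + F z * (G y - G z - G' (y - z)) + F' (y - z) * (G y - G x) + (F z - F x) * G' (y - z)"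
      by (simp add: algebra_simps)
    also have "\<bar>\<dots>\<bar> \<le> (eF * ?n) * b + a * (eG * ?n) + (K * ?n) * (L * d) + (K * d) * (L * ?n)"
      using t1 t2 t3 t4 by linarith
    also have "\<dots> = (e / 2 + 2 * (K * L * d)) * ?n"
      using ab by (simp add: eF_def eG_def field_simps)
    also have "\<dots> \<le> e * ?n" using KLd by (intro mult_right_mono) auto
    finally show ?thesis .
  qed
  then show "\<exists>d>0. \<forall>y z. norm (y - x) < d \<longrightarrow> norm (z - x) < d \<longrightarrow>
     \<bar>F y * G y - F z * G z - (F' (y - z) * G x + F x * G' (y - z))\<bar> \<le> e * norm (y - z)"
    using d by blast
qed

lemma has_strict_derivative_cmult:
  assumes "has_strict_derivative F F' x"
  shows "has_strict_derivative (\<lambda>y. c * F y) (\<lambda>h. c * F' h) x"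
  using has_strict_derivative_mult[OF has_strict_derivative_const assms, of c] by simp

lemma has_strict_derivative_sum:
  assumes "finite I" "\<And>i. i \<in> I \<Longrightarrow> has_strict_derivative (F i) (F' i) x"
  shows "has_strict_derivative (\<lambda>y. \<Sum>i\<in>I. F i y) (\<lambda>h. \<Sum>i\<in>I. F' i h) x"
  using assms by (induction I rule: finite_induct)
    (simp_all add: has_strict_derivative_const has_strict_derivative_add)

lemma has_strict_derivative_prod:
  assumes "finite I" "\<And>i. i \<in> I \<Longrightarrow> has_strict_derivative (F i) (F' i) x"
  shows "has_strict_derivative (\<lambda>y. \<Prod>i\<in>I. F i y) (\<lambda>h. \<Sum>i\<in>I. F' i h * (\<Prod>j\<in>I - {i}. F j x)) x"
  using assms
proof (induction I rule: finite_induct)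
  case empty
  then show ?case by (simp add: has_strict_derivative_const)
next
  case (insert i I)
  have "has_strict_derivative (\<lambda>y. F i y * (\<Prod>i\<in>I. F i y))
     (\<lambda>h. F' i h * (\<Prod>i\<in>I. F i x) + F i x * (\<Sum>i\<in>I. F' i h * (\<Prod>j\<in>I - {i}. F j x))) x"
    using insert by (intro has_strict_derivative_mult) auto
  moreover have "F i x * (\<Sum>k\<in>I. F' k h * (\<Prod>j\<in>I - {k}. F j x)) = (\<Sum>k\<in>I. F' k h * (\<Prod>j\<in>insert i I - {k}. F j x))" for h
    unfolding sum_distrib_left
  proof (intro sum.cong refl)
    fix k assume "k \<in> I"
    then have "insert i I - {k} = insert i (I - {k})" using insert.hyps by auto
    then show "F i x * (F' k h * (\<Prod>j\<in>I - {k}. F j x)) = F' k h * (\<Prod>j\<in>insert i I - {k}. F j x)"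
      using insert.hyps by simp
  qed
  moreover have "insert i I - {i} = I" using insert.hyps by auto
  ultimately show ?case using insert.hyps by simp
qed

lemma has_strict_derivative_compose_linear:
  assumes F: "has_strict_derivative F F' (L x)" and L: "bounded_linear L"
  shows "has_strict_derivative (\<lambda>y. F (L y)) (\<lambda>h. F' (L h)) x"
  unfolding has_strict_derivative_def
proof (intro conjI allI impI)
  show "bounded_linear (\<lambda>h. F' (L h))"
    using F L by (auto simp: has_strict_derivative_def intro: bounded_linear_compose)
  fix e :: real assume "e > 0"
  obtain K where K: "K > 0" "\<And>h. norm (L h) \<le> K * norm h"
    using bounded_linear.pos_bounded[OF L] by (auto simp: mult.commute)
  obtain d where d: "d > 0" "\<forall>y z. norm (y - L x) < d \<longrightarrow> norm (z - L x) < d \<longrightarrow>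
        \<bar>F y - F z - F' (y - z)\<bar> \<le> (e / K) * norm (y - z)"
    by (rule has_strict_derivativeD[OF F, of "e / K"]) (use \<open>e > 0\<close> K in auto)
  note Ld = linear_diff[OF bounded_linear.linear[OF L], symmetric]
  have "\<bar>F (L y) - F (L z) - F' (L (y - z))\<bar> \<le> e * norm (y - z)"
    if "norm (y - x) < d / K" "norm (z - x) < d / K" for y z
  proof -
    have "norm (L y - L x) < d" "norm (L z - L x) < d"
      using that K(2)[of "y - x"] K(2)[of "z - x"] K(1) by (auto simp: Ld pos_less_divide_eq mult.commute)
    from d(2)[rule_format, OF this] have "\<bar>F (L y) - F (L z) - F' (L (y - z))\<bar> \<le> e / K * norm (L (y - z))" by (simp add: Ld)
    also have "\<dots> \<le> e / K * (K * norm (y - z))"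
      using K \<open>e > 0\<close> by (intro mult_left_mono) auto
    finally show ?thesis using K by simp
  qed
  then show "\<exists>d>0. \<forall>y z. norm (y - x) < d \<longrightarrow> norm (z - x) < d \<longrightarrow>
     \<bar>F (L y) - F (L z) - F' (L (y - z))\<bar> \<le> e * norm (y - z)"
    using d(1) K(1) by (intro exI[of _ "d / K"]) auto
qed

lemma bounded_linear_entry: "bounded_linear (\<lambda>M :: real ^ 'n ^ 'm. M $ i $ j)"
  using bounded_linear_compose[OF bounded_linear_vec_nth bounded_linear_vec_nth] .

text \<open>In the Leibniz expansion a permutation other than the identity moves at least two
  indices. A zero entry of the identity matrix therefore survives the removal of one factor, and
  only the identity permutation contributes to the derivative.\<close>

lemma has_strict_derivative_det_mat_1:
  "has_strict_derivative (det :: real ^ 'n ^ 'n \<Rightarrow> real) trace (mat 1)"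
proof -
  let ?I = "mat 1 :: real ^ 'n ^ 'n"
  let ?D = "\<lambda>h. \<Sum>p\<in>{p. p permutes UNIV}. of_int (sign p) * (\<Sum>i\<in>UNIV. h $ i $ p i * (\<Prod>j\<in>UNIV - {i}. ?I $ j $ p j))"
  have "has_strict_derivative (det :: real ^ 'n ^ 'n \<Rightarrow> real) ?D ?I"
    unfolding det_def
    by (intro has_strict_derivative_sum has_strict_derivative_cmult has_strict_derivative_prod
        has_strict_derivative_linear bounded_linear_entry finite_permutations finite)
  moreover have "?D = trace"
  proof
    fix h
    have zero: "(\<Prod>j\<in>UNIV - {i}. ?I $ j $ p j) = 0" if p: "p permutes UNIV" "p \<noteq> id" for p i
    proof -
      obtain k where k: "p k \<noteq> k" using p(2) by (auto simp: fun_eq_iff)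
      have "p (p k) \<noteq> p k" using k permutes_inj[OF p(1)] by (auto dest: injD)
      with k obtain j where "j \<noteq> i" "p j \<noteq> j" by metis
      then show ?thesis by (intro prod_zero) (auto simp: mat_def intro!: bexI[of _ j])
    qed
    have "?D h = (\<Sum>p\<in>{id}. of_int (sign p) * (\<Sum>i\<in>UNIV. h $ i $ p i * (\<Prod>j\<in>UNIV - {i}. ?I $ j $ p j)))"
      by (intro sum.mono_neutral_right finite_permutations) (auto simp: permutes_id zero)
    also have "\<dots> = trace h" by (simp add: trace_def mat_def)
    finally show "?D h = trace h" .
  qed
  ultimately show ?thesis by (simp only:)
qed

lemma bounded_linear_matrix_mult_left: "bounded_linear (\<lambda>M. (A :: real ^ 'n ^ 'm) ** (M :: real ^ 'k ^ 'n))"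
  by (intro linear_conv_bounded_linear[THEN iffD1] linearI)
     (simp_all add: vec_eq_iff matrix_matrix_mult_def sum_distrib_left distrib_left sum.distrib mult_ac)

text \<open>Jacobi's formula: multiplicativity, det M = det A * det (A^-1 M), moves the base point
  to the identity matrix.\<close>

theorem has_strict_derivative_det:
  fixes A :: "real ^ 'n ^ 'n"
  assumes "invertible A"
  shows "has_strict_derivative det (\<lambda>H. det A * trace (matrix_inv A ** H)) A"
proof -
  have inv: "A ** matrix_inv A = mat 1" "matrix_inv A ** A = mat 1"
    using assms someI_ex[of "\<lambda>B. A ** B = mat 1 \<and> B ** A = mat 1"] unfolding matrix_inv_def invertible_def by auto
  have eq: "det = (\<lambda>M. det A * det (matrix_inv A ** M))"
    unfolding det_mul[symmetric] matrix_mul_assoc inv by simp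
  have "has_strict_derivative (\<lambda>M. det A * det (matrix_inv A ** M)) (\<lambda>H. det A * trace (matrix_inv A ** H)) A"
    by (rule has_strict_derivative_cmult, rule has_strict_derivative_compose_linear)
       (simp_all add: inv has_strict_derivative_det_mat_1 bounded_linear_matrix_mult_left)
  then show ?thesis unfolding eq[symmetric] .
qed

section \<open>Growth of the determinant under positive semidefinite perturbations\<close>

lemma positive_definite_det_pos:
  fixes A :: "real ^ 'n ^ 'n"
  assumes "positive_definite A"
  shows "det A > 0"
proof -
  obtain B :: "real ^ 'n ^ 'n" where "transpose B ** A ** B = mat 1"
    by (rule positive_definite_factorization[OF assms])
  from arg_cong[OF this, of det] have eq: "(det B)\<^sup>2 * det A = 1"
    by (simp add: det_mul det_transpose power2_eq_square mult_ac)
  then have "(det B)\<^sup>2 > 0" by (metis mult_zero_left zero_less_power2 zero_neq_one power_zero_numeral)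
  with eq show ?thesis by (metis zero_less_mult_pos zero_less_one)
qed

text \<open>Moving from \<open>b\<close> in direction y = P b changes the form by 2 t |y|^2 up to
  second order in t, which would be negative for small negative t unless y = 0.\<close>

lemma psd_kernel:
  fixes P :: "real ^ 'n ^ 'n"
  assumes sym: "transpose P = P" and psd: "\<And>x. 0 \<le> x \<bullet> (P *v x)" and b: "b \<bullet> (P *v b) = 0"
  shows "P *v b = 0"
proof -
  define y where "y = P *v b"
  have le: "0 \<le> 2 * t * (y \<bullet> y) + t\<^sup>2 * (y \<bullet> (P *v y))" for t
  proof -
    have "(b + t *\<^sub>R y) \<bullet> (P *v (b + t *\<^sub>R y)) = b \<bullet> (P *v b) + t * (b \<bullet> (P *v y)) + t * (y \<bullet> (P *v b)) + t * t * (y \<bullet> (P *v y))"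
      by (simp add: matrix_vector_right_distrib matrix_vector_mult_scaleR inner_add_left inner_add_right algebra_simps)
    also have "b \<bullet> (P *v y) = y \<bullet> (P *v b)" by (rule inner_matrix_vector_mult_commute[OF sym])
    finally show ?thesis using psd[of "b + t *\<^sub>R y"] by (simp add: b y_def power2_eq_square)
  qed
  define q where "q = y \<bullet> (P *v y)"
  have "q \<ge> 0" unfolding q_def by (rule psd)
  have "y \<bullet> y = 0"
  proof (rule ccontr)
    assume "y \<bullet> y \<noteq> 0"
    then have pos: "y \<bullet> y > 0" by (simp add: less_le)
    \<comment> \<open>Dividing by \<open>q + 1\<close> instead of \<open>q\<close> covers q = 0; the
      form then takes the value t |y|^2 - t^2, a sum of two negative terms.\<close>
    define t where "t = - (y \<bullet> y) / (q + 1)"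
    have "t * (q + 1) = - (y \<bullet> y)" using \<open>q \<ge> 0\<close> by (simp add: t_def)
    then have "t * t * q = t * (- (y \<bullet> y)) - t * t" by (metis add_diff_cancel_right' distrib_left mult.assoc mult.right_neutral)
    then have "2 * t * (y \<bullet> y) + t\<^sup>2 * q = t * (y \<bullet> y) - t * t" by (simp add: power2_eq_square)
    also have "\<dots> < 0"
    proof -
      have "t < 0" using pos \<open>q \<ge> 0\<close> by (simp add: t_def divide_neg_pos)
      then have "t * (y \<bullet> y) < 0" "t * t > 0" using pos by (simp_all add: mult_neg_pos mult_neg_neg)
      then show ?thesis by linarith
    qed
    finally show False using le[of t] by (simp add: q_def)
  qed
  then show ?thesis by (simp add: y_def)
qed

text \<open>Writing the inverse of \<open>C\<close> as B times its transpose makes the trace a sum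
  of values of the form \<open>P\<close> at the columns of \<open>B\<close>. If all vanish, these
  columns lie in the kernel of \<open>P\<close>; they span the space, so \<open>P\<close> would be
  zero.\<close>

lemma trace_inverse_mult_pos:
  fixes C P :: "real ^ 'n ^ 'n"
  assumes C: "positive_definite C"
    and sym: "transpose P = P" and psd: "\<And>x. 0 \<le> x \<bullet> (P *v x)" and "P \<noteq> 0"
  shows "trace (matrix_inv C ** P) > 0"
proof -
  obtain B :: "real ^ 'n ^ 'n" where B: "transpose B ** C ** B = mat 1"
    by (rule positive_definite_factorization[OF C])
  have "trace (matrix_inv C ** P) = trace ((transpose B ** P) ** B)"
    unfolding multivariate_normal_eq_distr(2)[OF B] using trace_mul_sym[of B "transpose B ** P"]
    by (simp only: matrix_mul_assoc)
  also have "\<dots> = (\<Sum>i\<in>UNIV. column i B \<bullet> (P *v column i B))"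
  proof -
    have "(transpose B ** P ** B) $ i $ i = column i B \<bullet> (P *v column i B)" for i
      unfolding matrix_mul_assoc[symmetric]
      by (simp add: matrix_matrix_mult_def transpose_def inner_vec_def column_def matrix_vector_mult_def)
    then show ?thesis by (simp add: trace_def)
  qed
  finally have eq: "trace (matrix_inv C ** P) = (\<Sum>i\<in>UNIV. column i B \<bullet> (P *v column i B))" .
  have "(\<Sum>i\<in>UNIV. column i B \<bullet> (P *v column i B)) \<noteq> 0"
  proof
    assume "(\<Sum>i\<in>UNIV. column i B \<bullet> (P *v column i B)) = 0"
    then have "column i B \<bullet> (P *v column i B) = 0" for i
      using psd by (simp add: sum_nonneg_eq_0_iff)
    then have 0: "P *v column i B = 0" for i by (rule psd_kernel[OF sym psd])
    have "(P ** B) $ i $ j = 0" for i j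
      using arg_cong[OF 0[of j], of "\<lambda>v. v $ i"]
      by (simp add: matrix_matrix_mult_def matrix_vector_mult_def column_def)
    then have "P ** B = 0" by (simp add: vec_eq_iff)
    moreover have "B ** (transpose B ** C) = mat 1" by (rule matrix_left_right_inverse1[OF B])
    ultimately have "P = 0 ** (transpose B ** C)" by (metis matrix_mul_assoc matrix_mul_rid)
    then show False using \<open>P \<noteq> 0\<close> by (simp add: matrix_matrix_mult_def zero_vec_def vec_eq_iff)
  qed
  moreover have "(\<Sum>i\<in>UNIV. column i B \<bullet> (P *v column i B)) \<ge> 0" by (intro sum_nonneg psd)
  ultimately show ?thesis unfolding eq by linarith
qed

lemma positive_definite_imp_invertible:
  fixes A :: "real ^ 'n ^ 'n"
  shows "positive_definite A \<Longrightarrow> invertible A"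
  using positive_definite_det_pos[of A] by (simp add: invertible_det_nz)

text \<open>Along the segment from \<open>A\<close> to \<open>A + P\<close> the matrices stay
  positive definite, and by Jacobi's formula the derivative is the determinant times a positive
  trace. This strictness makes the true regression function the unique minimiser of the limiting
  criterion.\<close>

theorem det_less_det_add_psd:
  fixes A P :: "real ^ 'n ^ 'n"
  assumes A: "positive_definite A"
    and sym: "transpose P = P" and psd: "\<And>x. 0 \<le> x \<bullet> (P *v x)" and "P \<noteq> 0"
  shows "det A < det (A + P)"
proof -
  have pd: "positive_definite (A + t *\<^sub>R P)" if "t \<ge> 0" for t
    unfolding positive_definite_def
  proof (intro conjI allI impI)
    show "transpose (A + t *\<^sub>R P) = A + t *\<^sub>R P"
      using A sym by (simp add: positive_definite_def transpose_def vec_eq_iff)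
    fix x :: "real ^ 'n" assume "x \<noteq> 0"
    then have "0 < x \<bullet> (A *v x)" using A by (simp add: positive_definite_def)
    moreover have "0 \<le> t * (x \<bullet> (P *v x))" using that psd by simp
    ultimately show "0 < x \<bullet> ((A + t *\<^sub>R P) *v x)"
      by (simp add: matrix_vector_mult_add_rdistrib scaleR_matrix_vector_assoc[symmetric] inner_add_right)
  qed
  have "det (A + 0 *\<^sub>R P) < det (A + 1 *\<^sub>R P)"
  proof (rule DERIV_pos_imp_increasing[of 0 1 "\<lambda>t. det (A + t *\<^sub>R P)"])
    fix t :: real assume "0 \<le> t" "t \<le> 1"
    let ?C = "A + t *\<^sub>R P"
    note C = pd[OF \<open>0 \<le> t\<close>]
    have "(det has_derivative (\<lambda>H. det ?C * trace (matrix_inv ?C ** H))) (at ?C)"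
      by (intro has_strict_derivative_imp_has_derivative has_strict_derivative_det positive_definite_imp_invertible C)
    moreover have "((\<lambda>s. A + s *\<^sub>R P) has_derivative (\<lambda>s. s *\<^sub>R P)) (at t)"
      by (auto intro!: derivative_eq_intros)
    ultimately have "((\<lambda>s. det (A + s *\<^sub>R P)) has_derivative (\<lambda>s. det ?C * trace (matrix_inv ?C ** (s *\<^sub>R P)))) (at t)"
      using has_derivative_compose[of "\<lambda>s. A + s *\<^sub>R P" _ t UNIV det] by auto
    moreover have "trace (matrix_inv ?C ** (s *\<^sub>R P)) = s * trace (matrix_inv ?C ** P)" for s
      by (simp add: trace_def matrix_matrix_mult_def sum_distrib_left mult_ac)
    ultimately have "((\<lambda>s. det (A + s *\<^sub>R P)) has_real_derivative det ?C * trace (matrix_inv ?C ** P)) (at t)"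
      unfolding has_field_derivative_def by (elim has_derivative_eq_rhs) (simp add: fun_eq_iff mult_ac)
    moreover have "det ?C * trace (matrix_inv ?C ** P) > 0"
      using positive_definite_det_pos[OF C] trace_inverse_mult_pos[OF C sym psd \<open>P \<noteq> 0\<close>] by simp
    ultimately show "\<exists>y. ((\<lambda>s. det (A + s *\<^sub>R P)) has_real_derivative y) (at t) \<and> 0 < y" by blast
  qed simp
  then show ?thesis by simp
qed

section \<open>Weak laws and the central limit theorem for iid sequences\<close>

context prob_space
begin

text \<open>An outer probability: the exceptional set only has to be covered by a measurable set of
  small mass. Bounds uniform over a continuum of parameters and statements about minimisers can then
  be handled without proving them measurable.\<close>

definition likely :: "real \<Rightarrow> (nat \<Rightarrow> 'a \<Rightarrow> bool) \<Rightarrow> bool" where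
  "likely \<kappa> P \<longleftrightarrow> (\<forall>\<^sub>F n in sequentially. \<exists>A\<in>events. prob A \<le> \<kappa> \<and> (\<forall>\<omega>\<in>space M - A. P n \<omega>))"

definition asymptotically_certain :: "(nat \<Rightarrow> 'a \<Rightarrow> bool) \<Rightarrow> bool" where
  "asymptotically_certain P \<longleftrightarrow> (\<forall>\<kappa>>0. likely \<kappa> P)"

definition bounded_in_prob :: "(nat \<Rightarrow> 'a \<Rightarrow> real) \<Rightarrow> bool" where
  "bounded_in_prob X \<longleftrightarrow> (\<forall>\<kappa>>0. \<exists>K>0. likely \<kappa> (\<lambda>n \<omega>. X n \<omega> \<le> K))"

lemma likely_mono:
  assumes "likely a P" "a \<le> b" "\<forall>\<^sub>F n in sequentially. \<forall>\<omega>\<in>space M. P n \<omega> \<longrightarrow> Q n \<omega>"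
  shows "likely b Q"
  using assms(1,3) unfolding likely_def
proof eventually_elim
  case (elim n)
  then obtain A where "A \<in> events" "prob A \<le> a" "\<forall>\<omega>\<in>space M - A. P n \<omega>" by blast
  with elim(2) \<open>a \<le> b\<close> show ?case by (intro bexI[of _ A]) auto
qed

lemma likely_conj:
  assumes "likely a P" "likely b Q"
  shows "likely (a + b) (\<lambda>n \<omega>. P n \<omega> \<and> Q n \<omega>)"
  using assms unfolding likely_def
proof eventually_elim
  case (elim n)
  then obtain A B where A: "A \<in> events" "prob A \<le> a" "\<forall>\<omega>\<in>space M - A. P n \<omega>"
    and B: "B \<in> events" "prob B \<le> b" "\<forall>\<omega>\<in>space M - B. Q n \<omega>" by blast
  have "prob (A \<union> B) \<le> a + b"
    using measure_Un_le[OF A(1) B(1)] A(2) B(2) by linarith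
  then show ?case using A B by (intro bexI[of _ "A \<union> B"]) auto
qed

lemma likely_of_prob:
  assumes "\<forall>\<^sub>F n in sequentially. A n \<in> events \<and> prob (A n) \<le> \<kappa>" "\<And>n \<omega>. \<omega> \<in> space M - A n \<Longrightarrow> P n \<omega>"
  shows "likely \<kappa> P"
  unfolding likely_def
  using assms(1)
proof eventually_elim
  case (elim n)
  then show ?case using assms(2) by (intro bexI[of _ "A n"]) auto
qed

lemma asymptotically_certain_conj:
  assumes "asymptotically_certain P" "asymptotically_certain Q"
  shows "asymptotically_certain (\<lambda>n \<omega>. P n \<omega> \<and> Q n \<omega>)"
  unfolding asymptotically_certain_def
proof (intro allI impI)
  fix \<kappa> :: real assume "\<kappa> > 0"
  then have "likely (\<kappa> / 2) P" "likely (\<kappa> / 2) Q"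
    using assms by (auto simp: asymptotically_certain_def)
  from likely_conj[OF this] show "likely \<kappa> (\<lambda>n \<omega>. P n \<omega> \<and> Q n \<omega>)" by simp
qed

lemma asymptotically_certain_mono:
  assumes "asymptotically_certain P" "\<forall>\<^sub>F n in sequentially. \<forall>\<omega>\<in>space M. P n \<omega> \<longrightarrow> Q n \<omega>"
  shows "asymptotically_certain Q"
  unfolding asymptotically_certain_def
proof (intro allI impI)
  fix \<kappa> :: real assume "\<kappa> > 0"
  then have "likely \<kappa> P" using assms(1) by (simp add: asymptotically_certain_def)
  then show "likely \<kappa> Q" by (rule likely_mono) (use assms(2) in auto)
qed

lemma asymptotically_certain_mono':
  assumes "asymptotically_certain P" "\<And>n \<omega>. \<omega> \<in> space M \<Longrightarrow> n > 0 \<Longrightarrow> P n \<omega> \<Longrightarrow> Q n \<omega>"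
  shows "asymptotically_certain Q"
proof (rule asymptotically_certain_mono[OF assms(1)])
  show "\<forall>\<^sub>F n in sequentially. \<forall>\<omega>\<in>space M. P n \<omega> \<longrightarrow> Q n \<omega>"
    using eventually_gt_at_top[of "0::nat"] by eventually_elim (use assms(2) in blast)
qed

lemma asymptotically_certain_eventually:
  assumes "\<forall>\<^sub>F n in sequentially. \<forall>\<omega>\<in>space M. P n \<omega>"
  shows "asymptotically_certain P"
  unfolding asymptotically_certain_def likely_def
proof (intro allI impI)
  fix \<kappa> :: real assume "\<kappa> > 0"
  show "\<forall>\<^sub>F n in sequentially. \<exists>A\<in>events. prob A \<le> \<kappa> \<and> (\<forall>\<omega>\<in>space M - A. P n \<omega>)"
    using assms by eventually_elim (use \<open>\<kappa> > 0\<close> in \<open>auto intro!: bexI[of _ "{}"]\<close>)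
qed

lemma asymptotically_certain_ball:
  assumes "finite I" "\<And>i. i \<in> I \<Longrightarrow> asymptotically_certain (P i)"
  shows "asymptotically_certain (\<lambda>n \<omega>. \<forall>i\<in>I. P i n \<omega>)"
  using assms
proof (induction I rule: finite_induct)
  case empty
  then show ?case by (intro asymptotically_certain_eventually) auto
next
  case (insert i I)
  then have "asymptotically_certain (\<lambda>n \<omega>. P i n \<omega> \<and> (\<forall>i\<in>I. P i n \<omega>))"
    by (intro asymptotically_certain_conj) auto
  then show ?case by simp
qed

lemma bounded_in_probI:
  assumes "asymptotically_certain (\<lambda>n \<omega>. X n \<omega> \<le> K)"
  shows "bounded_in_prob X"
  unfolding bounded_in_prob_def
proof (intro allI impI)
  fix \<kappa> :: real assume "\<kappa> > 0"
  then have "likely \<kappa> (\<lambda>n \<omega>. X n \<omega> \<le> K)" using assms by (simp add: asymptotically_certain_def)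
  then have "likely \<kappa> (\<lambda>n \<omega>. X n \<omega> \<le> max K 1)"
    by (rule likely_mono) (auto intro!: always_eventually)
  then show "\<exists>K>0. likely \<kappa> (\<lambda>n \<omega>. X n \<omega> \<le> K)" by (intro exI[of _ "max K 1"]) auto
qed

lemma bounded_in_prob_mono:
  assumes "bounded_in_prob X" "\<And>n \<omega>. \<omega> \<in> space M \<Longrightarrow> Y n \<omega> \<le> X n \<omega>"
  shows "bounded_in_prob Y"
  unfolding bounded_in_prob_def
proof (intro allI impI)
  fix \<kappa> :: real assume "\<kappa> > 0"
  then obtain K where K: "K > 0" "likely \<kappa> (\<lambda>n \<omega>. X n \<omega> \<le> K)"
    using assms(1) unfolding bounded_in_prob_def by blast
  from K(2) have "likely \<kappa> (\<lambda>n \<omega>. Y n \<omega> \<le> K)"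
    by (rule likely_mono) (auto intro!: always_eventually intro: order_trans[OF assms(2)])
  with K(1) show "\<exists>K>0. likely \<kappa> (\<lambda>n \<omega>. Y n \<omega> \<le> K)" by blast
qed

lemma bounded_in_prob_add:
  assumes "bounded_in_prob X" "bounded_in_prob Y"
  shows "bounded_in_prob (\<lambda>n \<omega>. X n \<omega> + Y n \<omega>)"
  unfolding bounded_in_prob_def
proof (intro allI impI)
  fix \<kappa> :: real assume "\<kappa> > 0"
  then have "\<kappa> / 2 > 0" by simp
  then obtain K L where K: "K > 0" "likely (\<kappa> / 2) (\<lambda>n \<omega>. X n \<omega> \<le> K)"
    and L: "L > 0" "likely (\<kappa> / 2) (\<lambda>n \<omega>. Y n \<omega> \<le> L)"
    using assms unfolding bounded_in_prob_def by blast
  have "likely \<kappa> (\<lambda>n \<omega>. X n \<omega> + Y n \<omega> \<le> K + L)"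
    by (rule likely_mono[OF likely_conj[OF K(2) L(2)]]) (auto intro!: always_eventually)
  then show "\<exists>K>0. likely \<kappa> (\<lambda>n \<omega>. X n \<omega> + Y n \<omega> \<le> K)" using K L by (intro exI[of _ "K + L"]) auto
qed

lemma bounded_in_prob_sum:
  assumes "finite I" "\<And>i. i \<in> I \<Longrightarrow> bounded_in_prob (X i)"
  shows "bounded_in_prob (\<lambda>n \<omega>. \<Sum>i\<in>I. X i n \<omega>)"
  using assms
proof (induction I rule: finite_induct)
  case empty
  then show ?case
    by (auto intro!: bounded_in_probI[of _ 1] asymptotically_certain_eventually)
next
  case (insert i I)
  then show ?case by (simp add: bounded_in_prob_add)
qed

end

text \<open>Independence concerns finite subfamilies, and the chosen events are carried along the
  injection by its inverse. It serves to shift the index of a sequence by one.\<close>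

lemma (in prob_space) indep_vars_reindex:
  assumes h: "inj_on h I" and x: "indep_vars (\<lambda>_. N) x (h ` I)"
  shows "indep_vars (\<lambda>_. N) (\<lambda>i. x (h i)) I"
proof -
  let ?F = "\<lambda>k. {x k -` A \<inter> space M |A. A \<in> sets N}"
  have rv: "\<And>k. k \<in> h ` I \<Longrightarrow> random_variable N (x k)" and ind: "indep_sets ?F (h ` I)"
    using x by (auto simp: indep_vars_def2)
  have "indep_sets (\<lambda>i. ?F (h i)) I"
  proof (rule indep_setsI)
    fix i assume "i \<in> I"
    then show "?F (h i) \<subseteq> events" using ind by (auto simp: indep_sets_def)
  next
    fix A J assume J: "J \<noteq> {}" "J \<subseteq> I" "finite J" "\<forall>j\<in>J. A j \<in> ?F (h j)"
    define A' where "A' k = A (inv_into I h k)" for k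
    have A': "A' (h j) = A j" if "j \<in> J" for j using that J(2) h by (auto simp: A'_def)
    have "prob (\<Inter>k\<in>h ` J. A' k) = (\<Prod>k\<in>h ` J. prob (A' k))"
      using J A' by (intro indep_setsD[OF ind]) auto
    also have "(\<Inter>k\<in>h ` J. A' k) = (\<Inter>j\<in>J. A j)" using A' by auto
    also have "(\<Prod>k\<in>h ` J. prob (A' k)) = (\<Prod>j\<in>J. prob (A' (h j)))"
      by (rule prod.reindex_cong[OF inj_on_subset[OF h J(2)]]) auto
    also have "\<dots> = (\<Prod>j\<in>J. prob (A j))" using A' by (intro prod.cong) auto
    finally show "prob (\<Inter>j\<in>J. A j) = (\<Prod>j\<in>J. prob (A j))" .
  qed
  then show ?thesis using rv by (auto simp: indep_vars_def2)
qed

section \<open>Empirical means of an iid sequence\<close>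

locale iid_sequence = prob_space M for M :: "'w measure" +
  fixes x :: "nat \<Rightarrow> 'w \<Rightarrow> 'b::topological_space"
  assumes indep: "indep_vars (\<lambda>_. borel) x UNIV"
    and identical: "\<And>t. distr M borel (x t) = distr M borel (x 0)"
begin

lemma x_measurable [measurable]: "x t \<in> borel_measurable M"
  using indep by (simp add: indep_vars_def)

lemma transfer_integrable:
  fixes f :: "'b \<Rightarrow> 'c::{banach, second_countable_topology}"
  assumes [measurable]: "f \<in> borel_measurable borel"
  shows "integrable M (\<lambda>\<omega>. f (x t \<omega>)) \<longleftrightarrow> integrable M (\<lambda>\<omega>. f (x 0 \<omega>))"
  using integrable_distr_eq[of "x t" M borel f] integrable_distr_eq[of "x 0" M borel f]
  by (simp add: identical[of t])

lemma transfer_integral: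
  fixes f :: "'b \<Rightarrow> 'c::{banach, second_countable_topology}"
  assumes [measurable]: "f \<in> borel_measurable borel"
  shows "(LINT \<omega>|M. f (x t \<omega>)) = (LINT \<omega>|M. f (x 0 \<omega>))"
  using integral_distr[of "x t" M borel f] integral_distr[of "x 0" M borel f]
  by (simp add: identical[of t])

definition emp :: "nat \<Rightarrow> ('b \<Rightarrow> 'c::real_vector) \<Rightarrow> 'w \<Rightarrow> 'c" where
  "emp n f \<omega> = (1 / real n) *\<^sub>R (\<Sum>t=1..n. f (x t \<omega>))"

definition expect :: "('b \<Rightarrow> 'c::{banach, second_countable_topology}) \<Rightarrow> 'c" where
  "expect f = (LINT \<omega>|M. f (x 0 \<omega>))"

text \<open>Borel measurability of \<open>f\<close> itself is included, because integrability and
  integrals pass from index 0 to index t through the common law on the value space.\<close>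

definition integ :: "('b \<Rightarrow> 'c::{banach, second_countable_topology}) \<Rightarrow> bool" where
  "integ f \<longleftrightarrow> f \<in> borel_measurable borel \<and> integrable M (\<lambda>\<omega>. f (x 0 \<omega>))"

lemma integ_measurable: "integ f \<Longrightarrow> f \<in> borel_measurable borel"
  by (simp add: integ_def)

lemma integ_bound:
  fixes f :: "'b \<Rightarrow> 'c::{banach, second_countable_topology}" and g :: "'b \<Rightarrow> real"
  assumes "f \<in> borel_measurable borel" "integ g" "\<And>z. norm (f z) \<le> g z"
  shows "integ f"
  unfolding integ_def
proof
  note [measurable] = assms(1)
  have le: "norm (f z) \<le> norm (g z)" for z using assms(3)[of z] by simp
  show "integrable M (\<lambda>\<omega>. f (x 0 \<omega>))"
  proof (rule Bochner_Integration.integrable_bound)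
    show "integrable M (\<lambda>\<omega>. g (x 0 \<omega>))" using assms(2) by (simp add: integ_def)
    show "(\<lambda>\<omega>. f (x 0 \<omega>)) \<in> borel_measurable M" by measurable
    show "AE \<omega> in M. norm (f (x 0 \<omega>)) \<le> norm (g (x 0 \<omega>))" by (intro AE_I2 le)
  qed
qed (rule assms(1))

lemma integ_add: "integ f \<Longrightarrow> integ g \<Longrightarrow> integ (\<lambda>z. f z + g z)"
  by (auto simp: integ_def)

lemma integ_diff: "integ f \<Longrightarrow> integ g \<Longrightarrow> integ (\<lambda>z. f z - g z)"
  by (auto simp: integ_def)

lemma integ_cmult: "integ f \<Longrightarrow> integ (\<lambda>z. c * f z)" for f :: "'b \<Rightarrow> real"
  by (auto simp: integ_def)

lemma integ_sum: "(\<And>i. i \<in> I \<Longrightarrow> integ (f i)) \<Longrightarrow> integ (\<lambda>z. \<Sum>i\<in>I. f i z)"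
  unfolding integ_def by (intro conjI borel_measurable_sum Bochner_Integration.integrable_sum) auto

lemma integ_const: "integ (\<lambda>z. c)"
  by (auto simp: integ_def)

lemma integ_abs: "integ f \<Longrightarrow> integ (\<lambda>z. \<bar>f z\<bar>)" for f :: "'b \<Rightarrow> real"
  by (auto simp: integ_def)

lemma expect_add: "integ f \<Longrightarrow> integ g \<Longrightarrow> expect (\<lambda>z. f z + g z) = expect f + expect g"
  by (simp add: integ_def expect_def)

lemma expect_diff: "integ f \<Longrightarrow> integ g \<Longrightarrow> expect (\<lambda>z. f z - g z) = expect f - expect g"
  by (simp add: integ_def expect_def)

lemma expect_cmult: "integ f \<Longrightarrow> expect (\<lambda>z. c * f z) = c * expect f" for f :: "'b \<Rightarrow> real"
  by (simp add: integ_def expect_def)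

lemma expect_sum: "(\<And>i. i \<in> I \<Longrightarrow> integ (f i)) \<Longrightarrow> expect (\<lambda>z. \<Sum>i\<in>I. f i z) = (\<Sum>i\<in>I. expect (f i))"
  by (simp add: integ_def expect_def)

lemma expect_mono: "integ f \<Longrightarrow> integ g \<Longrightarrow> (\<And>z. f z \<le> g z) \<Longrightarrow> expect f \<le> expect g" for f :: "'b \<Rightarrow> real"
  unfolding expect_def by (intro integral_mono) (auto simp: integ_def)

lemma expect_abs: "\<bar>expect f\<bar> \<le> expect (\<lambda>z. \<bar>f z\<bar>)" for f :: "'b \<Rightarrow> real"
  unfolding expect_def by (rule integral_abs_bound)

lemma expect_const: "expect (\<lambda>z. c) = c"
  by (simp add: expect_def prob_space)

lemma emp_add: "emp n (\<lambda>z. f z + g z) \<omega> = emp n f \<omega> + emp n g \<omega>"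
  by (simp add: emp_def sum.distrib scaleR_add_right)

lemma emp_diff: "emp n (\<lambda>z. f z - g z) \<omega> = emp n f \<omega> - emp n g \<omega>"
  by (simp add: emp_def sum_subtractf scaleR_diff_right)

lemma emp_cmult: "emp n (\<lambda>z. c * f z) \<omega> = c * emp n f \<omega>" for f :: "'b \<Rightarrow> real"
  by (simp add: emp_def sum_distrib_left mult_ac)

lemma emp_sum: "emp n (\<lambda>z. \<Sum>i\<in>I. f i z) \<omega> = (\<Sum>i\<in>I. emp n (f i) \<omega>)"
  unfolding emp_def by (subst sum.swap) (simp add: scaleR_sum_right)

lemma emp_const: "n > 0 \<Longrightarrow> emp n (\<lambda>z. c) \<omega> = c"
  by (simp add: emp_def scaleR_conv_of_real sum_constant_scaleR)

lemma emp_mono: "(\<And>z. f z \<le> g z) \<Longrightarrow> emp n f \<omega> \<le> emp n g \<omega>" for f :: "'b \<Rightarrow> real"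
  unfolding emp_def by (simp add: divide_right_mono sum_mono)

lemma emp_norm: "norm (emp n f \<omega>) \<le> emp n (\<lambda>z. norm (f z)) \<omega>" for f :: "'b \<Rightarrow> 'c::real_normed_vector"
  unfolding emp_def by (simp add: divide_right_mono norm_sum)

lemma emp_measurable [measurable]:
  fixes f :: "'b \<Rightarrow> 'c::euclidean_space"
  assumes [measurable]: "f \<in> borel_measurable borel"
  shows "emp n f \<in> borel_measurable M"
  unfolding emp_def by measurable

lemma indep_image:
  assumes "f \<in> borel_measurable borel"
  shows "indep_vars (\<lambda>_. borel) (\<lambda>t \<omega>. f (x t \<omega>)) UNIV"
  using indep_vars_compose2[OF indep, of "\<lambda>_. f" "\<lambda>_. borel"] assms by simp

text \<open>After expanding the square, independence factors the off-diagonal expectations, and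
  centering makes them vanish; n diagonal terms remain.\<close>

lemma sum_second_moment:
  fixes f :: "'b \<Rightarrow> real"
  assumes f: "f \<in> borel_measurable borel" and sq: "integ (\<lambda>z. (f z)\<^sup>2)" and mean: "expect f = 0"
  shows "integrable M (\<lambda>\<omega>. (\<Sum>t=1..n. f (x t \<omega>))\<^sup>2)"
    and "(LINT \<omega>|M. (\<Sum>t=1..n. f (x t \<omega>))\<^sup>2) = real n * expect (\<lambda>z. (f z)\<^sup>2)"
proof -
  note [measurable] = f
  have sqt: "integrable M (\<lambda>\<omega>. (f (x t \<omega>))\<^sup>2)" for t
    using sq transfer_integrable[of "\<lambda>z. (f z)\<^sup>2" t] by (simp add: integ_def)
  have int: "integrable M (\<lambda>\<omega>. f (x t \<omega>))" for t
    by (rule square_integrable_imp_integrable[OF _ sqt]) measurable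
  have mt: "(LINT \<omega>|M. f (x t \<omega>)) = 0" for t
    using mean transfer_integral[OF f, of t] by (simp add: expect_def)
  have cross: "integrable M (\<lambda>\<omega>. f (x s \<omega>) * f (x t \<omega>)) \<and>
    (LINT \<omega>|M. f (x s \<omega>) * f (x t \<omega>)) = (if s = t then expect (\<lambda>z. (f z)\<^sup>2) else 0)" for s t
  proof (cases "s = t")
    case True
    then show ?thesis
      using sqt[of t] transfer_integral[of "\<lambda>z. (f z)\<^sup>2" t] by (simp add: power2_eq_square expect_def)
  next
    case False
    have "indep_vars (\<lambda>_. borel) (\<lambda>t \<omega>. f (x t \<omega>)) {s, t}"
      by (rule indep_vars_subset[OF indep_image[OF f]]) auto
    from indep_vars_lebesgue_integral[OF _ this] indep_vars_integrable[OF _ this] int False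
    show ?thesis by (simp add: mt)
  qed
  have eq: "(\<Sum>t=1..n. f (x t \<omega>))\<^sup>2 = (\<Sum>s=1..n. \<Sum>t=1..n. f (x s \<omega>) * f (x t \<omega>))" for \<omega>
    by (simp add: power2_eq_square sum_product)
  show "integrable M (\<lambda>\<omega>. (\<Sum>t=1..n. f (x t \<omega>))\<^sup>2)"
    unfolding eq using cross by (intro Bochner_Integration.integrable_sum) auto
  have "(LINT \<omega>|M. (\<Sum>t=1..n. f (x t \<omega>))\<^sup>2) = (\<Sum>s=1..n. \<Sum>t=1..n. (if s = t then expect (\<lambda>z. (f z)\<^sup>2) else 0))"
    unfolding eq using cross by (subst Bochner_Integration.integral_sum) (auto intro!: sum.cong)
  also have "\<dots> = real n * expect (\<lambda>z. (f z)\<^sup>2)"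
    by (subst sum.cong[OF refl, of _ _ "\<lambda>_. expect (\<lambda>z. (f z)\<^sup>2)"]) auto
  finally show "(LINT \<omega>|M. (\<Sum>t=1..n. f (x t \<omega>))\<^sup>2) = real n * expect (\<lambda>z. (f z)\<^sup>2)" .
qed

lemma chebyshev_emp:
  fixes f :: "'b \<Rightarrow> real"
  assumes f: "f \<in> borel_measurable borel" and sq: "integ (\<lambda>z. (f z)\<^sup>2)" and mean: "expect f = 0"
    and "a > 0" "n > 0"
  shows "prob {\<omega>\<in>space M. a \<le> \<bar>emp n f \<omega>\<bar>} \<le> expect (\<lambda>z. (f z)\<^sup>2) / (real n * a\<^sup>2)"
proof -
  note [measurable] = f
  note sm = sum_second_moment[OF f sq mean, of n]
  have "{\<omega>\<in>space M. a \<le> \<bar>emp n f \<omega>\<bar>} = {\<omega>\<in>space M. (real n * a)\<^sup>2 \<le> (\<Sum>t=1..n. f (x t \<omega>))\<^sup>2}"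
  proof -
    have "a \<le> \<bar>emp n f \<omega>\<bar> \<longleftrightarrow> \<bar>real n * a\<bar> \<le> \<bar>\<Sum>t=1..n. f (x t \<omega>)\<bar>" for \<omega>
      using \<open>n > 0\<close> \<open>a > 0\<close> by (simp add: emp_def abs_mult pos_le_divide_eq mult.commute)
    then show ?thesis by (simp only: abs_le_square_iff)
  qed
  also have "prob \<dots> \<le> (LINT \<omega>|M. (\<Sum>t=1..n. f (x t \<omega>))\<^sup>2) / (real n * a)\<^sup>2"
    using sm(1) \<open>n > 0\<close> \<open>a > 0\<close> by (intro integral_Markov_inequality_measure[where A = "{}"]) auto
  also have "\<dots> = expect (\<lambda>z. (f z)\<^sup>2) / (real n * a\<^sup>2)"
    unfolding sm(2) using \<open>n > 0\<close> by (simp add: power2_eq_square)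
  finally show ?thesis .
qed

lemma bounded_in_prob_emp:
  fixes f :: "'b \<Rightarrow> real"
  assumes f: "f \<in> borel_measurable borel" and sq: "integ (\<lambda>z. (f z)\<^sup>2)" and mean: "expect f = 0"
  shows "bounded_in_prob (\<lambda>n \<omega>. sqrt (real n) * \<bar>emp n f \<omega>\<bar>)"
  unfolding bounded_in_prob_def
proof (intro allI impI)
  fix \<kappa> :: real assume "\<kappa> > 0"
  define v where "v = expect (\<lambda>z. (f z)\<^sup>2)"
  have "v \<ge> 0" by (simp add: v_def expect_def)
  \<comment> \<open>Chebyshev's inequality at level K / sqrt n gives v / K^2 = \<kappa> v / (v + 1);
    the added 1 keeps \<open>K\<close> positive when the variance is 0.\<close>
  define K where "K = sqrt ((v + 1) / \<kappa>)"
  have K: "K > 0" "K\<^sup>2 = (v + 1) / \<kappa>" using \<open>v \<ge> 0\<close> \<open>\<kappa> > 0\<close> by (simp_all add: K_def)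
  note [measurable] = f
  have "likely \<kappa> (\<lambda>n \<omega>. sqrt (real n) * \<bar>emp n f \<omega>\<bar> \<le> K)"
  \<comment> \<open>At n = 0 the exceptional set is empty: the factor sqrt 0 already makes the bound
    hold.\<close>
  proof (rule likely_of_prob[where A = "\<lambda>n. {\<omega>\<in>space M. K / sqrt (real n) \<le> \<bar>emp n f \<omega>\<bar>} \<inter> (if n = 0 then {} else UNIV)"])
    show "\<forall>\<^sub>F n in sequentially. {\<omega>\<in>space M. K / sqrt (real n) \<le> \<bar>emp n f \<omega>\<bar>} \<inter> (if n = 0 then {} else UNIV) \<in> events \<and>
       prob ({\<omega>\<in>space M. K / sqrt (real n) \<le> \<bar>emp n f \<omega>\<bar>} \<inter> (if n = 0 then {} else UNIV)) \<le> \<kappa>"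
      using eventually_gt_at_top[of 0]
    proof eventually_elim
      case (elim n)
      have "prob {\<omega>\<in>space M. K / sqrt (real n) \<le> \<bar>emp n f \<omega>\<bar>} \<le> v / (real n * (K / sqrt (real n))\<^sup>2)"
        unfolding v_def using elim K(1) by (intro chebyshev_emp f sq mean) auto
      also have "\<dots> = v / (v + 1) * \<kappa>"
        using elim K(2) by (simp add: power_divide)
      also have "\<dots> \<le> 1 * \<kappa>" using \<open>v \<ge> 0\<close> \<open>\<kappa> > 0\<close> by (intro mult_right_mono) auto
      finally show ?case using elim by simp
    qed
  next
    fix n \<omega> assume "\<omega> \<in> space M - {\<omega>\<in>space M. K / sqrt (real n) \<le> \<bar>emp n f \<omega>\<bar>} \<inter> (if n = 0 then {} else UNIV)"
    then show "sqrt (real n) * \<bar>emp n f \<omega>\<bar> \<le> K"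
      using K(1) by (cases "n = 0") (auto simp: not_le pos_less_divide_eq mult.commute)
  qed
  then show "\<exists>K>0. likely \<kappa> (\<lambda>n \<omega>. sqrt (real n) * \<bar>emp n f \<omega>\<bar> \<le> K)" using K(1) by blast
qed

lemma truncation:
  fixes f :: "'b \<Rightarrow> real"
  assumes f: "integ f" and "e > 0"
  obtains c where "c > 0" "expect (\<lambda>z. if \<bar>f z\<bar> \<le> c then 0 else \<bar>f z\<bar>) < e"
proof -
  note [measurable] = integ_measurable[OF f]
  have "(\<lambda>m. LINT \<omega>|M. (if \<bar>f (x 0 \<omega>)\<bar> \<le> real m then 0 else \<bar>f (x 0 \<omega>)\<bar>)) \<longlonglongrightarrow> (LINT \<omega>|M. 0)"
  proof (rule integral_dominated_convergence[where w = "\<lambda>\<omega>. \<bar>f (x 0 \<omega>)\<bar>"])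
    show "AE \<omega> in M. (\<lambda>m. if \<bar>f (x 0 \<omega>)\<bar> \<le> real m then 0 else \<bar>f (x 0 \<omega>)\<bar>) \<longlonglongrightarrow> 0"
    proof (intro AE_I2 tendsto_eventually)
      fix \<omega>
      obtain N where "\<bar>f (x 0 \<omega>)\<bar> \<le> real N" using real_arch_simple by blast
      then have "(if \<bar>f (x 0 \<omega>)\<bar> \<le> real m then 0 else \<bar>f (x 0 \<omega>)\<bar>) = 0" if "m \<ge> N" for m
        using that by auto
      then show "\<forall>\<^sub>F m in sequentially. (if \<bar>f (x 0 \<omega>)\<bar> \<le> real m then 0 else \<bar>f (x 0 \<omega>)\<bar>) = 0"
        by (rule eventually_sequentiallyI)
    qed
  qed (use f in \<open>auto simp: integ_def\<close>)
  then have "(\<lambda>m. expect (\<lambda>z. if \<bar>f z\<bar> \<le> real m then 0 else \<bar>f z\<bar>)) \<longlonglongrightarrow> 0"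
    by (simp add: expect_def)
  then have "\<forall>\<^sub>F m in sequentially. expect (\<lambda>z. if \<bar>f z\<bar> \<le> real m then 0 else \<bar>f z\<bar>) < e"
    using \<open>e > 0\<close> by (rule order_tendstoD)
  moreover have "\<forall>\<^sub>F m::nat in sequentially. m > 0" by (rule eventually_gt_at_top)
  ultimately have "\<forall>\<^sub>F m in sequentially. expect (\<lambda>z. if \<bar>f z\<bar> \<le> real m then 0 else \<bar>f z\<bar>) < e \<and> m > 0"
    by eventually_elim simp
  then obtain m where "expect (\<lambda>z. if \<bar>f z\<bar> \<le> real m then 0 else \<bar>f z\<bar>) < e" "m > 0"
    by (auto simp: eventually_sequentially)
  then show ?thesis by (intro that[of "real m"]) auto
qed

lemma markov_emp:
  fixes f :: "'b \<Rightarrow> real"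
  assumes f: "integ f" "\<And>z. 0 \<le> f z" and "a > 0"
  shows "prob {\<omega>\<in>space M. a \<le> emp n f \<omega>} \<le> expect f / a"
proof -
  note [measurable] = integ_measurable[OF f(1)]
  have int: "integrable M (\<lambda>\<omega>. f (x t \<omega>))" for t
    using f(1) transfer_integrable[of f t] by (simp add: integ_def)
  have "prob {\<omega>\<in>space M. a \<le> emp n f \<omega>} \<le> (LINT \<omega>|M. emp n f \<omega>) / a"
    using int f(2) \<open>a > 0\<close>
    by (intro integral_Markov_inequality_measure[where A = "{}"]) (auto simp: emp_def intro!: sum_nonneg divide_nonneg_nonneg)
  also have "(LINT \<omega>|M. emp n f \<omega>) = (if n = 0 then 0 else expect f)"
    unfolding emp_def using int by (simp add: transfer_integral[of f] expect_def[symmetric])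
  also have "\<dots> / a \<le> expect f / a"
    using \<open>a > 0\<close> f(2) by (auto simp: expect_def intro!: divide_right_mono integral_nonneg)
  finally show ?thesis .
qed

text \<open>Only a first moment is available, so \<open>f\<close> is truncated: the bounded centred
  part has a variance and obeys Chebyshev's inequality, the large part has small mean and obeys
  Markov's inequality.\<close>

theorem weak_law:
  fixes f :: "'b \<Rightarrow> real"
  assumes f: "integ f" and "e > 0"
  shows "asymptotically_certain (\<lambda>n \<omega>. \<bar>emp n f \<omega> - expect f\<bar> \<le> e)"
  unfolding asymptotically_certain_def
proof (intro allI impI)
  fix \<kappa> :: real assume "\<kappa> > 0"
  note [measurable] = integ_measurable[OF f]
  \<comment> \<open>The mean of the discarded part enters twice: as a bias, bounded by e / 3, and in
    Markov's inequality at level e / 3, where \<kappa> e / 6 gives probability \<kappa> / 2.\<close>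
  define r where "r = min (e / 3) (\<kappa> * e / 6)"
  have "r > 0" using \<open>e > 0\<close> \<open>\<kappa> > 0\<close> by (simp add: r_def)
  obtain c where c: "c > 0" "expect (\<lambda>z. if \<bar>f z\<bar> \<le> c then 0 else \<bar>f z\<bar>) < r"
    by (rule truncation[OF f \<open>r > 0\<close>])
  define g where "g z = (if \<bar>f z\<bar> \<le> c then 0 else f z)" for z
  have [measurable]: "g \<in> borel_measurable borel" unfolding g_def by measurable
  have g: "integ g" by (rule integ_bound[OF _ integ_abs[OF f]]) (auto simp: g_def)
  have ga: "expect (\<lambda>z. \<bar>g z\<bar>) < r"
    using c(2) by (simp add: g_def if_distrib)
  define m where "m = expect (\<lambda>z. f z - g z)"
  define h where "h z = (f z - g z) - m" for z
  have h: "integ h" unfolding h_def by (intro integ_diff integ_const f g)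
  have [measurable]: "h \<in> borel_measurable borel" by (rule integ_measurable[OF h])
  have h0: "expect h = 0" unfolding h_def by (simp add: expect_diff integ_diff integ_const f g expect_const m_def)
  have hsq: "integ (\<lambda>z. (h z)\<^sup>2)"
  proof (rule integ_bound[OF _ integ_const[of "(c + \<bar>m\<bar>)\<^sup>2"]])
    fix z
    have "\<bar>h z\<bar> \<le> c + \<bar>m\<bar>" using c(1) by (auto simp: h_def g_def)
    then show "norm ((h z)\<^sup>2) \<le> (c + \<bar>m\<bar>)\<^sup>2" by (simp add: abs_le_square_iff[symmetric] c(1) less_imp_le)
  qed measurable
  define v where "v = expect (\<lambda>z. (h z)\<^sup>2)"
  have "v \<ge> 0" by (simp add: v_def expect_def)
  have le: "\<bar>m - expect f\<bar> \<le> e / 3"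
    using expect_abs[of g] ga by (simp add: m_def expect_diff f g r_def)
  let ?A = "\<lambda>n. {\<omega>\<in>space M. e / 3 \<le> \<bar>emp n h \<omega>\<bar>} \<union> {\<omega>\<in>space M. e / 3 \<le> emp n (\<lambda>z. \<bar>g z\<bar>) \<omega>} \<union> (if n = 0 then space M else {})"
  have "(\<lambda>n. v / (real n * (e / 3)\<^sup>2)) \<longlonglongrightarrow> 0"
    using \<open>e > 0\<close> by real_asymp
  then have "\<forall>\<^sub>F n in sequentially. v / (real n * (e / 3)\<^sup>2) < \<kappa> / 2"
    using \<open>\<kappa> > 0\<close> by (intro order_tendstoD) auto
  then have "\<forall>\<^sub>F n in sequentially. ?A n \<in> events \<and> prob (?A n) \<le> \<kappa>"
    using eventually_gt_at_top[of 0]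
  proof eventually_elim
    case (elim n)
    have "prob (?A n) \<le> prob {\<omega>\<in>space M. e / 3 \<le> \<bar>emp n h \<omega>\<bar>} + prob {\<omega>\<in>space M. e / 3 \<le> emp n (\<lambda>z. \<bar>g z\<bar>) \<omega>}"
      using elim(2) by (simp add: measure_Un_le)
    also have "prob {\<omega>\<in>space M. e / 3 \<le> \<bar>emp n h \<omega>\<bar>} \<le> v / (real n * (e / 3)\<^sup>2)"
      unfolding v_def using elim \<open>e > 0\<close> by (intro chebyshev_emp hsq h0) auto
    also have "prob {\<omega>\<in>space M. e / 3 \<le> emp n (\<lambda>z. \<bar>g z\<bar>) \<omega>} \<le> expect (\<lambda>z. \<bar>g z\<bar>) / (e / 3)"
      using \<open>e > 0\<close> by (intro markov_emp integ_abs g) auto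
    also have "\<dots> \<le> r / (e / 3)" using ga \<open>e > 0\<close> by (intro divide_right_mono) auto
    also have "\<dots> \<le> (\<kappa> * e / 6) / (e / 3)" using \<open>e > 0\<close> by (intro divide_right_mono) (auto simp: r_def)
    also have "\<dots> = \<kappa> / 2" using \<open>e > 0\<close> by simp
    finally have le: "prob (?A n) \<le> v / (real n * (e / 3)\<^sup>2) + \<kappa> / 2" by simp
    have "?A n \<in> events" using elim(2) by simp
    then show ?case using le elim(1) by linarith
  qed
  then show "likely \<kappa> (\<lambda>n \<omega>. \<bar>emp n f \<omega> - expect f\<bar> \<le> e)"
  proof (rule likely_of_prob)
    fix n \<omega> assume a: "\<omega> \<in> space M - ?A n"
    then have n: "n > 0" by (cases "n = 0") auto
    have "\<bar>emp n h \<omega>\<bar> < e / 3" "emp n (\<lambda>z. \<bar>g z\<bar>) \<omega> < e / 3" using a by auto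
    moreover have "\<bar>emp n g \<omega>\<bar> \<le> emp n (\<lambda>z. \<bar>g z\<bar>) \<omega>" using emp_norm[of n g \<omega>] by simp
    moreover have "emp n h \<omega> = emp n f \<omega> - emp n g \<omega> - m"
      using n by (simp add: h_def[abs_def] emp_diff emp_const)
    ultimately show "\<bar>emp n f \<omega> - expect f\<bar> \<le> e" using le by linarith
  qed
qed

text \<open>A finite net reduces the supremum to finitely many parameters; the integrable Lipschitz
  factor controls the oscillation between them, both for the empirical mean and for the
  expectation.\<close>

theorem uniform_weak_law:
  fixes f :: "'p::metric_space \<Rightarrow> 'b \<Rightarrow> real"
  assumes \<Theta>: "compact \<Theta>" and f: "\<And>W. W \<in> \<Theta> \<Longrightarrow> integ (f W)" and L: "integ L" "\<And>z. 0 \<le> L z"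
    and lip: "\<And>W V z. W \<in> \<Theta> \<Longrightarrow> V \<in> \<Theta> \<Longrightarrow> \<bar>f W z - f V z\<bar> \<le> L z * dist W V" and "e > 0"
  shows "asymptotically_certain (\<lambda>n \<omega>. \<forall>W\<in>\<Theta>. \<bar>emp n (f W) \<omega> - expect (f W)\<bar> \<le> e)"
proof -
  define l where "l = expect L"
  have "l \<ge> 0" using L(2) by (simp add: l_def expect_def)
  \<comment> \<open>The mesh gives d (2 l + 1) = e / 2: the oscillation is at most d (l + 1) for the
    empirical mean, once the mean of \<open>L\<close> is within 1 of \<open>l\<close>, and d l for
    the expectation.\<close>
  define d where "d = e / (2 * (2 * l + 1))"
  have "d > 0" using \<open>e > 0\<close> \<open>l \<ge> 0\<close> by (simp add: d_def)
  have "\<Theta> \<subseteq> (\<Union>c\<in>\<Theta>. ball c d)" using \<open>d > 0\<close> by auto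
  then obtain C where C: "C \<subseteq> \<Theta>" "finite C" "\<Theta> \<subseteq> (\<Union>c\<in>C. ball c d)"
    by (rule compactE_image[OF \<Theta> open_ball])
  have "asymptotically_certain (\<lambda>n \<omega>. (\<forall>c\<in>C. \<bar>emp n (f c) \<omega> - expect (f c)\<bar> \<le> e / 2) \<and> \<bar>emp n L \<omega> - expect L\<bar> \<le> 1)"
    using C f L(1) \<open>e > 0\<close> by (intro asymptotically_certain_conj asymptotically_certain_ball weak_law) auto
  then show ?thesis
  proof (rule asymptotically_certain_mono', intro ballI)
    fix n \<omega> W
    assume *: "(\<forall>c\<in>C. \<bar>emp n (f c) \<omega> - expect (f c)\<bar> \<le> e / 2) \<and> \<bar>emp n L \<omega> - expect L\<bar> \<le> 1" and "W \<in> \<Theta>"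
    then obtain c where c: "c \<in> C" "dist c W < d" using C(3) by auto
    have "c \<in> \<Theta>" using c C by auto
    have "\<bar>emp n (f W) \<omega> - emp n (f c) \<omega>\<bar> \<le> emp n (\<lambda>z. \<bar>f W z - f c z\<bar>) \<omega>"
      using emp_norm[of n "\<lambda>z. f W z - f c z" \<omega>] by (simp add: emp_diff)
    also have "\<dots> \<le> emp n (\<lambda>z. dist W c * L z) \<omega>"
      using lip[OF \<open>W \<in> \<Theta>\<close> \<open>c \<in> \<Theta>\<close>] by (intro emp_mono) (simp add: mult.commute)
    also have "\<dots> = dist W c * emp n L \<omega>" by (rule emp_cmult)
    also have "\<dots> \<le> d * (l + 1)"
    proof (intro mult_mono)
      show "0 \<le> emp n L \<omega>" using L(2) by (simp add: emp_def sum_nonneg)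
    qed (use c(2) * \<open>d > 0\<close> in \<open>auto simp: dist_commute l_def\<close>)
    finally have 1: "\<bar>emp n (f W) \<omega> - emp n (f c) \<omega>\<bar> \<le> d * (l + 1)" .
    have "\<bar>expect (f W) - expect (f c)\<bar> \<le> expect (\<lambda>z. \<bar>f W z - f c z\<bar>)"
      using expect_abs[of "\<lambda>z. f W z - f c z"] f \<open>W \<in> \<Theta>\<close> \<open>c \<in> \<Theta>\<close> by (simp add: expect_diff)
    also have "\<dots> \<le> expect (\<lambda>z. dist W c * L z)"
      using lip[OF \<open>W \<in> \<Theta>\<close> \<open>c \<in> \<Theta>\<close>] f \<open>W \<in> \<Theta>\<close> \<open>c \<in> \<Theta>\<close> L(1)
      by (intro expect_mono integ_abs integ_diff integ_cmult) (auto simp: mult.commute)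
    also have "\<dots> = dist W c * l" using L(1) by (simp add: expect_cmult l_def)
    also have "\<dots> \<le> d * l" using c(2) \<open>l \<ge> 0\<close> by (intro mult_right_mono) (auto simp: dist_commute)
    finally have 2: "\<bar>expect (f W) - expect (f c)\<bar> \<le> d * l" .
    have "d * (2 * l + 1) = e / 2" using \<open>l \<ge> 0\<close> by (simp add: d_def field_simps)
    then have 3: "d * (l + 1) + d * l = e / 2" by (simp add: algebra_simps)
    have "\<bar>emp n (f c) \<omega> - expect (f c)\<bar> \<le> e / 2" using * c(1) by blast
    then show "\<bar>emp n (f W) \<omega> - expect (f W)\<bar> \<le> e" using 1 2 3 by linarith
  qed
qed

text \<open>The form of the central limit theorem needed for the cosine criterion. The variance
  stays in the exponent instead of being normalised to 1, so the degenerate case is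
  included.\<close>

theorem central_limit_cos:
  fixes f :: "'b \<Rightarrow> real"
  assumes f: "f \<in> borel_measurable borel" and sq: "integ (\<lambda>z. (f z)\<^sup>2)" and mean: "expect f = 0"
  shows "(\<lambda>n. LINT \<omega>|M. cos (sqrt (real n) * emp n f \<omega> + b)) \<longlonglongrightarrow> cos b * exp (- expect (\<lambda>z. (f z)\<^sup>2) / 2)"
proof -
  note [measurable] = f
  define v where "v = expect (\<lambda>z. (f z)\<^sup>2)"
  have "v \<ge> 0" by (simp add: v_def expect_def)
  \<comment> \<open>The empirical mean runs over 1..n, the sum in the central limit theorem over i <
    n.\<close>
  define X where "X t \<omega> = f (x (Suc t) \<omega>)" for t \<omega>
  have sqt: "integrable M (\<lambda>\<omega>. (f (x t \<omega>))\<^sup>2)" for t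
    using sq transfer_integrable[of "\<lambda>z. (f z)\<^sup>2" t] by (simp add: integ_def)
  have mt: "(LINT \<omega>|M. f (x t \<omega>)) = 0" for t
    using mean transfer_integral[OF f, of t] by (simp add: expect_def)
  have vt: "(LINT \<omega>|M. (f (x t \<omega>))\<^sup>2) = v" for t
    using transfer_integral[of "\<lambda>z. (f z)\<^sup>2" t] by (simp add: expect_def v_def)
  have empX: "sqrt (real n) * emp n f \<omega> = (\<Sum>i<n. X i \<omega>) / sqrt (real n)" if "n > 0" for n \<omega>
  proof -
    have "(\<Sum>t=1..n. f (x t \<omega>)) = (\<Sum>i<n. X i \<omega>)"
      unfolding X_def by (rule sum.reindex_bij_witness[of _ Suc "\<lambda>t. t - 1"]) auto
    then show ?thesis using that by (simp add: emp_def real_div_sqrt field_simps real_sqrt_mult_self flip: power2_eq_square)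
  qed
  show ?thesis
  proof (cases "v = 0")
    \<comment> \<open>With variance 0 no normalisation is possible, but \<open>f\<close> then
      vanishes almost surely along the whole sequence.\<close>
    case True
    have "AE \<omega> in M. f (x t \<omega>) = 0" for t
      using integral_nonneg_eq_0_iff_AE[OF sqt[of t]] vt[of t] True by simp
    then have "AE \<omega> in M. \<forall>t. f (x t \<omega>) = 0" by (simp add: AE_all_countable)
    then have "(LINT \<omega>|M. cos (sqrt (real n) * emp n f \<omega> + b)) = (LINT \<omega>|M. cos b)" for n
      by (intro integral_cong_AE) (auto simp: emp_def elim!: eventually_mono)
    then show ?thesis using True by (simp add: v_def prob_space)
  next
    case False
    define s where "s = sqrt v"
    have s: "s > 0" "s\<^sup>2 = v" using False \<open>v \<ge> 0\<close> by (auto simp: s_def)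
    have "indep_vars (\<lambda>_. borel) X UNIV"
    proof -
      have "indep_vars (\<lambda>_. borel) (\<lambda>t \<omega>. f (x t \<omega>)) (range Suc)"
        by (rule indep_vars_subset[OF indep_image[OF f]]) auto
      then show ?thesis unfolding X_def
        by (rule indep_vars_reindex[rotated]) simp
    qed
    then have "weak_conv_m (\<lambda>n. distr M borel (\<lambda>\<omega>. (\<Sum>i<n. X i \<omega>) / sqrt (real n * s\<^sup>2))) std_normal_distribution"
    proof (rule central_limit_theorem_zero_mean[where \<mu> = "distr M borel (X 0)"])
      show "distr M borel (X n) = distr M borel (X 0)" for n
      proof -
        have "distr M borel (X n) = distr (distr M borel (x (Suc n))) borel f" for n
          unfolding X_def by (subst distr_distr) (auto simp: comp_def)
        then show ?thesis by (simp only: identical[of "Suc n" for n])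
      qed
      show "expectation (X n) = 0" for n unfolding X_def by (rule mt)
      show "variance (X n) = s\<^sup>2" for n
      proof -
        have m: "expectation (X n) = 0" unfolding X_def by (rule mt)
        show ?thesis unfolding m by (simp add: X_def vt s)
      qed
    qed (use sqt s in \<open>auto simp: X_def\<close>)
    then have lim: "(\<lambda>n. LINT y|distr M borel (\<lambda>\<omega>. (\<Sum>i<n. X i \<omega>) / sqrt (real n * s\<^sup>2)). cos (s * y + b)) \<longlonglongrightarrow>
       (LINT y|std_normal_distribution. cos (s * y + b))"
    proof (rule weak_conv_imp_integral_bdd_continuous_conv[where B = 1, rotated 2])
      have [measurable]: "X n \<in> borel_measurable M" for n unfolding X_def by measurable
      show "real_distribution (distr M borel (\<lambda>\<omega>. (\<Sum>i<n. X i \<omega>) / sqrt (real n * s\<^sup>2)))" for n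
        by (intro real_distribution_distr) measurable
      show "real_distribution std_normal_distribution" by (rule real_dist_normal_dist)
    qed (auto intro!: continuous_intros)
    have val: "(LINT y|std_normal_distribution. cos (s * y + b)) = cos b * exp (- v / 2)"
    proof -
      have "(\<lambda>y::real. ennreal (std_gaussian_density y)) = (\<lambda>y. ennreal (std_normal_density y))"
        by (simp add: std_gaussian_density_def)
      then show ?thesis using std_gaussian_cos[of s b] s by (simp add: power2_eq_square)
    qed
    have ev: "\<forall>\<^sub>F n in sequentially. (LINT y|distr M borel (\<lambda>\<omega>. (\<Sum>i<n. X i \<omega>) / sqrt (real n * s\<^sup>2)). cos (s * y + b)) =
      (LINT \<omega>|M. cos (sqrt (real n) * emp n f \<omega> + b))"
      using eventually_gt_at_top[of 0]
    proof eventually_elim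
      case (elim n)
      have "s * ((\<Sum>i<n. X i \<omega>) / sqrt (real n * s\<^sup>2)) = sqrt (real n) * emp n f \<omega>" for \<omega>
        using s elim by (simp add: empX real_sqrt_mult s_def[symmetric])
      then show ?case by (subst integral_distr) (auto simp: X_def)
    qed
    show ?thesis
      unfolding v_def[symmetric] by (rule Lim_transform_eventually[OF lim[unfolded val] ev])
  qed
qed

end

lemma measurable_fst_borel [measurable]: "fst \<in> borel_measurable (borel :: ('a::topological_space \<times> 'b::topological_space) measure)"
  by (intro borel_measurable_continuous_onI continuous_on_fst continuous_on_id)

lemma measurable_snd_borel [measurable]: "snd \<in> borel_measurable (borel :: ('a::topological_space \<times> 'b::topological_space) measure)"
  by (intro borel_measurable_continuous_onI continuous_on_snd continuous_on_id)

lemma measurable_vec_nth [measurable]: "(\<lambda>v :: real ^ 'n. v $ i) \<in> borel_measurable borel"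
  by (intro borel_measurable_continuous_onI linear_continuous_on bounded_linear_vec_nth)

lemma norm_matrix_le_sum_entries:
  fixes A :: "real ^ 'n ^ 'm"
  shows "norm A \<le> (\<Sum>i\<in>UNIV. \<Sum>j\<in>UNIV. \<bar>A $ i $ j\<bar>)"
proof -
  have "norm A \<le> (\<Sum>i\<in>UNIV. norm (A $ i))" 
    unfolding norm_vec_def[of A] by (rule L2_set_le_sum) simp
  also have "\<dots> \<le> (\<Sum>i\<in>UNIV. \<Sum>j\<in>UNIV. \<bar>A $ i $ j\<bar>)" by (intro sum_mono norm_le_l1_cart)
  finally show ?thesis .
qed

section \<open>Consistency of log-determinant regression\<close>

text \<open>Observations are recorded as pairs of noise and regressor, so independence concerns the
  two coordinates. The weight \<open>w\<close> stands for 1 plus a multiple of the size of the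
  regressor: being at least 1, its lower powers are dominated by the integrable cube.\<close>

locale regression = iid_sequence M x for M :: "'w measure"
    and x :: "nat \<Rightarrow> 'w \<Rightarrow> (real ^ 'd) \<times> ('z::topological_space)" +
  fixes \<Gamma> :: "real ^ 'd ^ 'd" and w :: "'z \<Rightarrow> real"
  assumes w_measurable [measurable]: "w \<in> borel_measurable borel"
    and w_ge_1: "1 \<le> w z"
    and w_cube: "integ (\<lambda>x. w (snd x) ^ 3)"
    and noise_square: "integ (\<lambda>x. (norm (fst x))\<^sup>2)"
    and noise_mean: "expect (\<lambda>x. fst x $ i) = 0"
    and noise_cov: "expect (\<lambda>x. fst x $ i * fst x $ j) = \<Gamma> $ i $ j"
    and cov_pd: "positive_definite \<Gamma>"
    and noise_design_indep: "\<And>(a :: real ^ 'd \<Rightarrow> real) (b :: 'z \<Rightarrow> real). a \<in> borel_measurable borel \<Longrightarrow> b \<in> borel_measurable borel \<Longrightarrow>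
      integ (\<lambda>x. a (fst x)) \<Longrightarrow> integ (\<lambda>x. b (snd x)) \<Longrightarrow>
      integ (\<lambda>x. a (fst x) * b (snd x)) \<and>
      expect (\<lambda>x. a (fst x) * b (snd x)) = expect (\<lambda>x. a (fst x)) * expect (\<lambda>x. b (snd x))"
begin

lemma w_power_le: "w z \<le> w z ^ 3" "(w z)\<^sup>2 \<le> w z ^ 3" "1 \<le> w z ^ 3"
  using w_ge_1[of z] power_increasing[of 1 3 "w z"] power_increasing[of 2 3 "w z"] by auto

lemma w_nonneg: "0 \<le> w z"
  using w_ge_1[of z] by simp

lemma integ_design:
  assumes "b \<in> borel_measurable borel" "\<And>z. \<bar>b z\<bar> \<le> c * w z ^ 3"
  shows "integ (\<lambda>x. b (snd x))"
proof -
  note [measurable] = assms(1)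
  show ?thesis
    by (rule integ_bound[OF _ integ_cmult[OF w_cube, of c]]) (use assms(2) in auto)
qed

lemma integ_noise:
  assumes "a \<in> borel_measurable borel" "\<And>e. \<bar>a e\<bar> \<le> c * (1 + (norm e)\<^sup>2)"
  shows "integ (\<lambda>x. a (fst x))"
proof -
  note [measurable] = assms(1)
  show ?thesis
    by (rule integ_bound[OF _ integ_cmult[OF integ_add[OF integ_const[of 1] noise_square], of c]]) (use assms(2) in auto)
qed

lemma norm_le_1_plus_square: "norm e \<le> 1 + (norm e)\<^sup>2" for e :: "'v::real_normed_vector"
proof -
  have "0 \<le> (norm e - 1)\<^sup>2 + (norm e)\<^sup>2 + 1" by simp
  then show ?thesis by (simp add: power2_diff)
qed

lemma integ_noise_entry: "integ (\<lambda>x. fst x $ i)" "integ (\<lambda>x. fst x $ i * fst x $ j)" "integ (\<lambda>x. norm (fst x))"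
proof -
  show "integ (\<lambda>x. fst x $ i)"
    by (rule integ_noise[of "\<lambda>e. e $ i" 1]) (auto intro: order_trans[OF component_le_norm_cart norm_le_1_plus_square])
  have le: "\<bar>e $ i * e $ j\<bar> \<le> (norm e)\<^sup>2" for e :: "real ^ 'd"
    unfolding abs_mult power2_eq_square by (intro mult_mono component_le_norm_cart) auto
  have "\<bar>e $ i * e $ j\<bar> \<le> 1 * (1 + (norm e)\<^sup>2)" for e :: "real ^ 'd"
    using le[of e] by simp
  then show "integ (\<lambda>x. fst x $ i * fst x $ j)"
    by (rule integ_noise[of "\<lambda>e. e $ i * e $ j" 1, rotated]) measurable
  show "integ (\<lambda>x. norm (fst x))"
    by (rule integ_noise[of norm 1]) (use norm_le_1_plus_square in auto)
qed

text \<open>By independence, a noise factor with two moments and a design factor dominated by the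
  cube of the weight need only be integrable separately. Centering kills the products with a single
  noise coordinate.\<close>

lemma noise_design_product:
  assumes "b \<in> borel_measurable borel" "\<And>z. \<bar>b z\<bar> \<le> c * w z ^ 3"
  shows "integ (\<lambda>x. fst x $ i * b (snd x))" "expect (\<lambda>x. fst x $ i * b (snd x)) = 0"
    "integ (\<lambda>x. norm (fst x) * b (snd x))"
    "integ (\<lambda>x. (fst x $ i * fst x $ j) * b (snd x))"
    "expect (\<lambda>x. (fst x $ i * fst x $ j) * b (snd x)) = \<Gamma> $ i $ j * expect (\<lambda>x. b (snd x))"
proof -
  note b = integ_design[OF assms]
  show "integ (\<lambda>x. fst x $ i * b (snd x))" "expect (\<lambda>x. fst x $ i * b (snd x)) = 0"
    using noise_design_indep[of "\<lambda>e. e $ i" b] assms(1) b integ_noise_entry(1) noise_mean by auto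
  show "integ (\<lambda>x. norm (fst x) * b (snd x))"
    using noise_design_indep[of norm b] assms(1) b integ_noise_entry(3) by auto
  have "(\<lambda>e :: real ^ 'd. e $ i * e $ j) \<in> borel_measurable borel" by measurable
  then show "integ (\<lambda>x. (fst x $ i * fst x $ j) * b (snd x))"
    "expect (\<lambda>x. (fst x $ i * fst x $ j) * b (snd x)) = \<Gamma> $ i $ j * expect (\<lambda>x. b (snd x))"
    using noise_design_indep[of "\<lambda>e. e $ i * e $ j" b] assms(1) b integ_noise_entry(2) noise_cov by auto
qed

text \<open>\<open>h\<close> is the difference between a candidate and the true regression function.
  The truth is thus \<open>h = 0\<close>, whose residual is the noise.\<close>

definition residual :: "('z \<Rightarrow> real ^ 'd) \<Rightarrow> (real ^ 'd) \<times> 'z \<Rightarrow> real ^ 'd" where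
  "residual h p = fst p - h (snd p)"

definition emp_cov :: "nat \<Rightarrow> ('z \<Rightarrow> real ^ 'd) \<Rightarrow> 'w \<Rightarrow> real ^ 'd ^ 'd" where
  "emp_cov n h \<omega> = emp n (\<lambda>x. outer (residual h x) (residual h x)) \<omega>"

definition lim_cov :: "('z \<Rightarrow> real ^ 'd) \<Rightarrow> real ^ 'd ^ 'd" where
  "lim_cov h = (\<chi> i j. expect (\<lambda>x. residual h x $ i * residual h x $ j))"

lemma emp_nth: "emp n f \<omega> $ i = emp n (\<lambda>x. f x $ i) \<omega>"
  by (simp add: emp_def)

lemma emp_cov_nth: "emp_cov n h \<omega> $ i $ j = emp n (\<lambda>x. residual h x $ i * residual h x $ j) \<omega>"
  by (simp add: emp_cov_def emp_nth outer_def)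

lemma lim_cov_eq:
  assumes h: "h \<in> borel_measurable borel" and bound: "\<And>z. norm (h z) \<le> c * w z" and "c \<ge> 0"
  shows "lim_cov h = \<Gamma> + (\<chi> i j. expect (\<lambda>x. h (snd x) $ i * h (snd x) $ j))"
    and "integ (\<lambda>x. h (snd x) $ i * h (snd x) $ j)"
proof -
  note [measurable] = h
  have b1: "\<bar>h z $ i\<bar> \<le> c * w z ^ 3" for z i
    using component_le_norm_cart[of "h z" i] bound[of z] mult_left_mono[OF w_power_le(1)[of z] \<open>c \<ge> 0\<close>] by linarith
  have b2: "\<bar>h z $ i * h z $ j\<bar> \<le> c\<^sup>2 * w z ^ 3" for z i j
  proof -
    have "\<bar>h z $ i * h z $ j\<bar> \<le> (c * w z) * (c * w z)"
      unfolding abs_mult using bound[of z] w_nonneg[of z] \<open>c \<ge> 0\<close>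
      by (intro mult_mono order_trans[OF component_le_norm_cart]) auto
    also have "\<dots> = c\<^sup>2 * (w z)\<^sup>2" by (simp add: power2_eq_square)
    also have "\<dots> \<le> c\<^sup>2 * w z ^ 3" by (intro mult_left_mono w_power_le) auto
    finally show ?thesis .
  qed
  show i2: "integ (\<lambda>x. h (snd x) $ i * h (snd x) $ j)" for i j
    by (rule integ_design[of "\<lambda>z. h z $ i * h z $ j", OF _ b2]) measurable
  have hm: "(\<lambda>z. h z $ j) \<in> borel_measurable borel" for j by measurable
  have i1: "integ (\<lambda>x. fst x $ i * h (snd x) $ j)" "expect (\<lambda>x. fst x $ i * h (snd x) $ j) = 0" for i j
    using noise_design_product(1,2)[of "\<lambda>z. h z $ j", OF hm b1] by auto
  have "expect (\<lambda>x. residual h x $ i * residual h x $ j) = \<Gamma> $ i $ j + expect (\<lambda>x. h (snd x) $ i * h (snd x) $ j)" for i j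
  proof -
    have "(\<lambda>x. residual h x $ i * residual h x $ j) =
      (\<lambda>x. (fst x $ i * fst x $ j + h (snd x) $ i * h (snd x) $ j) - (fst x $ i * h (snd x) $ j + fst x $ j * h (snd x) $ i))"
      by (simp add: residual_def fun_eq_iff algebra_simps)
    then have "expect (\<lambda>x. residual h x $ i * residual h x $ j) =
      (expect (\<lambda>x. fst x $ i * fst x $ j) + expect (\<lambda>x. h (snd x) $ i * h (snd x) $ j)) -
      (expect (\<lambda>x. fst x $ i * h (snd x) $ j) + expect (\<lambda>x. fst x $ j * h (snd x) $ i))"
      by (simp only: expect_diff[OF integ_add[OF integ_noise_entry(2) i2] integ_add[OF i1(1) i1(1)]]
          expect_add[OF integ_noise_entry(2) i2] expect_add[OF i1(1) i1(1)])
    then show ?thesis by (simp add: i1(2) noise_cov)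
  qed
  then show "lim_cov h = \<Gamma> + (\<chi> i j. expect (\<lambda>x. h (snd x) $ i * h (snd x) $ j))"
    by (simp add: lim_cov_def vec_eq_iff)
qed

lemma uniform_weak_law_cov:
  fixes D :: "'p::metric_space \<Rightarrow> 'z \<Rightarrow> real ^ 'd"
  assumes \<Theta>: "compact \<Theta>" and D: "\<And>W. W \<in> \<Theta> \<Longrightarrow> D W \<in> borel_measurable borel"
    and bound: "\<And>W z. W \<in> \<Theta> \<Longrightarrow> norm (D W z) \<le> c * w z" and "c \<ge> 0"
    and lip: "\<And>W V z. W \<in> \<Theta> \<Longrightarrow> V \<in> \<Theta> \<Longrightarrow> norm (D W z - D V z) \<le> c * w z * dist W V" and "e > 0"
  shows "asymptotically_certain (\<lambda>n \<omega>. \<forall>W\<in>\<Theta>. norm (emp_cov n (D W) \<omega> - lim_cov (D W)) \<le> e)"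
    and "\<exists>l. \<forall>W\<in>\<Theta>. \<forall>V\<in>\<Theta>. norm (lim_cov (D W) - lim_cov (D V)) \<le> l * dist W V"
proof -
  \<comment> \<open>From r r' - s s' = r (r' - s') + (r - s) s', with residual entries at most
    |\<epsilon>| + c w and their differences at most c w times the distance: \<open>L\<close> is 2
    (|\<epsilon>| + c w) c w.\<close>
  define L where "L x = 2 * c * (norm (fst x) * w (snd x)) + 2 * c\<^sup>2 * (w (snd x))\<^sup>2" for x :: "(real ^ 'd) \<times> 'z"
  define f where "f i j W x = residual (D W) x $ i * residual (D W) x $ j" for i j :: 'd and W and x :: "(real ^ 'd) \<times> 'z"
  have Lint: "integ L"
    unfolding L_def
  proof (intro integ_add integ_cmult)
    show "integ (\<lambda>x. norm (fst x) * w (snd x))"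
      by (rule noise_design_product(3)[of w 1]) (use w_power_le w_nonneg in auto)
    show "integ (\<lambda>x. (w (snd x))\<^sup>2)"
      by (rule integ_design[of "\<lambda>z. (w z)\<^sup>2" 1]) (use w_power_le w_nonneg in auto)
  qed
  have L0: "0 \<le> L x" for x using w_nonneg \<open>c \<ge> 0\<close> by (simp add: L_def)
  have res: "\<bar>residual (D W) x $ i\<bar> \<le> norm (fst x) + c * w (snd x)" if "W \<in> \<Theta>" for W x i
  proof -
    have "\<bar>residual (D W) x $ i\<bar> \<le> norm (fst x - D W (snd x))"
      unfolding residual_def by (rule component_le_norm_cart)
    also have "\<dots> \<le> norm (fst x) + norm (D W (snd x))" by (rule norm_triangle_ineq4)
    finally show ?thesis using bound[OF that, of "snd x"] by linarith
  qed
  have flip: "\<bar>f i j W x - f i j V x\<bar> \<le> L x * dist W V" if W: "W \<in> \<Theta>" and V: "V \<in> \<Theta>" for i j W V x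
  proof -
    let ?r = "residual (D W) x" and ?s = "residual (D V) x"
    let ?b = "norm (fst x) + c * w (snd x)" and ?d = "c * w (snd x) * dist W V"
    have d: "\<bar>?r $ k - ?s $ k\<bar> \<le> ?d" for k
    proof -
      have "\<bar>?r $ k - ?s $ k\<bar> = \<bar>(D V (snd x) - D W (snd x)) $ k\<bar>" by (simp add: residual_def)
      also have "\<dots> \<le> norm (D V (snd x) - D W (snd x))" by (rule component_le_norm_cart)
      also have "\<dots> \<le> ?d" using lip[OF V W, of "snd x"] by (simp add: dist_commute)
      finally show ?thesis .
    qed
    have "f i j W x - f i j V x = ?r $ i * (?r $ j - ?s $ j) + (?r $ i - ?s $ i) * ?s $ j"
      by (simp add: f_def algebra_simps)
    also have "\<bar>\<dots>\<bar> \<le> \<bar>?r $ i\<bar> * \<bar>?r $ j - ?s $ j\<bar> + \<bar>?r $ i - ?s $ i\<bar> * \<bar>?s $ j\<bar>"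
      by (metis abs_mult abs_triangle_ineq)
    also have "\<dots> \<le> ?b * ?d + ?d * ?b"
      using w_nonneg \<open>c \<ge> 0\<close> by (intro add_mono mult_mono d res W V) auto
    also have "\<dots> = L x * dist W V" by (simp add: L_def power2_eq_square algebra_simps)
    finally show ?thesis .
  qed
  have fint: "integ (f i j W)" if W: "W \<in> \<Theta>" for i j W
  proof (rule integ_bound)
    note [measurable] = D[OF W]
    show "f i j W \<in> borel_measurable borel" unfolding f_def residual_def by measurable
    show "integ (\<lambda>x. (norm (fst x))\<^sup>2 + (2 * c * (norm (fst x) * w (snd x)) + c\<^sup>2 * (w (snd x))\<^sup>2))"
    proof (intro integ_add integ_cmult noise_square)
      show "integ (\<lambda>x. norm (fst x) * w (snd x))"
        by (rule noise_design_product(3)[of w 1]) (use w_power_le w_nonneg in auto)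
      show "integ (\<lambda>x. (w (snd x))\<^sup>2)"
        by (rule integ_design[of "\<lambda>z. (w z)\<^sup>2" 1]) (use w_power_le w_nonneg in auto)
    qed
    fix x :: "(real ^ 'd) \<times> 'z"
    have "\<bar>f i j W x\<bar> \<le> (norm (fst x) + c * w (snd x)) * (norm (fst x) + c * w (snd x))"
      unfolding f_def abs_mult using w_nonneg \<open>c \<ge> 0\<close> by (intro mult_mono res W) auto
    also have "\<dots> = (norm (fst x))\<^sup>2 + (2 * c * (norm (fst x) * w (snd x)) + c\<^sup>2 * (w (snd x))\<^sup>2)"
      by (simp add: power2_eq_square algebra_simps)
    finally show "norm (f i j W x) \<le> (norm (fst x))\<^sup>2 + (2 * c * (norm (fst x) * w (snd x)) + c\<^sup>2 * (w (snd x))\<^sup>2)"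
      by simp
  qed
  define r where "r = e / real (CARD('d) * CARD('d))"
  have "r > 0" using \<open>e > 0\<close> by (simp add: r_def)
  have "asymptotically_certain (\<lambda>n \<omega>. \<forall>p\<in>UNIV. \<forall>W\<in>\<Theta>. \<bar>emp n (f (fst p) (snd p) W) \<omega> - expect (f (fst p) (snd p) W)\<bar> \<le> r)"
    by (intro asymptotically_certain_ball uniform_weak_law[OF \<Theta> fint Lint L0 flip \<open>r > 0\<close>]) auto
  then show "asymptotically_certain (\<lambda>n \<omega>. \<forall>W\<in>\<Theta>. norm (emp_cov n (D W) \<omega> - lim_cov (D W)) \<le> e)"
  proof (rule asymptotically_certain_mono', intro ballI)
    fix n \<omega> W
    assume *: "\<forall>p\<in>UNIV. \<forall>W\<in>\<Theta>. \<bar>emp n (f (fst p) (snd p) W) \<omega> - expect (f (fst p) (snd p) W)\<bar> \<le> r" and W: "W \<in> \<Theta>"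
    have "norm (emp_cov n (D W) \<omega> - lim_cov (D W)) \<le> (\<Sum>i\<in>UNIV. \<Sum>j\<in>UNIV. \<bar>(emp_cov n (D W) \<omega> - lim_cov (D W)) $ i $ j\<bar>)"
      by (rule norm_matrix_le_sum_entries)
    also have "\<dots> \<le> (\<Sum>i\<in>(UNIV::'d set). \<Sum>j\<in>(UNIV::'d set). r)"
    proof (intro sum_mono)
      fix i j
      show "\<bar>(emp_cov n (D W) \<omega> - lim_cov (D W)) $ i $ j\<bar> \<le> r"
        using *[rule_format, of "(i, j)" W] W by (simp add: emp_cov_nth lim_cov_def f_def[abs_def])
    qed
    also have "\<dots> = e" by (simp add: r_def)
    finally show "norm (emp_cov n (D W) \<omega> - lim_cov (D W)) \<le> e" .
  qed
  have "norm (lim_cov (D W) - lim_cov (D V)) \<le> (real (CARD('d) * CARD('d)) * expect L) * dist W V" if W: "W \<in> \<Theta>" and V: "V \<in> \<Theta>" for W V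
  proof -
    have "norm (lim_cov (D W) - lim_cov (D V)) \<le> (\<Sum>i\<in>UNIV. \<Sum>j\<in>UNIV. \<bar>(lim_cov (D W) - lim_cov (D V)) $ i $ j\<bar>)"
      by (rule norm_matrix_le_sum_entries)
    also have "\<dots> \<le> (\<Sum>i\<in>(UNIV::'d set). \<Sum>j\<in>(UNIV::'d set). dist W V * expect L)"
    proof (intro sum_mono)
      fix i j
      have "\<bar>(lim_cov (D W) - lim_cov (D V)) $ i $ j\<bar> = \<bar>expect (\<lambda>x. f i j W x - f i j V x)\<bar>"
        by (simp add: lim_cov_def expect_diff[OF fint[OF W] fint[OF V]] flip: f_def)
      also have "\<dots> \<le> expect (\<lambda>x. \<bar>f i j W x - f i j V x\<bar>)" by (rule expect_abs)
      also have "\<dots> \<le> expect (\<lambda>x. dist W V * L x)"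
        by (intro expect_mono integ_abs integ_diff fint W V integ_cmult Lint) (use flip[OF W V] in \<open>simp add: mult.commute\<close>)
      also have "\<dots> = dist W V * expect L" by (rule expect_cmult[OF Lint])
      finally show "\<bar>(lim_cov (D W) - lim_cov (D V)) $ i $ j\<bar> \<le> dist W V * expect L" .
    qed
    also have "\<dots> = (real (CARD('d) * CARD('d)) * expect L) * dist W V" by simp
    finally show ?thesis .
  qed
  then show "\<exists>l. \<forall>W\<in>\<Theta>. \<forall>V\<in>\<Theta>. norm (lim_cov (D W) - lim_cov (D V)) \<le> l * dist W V" by blast
qed

text \<open>The limit exceeds \<Gamma> by the second moment matrix of h(Z), whose form at v is the
  expectation of (v \<bullet> h(Z))^2. If this matrix were zero, its diagonal would force h(Z) = 0
  almost surely.\<close>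

lemma det_lim_cov_greater:
  assumes h: "h \<in> borel_measurable borel" and bound: "\<And>z. norm (h z) \<le> c * w z" and "c \<ge> 0"
    and nz: "\<not> (AE \<omega> in M. h (snd (x 0 \<omega>)) = 0)"
  shows "det \<Gamma> < det (lim_cov h)"
proof -
  note [measurable] = h
  define P where "P = (\<chi> i j. expect (\<lambda>x. h (snd x) $ i * h (snd x) $ j))"
  note eq = lim_cov_eq[OF h bound \<open>c \<ge> 0\<close>]
  have quad: "v \<bullet> (P *v v) = expect (\<lambda>x. (v \<bullet> h (snd x))\<^sup>2)" for v
  proof -
    have "v \<bullet> (P *v v) = (\<Sum>i\<in>UNIV. \<Sum>j\<in>UNIV. (v $ i * v $ j) * expect (\<lambda>x. h (snd x) $ i * h (snd x) $ j))"
      by (simp add: P_def inner_vec_def matrix_vector_mult_def sum_distrib_left mult_ac)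
    also have "\<dots> = expect (\<lambda>x. \<Sum>i\<in>UNIV. \<Sum>j\<in>UNIV. (v $ i * v $ j) * (h (snd x) $ i * h (snd x) $ j))"
      by (subst expect_sum, intro integ_sum integ_cmult eq(2))
         (subst expect_sum, intro integ_cmult eq(2), simp only: expect_cmult[OF eq(2)])
    also have "(\<lambda>x. \<Sum>i\<in>UNIV. \<Sum>j\<in>UNIV. (v $ i * v $ j) * (h (snd x) $ i * h (snd x) $ j)) = (\<lambda>x. (v \<bullet> h (snd x))\<^sup>2)"
      by (simp add: fun_eq_iff inner_vec_def power2_eq_square sum_product mult_ac)
    finally show ?thesis .
  qed
  have "P \<noteq> 0"
  proof
    assume "P = 0"
    have "AE \<omega> in M. h (snd (x 0 \<omega>)) $ i = 0" for i
    proof -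
      have "P $ i $ i = 0" using \<open>P = 0\<close> by simp
      then have "(LINT \<omega>|M. (h (snd (x 0 \<omega>)) $ i)\<^sup>2) = 0"
        by (simp add: P_def expect_def power2_eq_square)
      moreover have "integrable M (\<lambda>\<omega>. (h (snd (x 0 \<omega>)) $ i)\<^sup>2)"
        using eq(2)[of i i] by (simp add: integ_def power2_eq_square)
      ultimately have "AE \<omega> in M. (h (snd (x 0 \<omega>)) $ i)\<^sup>2 = 0"
        by (subst (asm) integral_nonneg_eq_0_iff_AE) auto
      then show ?thesis by simp
    qed
    then have "AE \<omega> in M. \<forall>i. h (snd (x 0 \<omega>)) $ i = 0" by (simp add: AE_all_countable)
    then have "AE \<omega> in M. h (snd (x 0 \<omega>)) = 0" by (simp add: vec_eq_iff)
    with nz show False by blast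
  qed
  have "det \<Gamma> < det (\<Gamma> + P)"
  proof (rule det_less_det_add_psd[OF cov_pd _ _ \<open>P \<noteq> 0\<close>])
    show "transpose P = P" by (simp add: P_def transpose_def vec_eq_iff mult.commute)
    show "0 \<le> v \<bullet> (P *v v)" for v by (simp add: quad expect_def)
  qed
  then show ?thesis by (simp add: eq(1) P_def)
qed

text \<open>Near-minimisers are located near the set of parameters that fit the true function almost
  surely, not near \<open>W0\<close> itself; identification up to symmetry is a separate property of
  the model. The comparison of determinants with \<open>W0\<close> is all that is used of a
  minimiser.\<close>

theorem consistency:
  fixes D :: "'p::metric_space \<Rightarrow> 'z \<Rightarrow> real ^ 'd"
  assumes \<Theta>: "compact \<Theta>" and D: "\<And>W. W \<in> \<Theta> \<Longrightarrow> D W \<in> borel_measurable borel"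
    and bound: "\<And>W z. W \<in> \<Theta> \<Longrightarrow> norm (D W z) \<le> c * w z" and "c \<ge> 0"
    and lip: "\<And>W V z. W \<in> \<Theta> \<Longrightarrow> V \<in> \<Theta> \<Longrightarrow> norm (D W z - D V z) \<le> c * w z * dist W V"
    and W0: "W0 \<in> \<Theta>" "\<And>z. D W0 z = 0" and "\<eta> > 0"
  shows "asymptotically_certain (\<lambda>n \<omega>. \<forall>V\<in>\<Theta>. det (emp_cov n (D V) \<omega>) \<le> det (emp_cov n (D W0) \<omega>) \<longrightarrow>
     (\<exists>V'\<in>\<Theta>. (AE \<omega> in M. D V' (snd (x 0 \<omega>)) = 0) \<and> dist V V' < \<eta>))"
proof -
  define T0 where "T0 = {V\<in>\<Theta>. AE \<omega> in M. D V (snd (x 0 \<omega>)) = 0}"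
  \<comment> \<open>At distance at least \<eta> from every perfect fit: a closed subset of a compact
    set, so the continuous limiting determinant attains a minimum there, strictly above det
    \<Gamma>.\<close>
  define Far where "Far = \<Theta> \<inter> (\<Inter>V'\<in>T0. {V. \<eta> \<le> dist V V'})"
  have "compact Far" unfolding Far_def
    by (intro compact_Int_closed \<Theta> closed_INT ballI closed_Collect_le continuous_intros)
  define S where "S V = lim_cov (D V)" for V
  obtain l where l: "\<forall>W\<in>\<Theta>. \<forall>V\<in>\<Theta>. norm (S W - S V) \<le> l * dist W V"
    using uniform_weak_law_cov(2)[OF \<Theta> D bound \<open>c \<ge> 0\<close> lip zero_less_one] unfolding S_def by blast
  have contS: "continuous_on \<Theta> S"
  proof (rule continuous_onI)
    fix W and e :: real assume W: "W \<in> \<Theta>" and "e > 0"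
    have "dist (S V) (S W) \<le> e" if "V \<in> \<Theta>" "dist V W < e / (\<bar>l\<bar> + 1)" for V
    proof -
      have "dist (S V) (S W) \<le> l * dist V W" using l that W by (simp add: dist_norm)
      also have "\<dots> \<le> (\<bar>l\<bar> + 1) * dist V W" by (intro mult_right_mono) auto
      also have "\<dots> \<le> (\<bar>l\<bar> + 1) * (e / (\<bar>l\<bar> + 1))" using that(2) by (intro mult_left_mono) auto
      finally show ?thesis by simp
    qed
    then show "\<exists>d>0. \<forall>V\<in>\<Theta>. dist V W < d \<longrightarrow> dist (S V) (S W) \<le> e"
      using \<open>e > 0\<close> by (intro exI[of _ "e / (\<bar>l\<bar> + 1)"]) auto
  qed
  have detcont: "continuous_on UNIV (det :: real ^ 'd ^ 'd \<Rightarrow> real)"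
    unfolding det_def by (intro continuous_intros)
  have "D W0 = (\<lambda>z. 0)" using W0(2) by auto
  then have S0: "S W0 = \<Gamma>"
    using lim_cov_eq(1)[OF D[OF W0(1)] bound[OF W0(1)] \<open>c \<ge> 0\<close>]
    by (simp add: S_def expect_const vec_eq_iff)
  \<comment> \<open>\<open>k\<close> is half of the gap: the empirical determinants at a far
    parameter and at \<open>W0\<close> each err by less than \<open>k\<close>, so the gap is not
    bridged.\<close>
  obtain k where k: "k > 0" "\<And>V. V \<in> Far \<Longrightarrow> det \<Gamma> + 2 * k \<le> det (S V)"
  proof (cases "Far = {}")
    case True
    then show ?thesis by (intro that[of 1]) auto
  next
    case False
    have "continuous_on Far (\<lambda>V. det (S V))"
      by (rule continuous_on_compose2[OF detcont continuous_on_subset[OF contS]]) (auto simp: Far_def)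
    then obtain V where V: "V \<in> Far" "\<forall>U\<in>Far. det (S V) \<le> det (S U)"
      using continuous_attains_inf[OF \<open>compact Far\<close> False] by blast
    have "V \<in> \<Theta>" using V by (simp add: Far_def)
    have "V \<notin> T0"
    proof
      assume "V \<in> T0"
      then have "\<eta> \<le> dist V V" using V(1) unfolding Far_def by blast
      with \<open>\<eta> > 0\<close> show False by simp
    qed
    then have "det \<Gamma> < det (S V)"
      unfolding S_def using \<open>V \<in> \<Theta>\<close>
      by (intro det_lim_cov_greater[OF D[OF \<open>V \<in> \<Theta>\<close>] bound[OF \<open>V \<in> \<Theta>\<close>] \<open>c \<ge> 0\<close>]) (simp add: T0_def)
    with V(2) show ?thesis by (intro that[of "(det (S V) - det \<Gamma>) / 2"]) (auto simp: field_simps)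
  qed
  \<comment> \<open>The closed 1-neighbourhood of the limiting matrices is compact, hence the
    determinant is uniformly continuous on it; since e \<le> 1 it contains the empirical matrices
    too.\<close>
  define K where "K = {a + b | a b. a \<in> S ` \<Theta> \<and> b \<in> cball 0 1}"
  have "compact K" unfolding K_def
    by (intro compact_sums compact_continuous_image contS \<Theta> compact_cball)
  then have "uniformly_continuous_on K (det :: real ^ 'd ^ 'd \<Rightarrow> real)"
    by (intro compact_uniformly_continuous continuous_on_subset[OF detcont]) auto
  then obtain d where d: "d > 0" "\<And>A B. A \<in> K \<Longrightarrow> B \<in> K \<Longrightarrow> dist B A < d \<Longrightarrow> dist (det B) (det A) < k"
    unfolding uniformly_continuous_on_def using k(1) by blast
  define e where "e = min 1 (d / 2)"
  have e: "e > 0" "e \<le> 1" "e < d" using d(1) by (auto simp: e_def)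
  have "asymptotically_certain (\<lambda>n \<omega>. \<forall>W\<in>\<Theta>. norm (emp_cov n (D W) \<omega> - S W) \<le> e)"
    unfolding S_def by (rule uniform_weak_law_cov(1)[OF \<Theta> D bound \<open>c \<ge> 0\<close> lip e(1)])
  then show ?thesis
  proof (rule asymptotically_certain_mono', intro ballI impI)
    fix n \<omega> V
    assume *: "\<forall>W\<in>\<Theta>. norm (emp_cov n (D W) \<omega> - S W) \<le> e" and V: "V \<in> \<Theta>"
      and le: "det (emp_cov n (D V) \<omega>) \<le> det (emp_cov n (D W0) \<omega>)"
    have close: "\<bar>det (emp_cov n (D W) \<omega>) - det (S W)\<bar> < k" if "W \<in> \<Theta>" for W
    proof -
      have n: "norm (emp_cov n (D W) \<omega> - S W) \<le> e" using * that by blast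
      have mem: "A \<in> K" if "norm (A - S W) \<le> 1" for A
        unfolding K_def using that \<open>W \<in> \<Theta>\<close> by (intro CollectI exI[of _ "S W"] exI[of _ "A - S W"]) auto
      have "S W \<in> K" "emp_cov n (D W) \<omega> \<in> K" using n e(2) by (auto intro!: mem)
      then have "dist (det (emp_cov n (D W) \<omega>)) (det (S W)) < k"
        using n e(3) by (intro d(2)) (auto simp: dist_norm)
      then show ?thesis by (simp add: dist_real_def)
    qed
    have "V \<notin> Far"
    proof
      assume "V \<in> Far"
      then have "det \<Gamma> + 2 * k \<le> det (S V)" by (rule k(2))
      then show False using close[OF V] close[OF W0(1), unfolded S0] le by linarith
    qed
    then obtain V' where "V' \<in> T0" "dist V V' < \<eta>" using V by (auto simp: Far_def not_le)
    then show "\<exists>V'\<in>\<Theta>. (AE \<omega> in M. D V' (snd (x 0 \<omega>)) = 0) \<and> dist V V' < \<eta>"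
      unfolding T0_def by blast
  qed
qed

end

section \<open>Expansion of the empirical determinant\<close>

lemma matrix_inv_symmetric:
  fixes A :: "real ^ 'n ^ 'n"
  assumes "invertible A" "transpose A = A"
  shows "transpose (matrix_inv A) = matrix_inv A"
proof -
  obtain B where B: "A ** B = mat 1" "B ** A = mat 1" using assms(1) by (auto simp: invertible_def)
  have inv: "matrix_inv A = B" by (rule matrix_inverse_unique[OF B(1)])
  have "A ** transpose B = mat 1"
    using arg_cong[OF B(2), of transpose] assms(2) by (simp add: matrix_transpose_mul)
  then have "matrix_inv A = transpose B" by (rule matrix_inverse_unique)
  then show ?thesis using inv by simp
qed

lemma inner_matrix_vector_sum:
  fixes A :: "real ^ 'n ^ 'm"
  shows "u \<bullet> (A *v v) = (\<Sum>i\<in>UNIV. \<Sum>j\<in>UNIV. A $ i $ j * (u $ i * v $ j))"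
  by (simp add: inner_vec_def matrix_vector_mult_def sum_distrib_left mult_ac)

lemma sum_weighted_bound:
  fixes P b :: "'i \<Rightarrow> real"
  assumes "\<And>i. i \<in> I \<Longrightarrow> \<bar>b i\<bar> \<le> B"
  shows "\<bar>\<Sum>i\<in>I. P i * b i\<bar> \<le> (\<Sum>i\<in>I. \<bar>P i\<bar>) * B"
proof -
  have "\<bar>\<Sum>i\<in>I. P i * b i\<bar> \<le> (\<Sum>i\<in>I. \<bar>P i\<bar> * \<bar>b i\<bar>)"
    using sum_abs[of "\<lambda>i. P i * b i" I] by (simp add: abs_mult)
  also have "\<dots> \<le> (\<Sum>i\<in>I. \<bar>P i\<bar> * B)" by (intro sum_mono mult_left_mono assms) auto
  finally show ?thesis by (simp add: sum_distrib_right)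
qed

text \<open>\<open>D \<delta>\<close> is the increment of the regression function at displacement
  \<delta>, \<open>g\<close> its first partial derivatives, \<open>Q\<close> its second-order Taylor
  term. Order m carries the weight w^m, because each differentiation of a unit can produce a factor
  of the input.\<close>

locale smooth_regression = regression M x \<Gamma> w for M :: "'w measure"
    and x :: "nat \<Rightarrow> 'w \<Rightarrow> (real ^ 'd) \<times> ('z::topological_space)" and \<Gamma> w +
  fixes D :: "real ^ 'k \<Rightarrow> 'z \<Rightarrow> real ^ 'd" and g :: "'k \<Rightarrow> 'z \<Rightarrow> real ^ 'd"
    and Q :: "real ^ 'k \<Rightarrow> 'z \<Rightarrow> real ^ 'd" and C :: real
  assumes C_nonneg: "0 \<le> C"
    and D_measurable [measurable]: "\<And>\<delta>. D \<delta> \<in> borel_measurable borel"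
    and g_measurable [measurable]: "\<And>k. g k \<in> borel_measurable borel"
    and Q_measurable [measurable]: "\<And>\<delta>. Q \<delta> \<in> borel_measurable borel"
    and g_bound: "\<And>k z. norm (g k z) \<le> C * w z"
    and D_order1: "\<And>\<delta> z. norm \<delta> \<le> 1 \<Longrightarrow> norm (D \<delta> z) \<le> C * w z * norm \<delta>"
    and D_order2: "\<And>\<delta> z. norm \<delta> \<le> 1 \<Longrightarrow>
      norm (D \<delta> z - (\<Sum>k\<in>UNIV. \<delta> $ k *\<^sub>R g k z)) \<le> C * (w z)\<^sup>2 * (norm \<delta>)\<^sup>2"
    and D_order3: "\<And>\<delta> z. norm \<delta> \<le> 1 \<Longrightarrow>
      norm (D \<delta> z - (\<Sum>k\<in>UNIV. \<delta> $ k *\<^sub>R g k z) - Q \<delta> z) \<le> C * w z ^ 3 * norm \<delta> ^ 3"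
    and Q_scale: "\<And>t \<delta> z. Q (t *\<^sub>R \<delta>) z = t\<^sup>2 *\<^sub>R Q \<delta> z"
    and Q_lipschitz: "\<And>\<delta> \<delta>' z. norm \<delta> \<le> 1 \<Longrightarrow> norm \<delta>' \<le> 1 \<Longrightarrow>
      norm (Q \<delta> z - Q \<delta>' z) \<le> C * (w z)\<^sup>2 * norm (\<delta> - \<delta>')"
begin

abbreviation P :: "real ^ 'd ^ 'd" where "P \<equiv> matrix_inv \<Gamma>"

lemma P_symmetric: "transpose P = P"
  using cov_pd by (intro matrix_inv_symmetric positive_definite_imp_invertible) (auto simp: positive_definite_def)

lemma P_nth_commute: "P $ i $ j = P $ j $ i"
  using arg_cong[OF P_symmetric, of "\<lambda>A. A $ j $ i"] by (simp add: transpose_def)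

definition G :: "real ^ 'k \<Rightarrow> 'z \<Rightarrow> real ^ 'd" where
  "G \<delta> z = (\<Sum>k\<in>UNIV. \<delta> $ k *\<^sub>R g k z)"

definition information :: "real ^ 'k ^ 'k" where
  "information = (\<chi> k l. expect (\<lambda>x. g k (snd x) \<bullet> (P *v g l (snd x))))"

definition score :: "nat \<Rightarrow> 'w \<Rightarrow> real ^ 'k" where
  "score n \<omega> = (\<chi> k. sqrt (real n) * emp n (\<lambda>x. fst x \<bullet> (P *v g k (snd x))) \<omega>)"

lemma G_measurable [measurable]: "G \<delta> \<in> borel_measurable borel"
  unfolding G_def by measurable

lemma weight_bounds_nonneg: "0 \<le> C * w z" "0 \<le> C * (w z)\<^sup>2" "0 \<le> C * w z ^ 3"
  using C_nonneg w_nonneg by simp_all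

lemma g_nth_bound: "\<bar>g k z $ i\<bar> \<le> C * w z"
  using component_le_norm_cart[of "g k z" i] g_bound[of k z] by linarith

lemma G_nth_bound: "\<bar>G \<delta> z $ i\<bar> \<le> real CARD('k) * C * w z * norm \<delta>"
proof -
  have "\<bar>G \<delta> z $ i\<bar> \<le> (\<Sum>k\<in>UNIV. \<bar>\<delta> $ k * g k z $ i\<bar>)"
    by (simp add: G_def sum_abs)
  also have "\<dots> \<le> (\<Sum>k\<in>(UNIV :: 'k set). norm \<delta> * (C * w z))"
    unfolding abs_mult by (intro sum_mono mult_mono component_le_norm_cart g_nth_bound) auto
  finally show ?thesis by (simp add: mult_ac)
qed

lemma g_product:
  "integ (\<lambda>x. g k (snd x) $ i * g l (snd x) $ j)"
proof (rule integ_design[of "\<lambda>z. g k z $ i * g l z $ j" "C\<^sup>2"])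
  fix z
  have "\<bar>g k z $ i * g l z $ j\<bar> \<le> (C * w z) * (C * w z)"
    unfolding abs_mult using weight_bounds_nonneg(1) by (intro mult_mono g_nth_bound) auto
  also have "\<dots> = C\<^sup>2 * (w z)\<^sup>2" by (simp add: power2_eq_square)
  also have "\<dots> \<le> C\<^sup>2 * w z ^ 3" by (intro mult_left_mono w_power_le) auto
  finally show "\<bar>g k z $ i * g l z $ j\<bar> \<le> C\<^sup>2 * w z ^ 3" .
qed measurable

lemma information_summand: "integ (\<lambda>x. g k (snd x) \<bullet> (P *v g l (snd x)))"
  unfolding inner_matrix_vector_sum by (intro integ_sum integ_cmult g_product)

lemma noise_g_square: "integ (\<lambda>x. (fst x $ i * g k (snd x) $ j)\<^sup>2)"
proof -
  have le: "\<bar>(g k z $ j)\<^sup>2\<bar> \<le> C\<^sup>2 * w z ^ 3" for z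
  proof -
    have "(g k z $ j)\<^sup>2 \<le> (C * w z)\<^sup>2"
      using power_mono[OF g_nth_bound[of k z j], of 2] by simp
    also have "\<dots> \<le> C\<^sup>2 * w z ^ 3"
      unfolding power_mult_distrib by (intro mult_left_mono w_power_le) auto
    finally show ?thesis by simp
  qed
  have "(\<lambda>z. (g k z $ j)\<^sup>2) \<in> borel_measurable borel" by measurable
  then have "integ (\<lambda>x. (fst x $ i * fst x $ i) * (g k (snd x) $ j)\<^sup>2)"
    using noise_design_product(4)[of "\<lambda>z. (g k z $ j)\<^sup>2", OF _ le] by simp
  then show ?thesis by (simp add: power2_eq_square mult_ac)
qed

lemma noise_g: "integ (\<lambda>x. fst x $ i * g k (snd x) $ j)" "expect (\<lambda>x. fst x $ i * g k (snd x) $ j) = 0"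
proof -
  have "\<bar>g k z $ j\<bar> \<le> C * w z ^ 3" for z
    using g_nth_bound[of k z j] mult_left_mono[OF w_power_le(1) C_nonneg, of z] by linarith
  moreover have "(\<lambda>z. g k z $ j) \<in> borel_measurable borel" by measurable
  ultimately show "integ (\<lambda>x. fst x $ i * g k (snd x) $ j)" "expect (\<lambda>x. fst x $ i * g k (snd x) $ j) = 0"
    using noise_design_product(1,2)[of "\<lambda>z. g k z $ j"] by blast+
qed

definition noise_moment_bound :: real where
  "noise_moment_bound = expect (\<lambda>x. norm (fst x) * w (snd x) ^ 3) + 1"

definition design_moment_bound :: real where
  "design_moment_bound = expect (\<lambda>x. w (snd x) ^ 3) + 1"

text \<open>The random input of the expansion; what follows from it is deterministic.
  \<open>e0\<close> and \<open>e1\<close> bound quantities that tend to zero, while \<open>K\<close>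
  is only a tightness bound for the products of noise and gradient, which are of order 1 / sqrt
  n.\<close>

definition regular :: "real \<Rightarrow> real \<Rightarrow> real \<Rightarrow> nat \<Rightarrow> 'w \<Rightarrow> bool" where
  "regular e0 e1 K n \<omega> \<longleftrightarrow>
     norm (emp_cov n (\<lambda>_. 0) \<omega> - \<Gamma>) \<le> e0 \<and>
     (\<forall>i j. \<forall>u\<in>cball 0 1. \<bar>emp n (\<lambda>x. fst x $ i * Q u (snd x) $ j) \<omega>\<bar> \<le> e1) \<and>
     emp n (\<lambda>x. norm (fst x) * w (snd x) ^ 3) \<omega> \<le> noise_moment_bound \<and>
     emp n (\<lambda>x. w (snd x) ^ 3) \<omega> \<le> design_moment_bound \<and>
     (\<forall>k l. \<bar>emp n (\<lambda>x. g k (snd x) \<bullet> (P *v g l (snd x))) \<omega> - information $ k $ l\<bar> \<le> e1) \<and>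
     (\<forall>k i j. sqrt (real n) * \<bar>emp n (\<lambda>x. fst x $ i * g k (snd x) $ j) \<omega>\<bar> \<le> K)"

lemma moment_bound_pos: "0 < noise_moment_bound" "0 < design_moment_bound"
proof -
  have "0 \<le> expect (\<lambda>x. norm (fst x) * w (snd x) ^ 3)" "0 \<le> expect (\<lambda>x. w (snd x) ^ 3)"
    unfolding expect_def using w_nonneg by (auto intro!: integral_nonneg)
  then show "0 < noise_moment_bound" "0 < design_moment_bound"
    by (auto simp: noise_moment_bound_def design_moment_bound_def)
qed

text \<open>\<open>K\<close> depends on \<kappa> alone. This order of quantifiers matters: the
  admissible size of \<open>e0\<close> is later derived from a Lipschitz constant that contains
  \<open>K\<close>. Half of \<kappa> is spent on tightness and half on the weak laws.\<close>

lemma regular_likely: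
  assumes "\<kappa> > 0"
  obtains K where "K > 0" "\<And>e0 e1. e0 > 0 \<Longrightarrow> e1 > 0 \<Longrightarrow> likely \<kappa> (regular e0 e1 K)"
proof -
  let ?h = "\<lambda>p n \<omega>. sqrt (real n) * \<bar>emp n (\<lambda>x. fst x $ fst (snd p) * g (fst p) (snd x) $ snd (snd p)) \<omega>\<bar>"
  have "bounded_in_prob (\<lambda>n \<omega>. \<Sum>p\<in>(UNIV :: ('k \<times> 'd \<times> 'd) set). ?h p n \<omega>)"
    by (intro bounded_in_prob_sum bounded_in_prob_emp noise_g_square noise_g(2)) (auto, measurable)
  moreover have "\<kappa> / 2 > 0" using assms by simp
  ultimately obtain K where K: "K > 0" "likely (\<kappa> / 2) (\<lambda>n \<omega>. (\<Sum>p\<in>(UNIV :: ('k \<times> 'd \<times> 'd) set). ?h p n \<omega>) \<le> K)"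
    unfolding bounded_in_prob_def by blast
  have "likely \<kappa> (regular e0 e1 K)" if e: "e0 > 0" "e1 > 0" for e0 e1
  proof -
    have c1: "asymptotically_certain (\<lambda>n \<omega>. norm (emp_cov n (\<lambda>_. 0) \<omega> - \<Gamma>) \<le> e0)"
    proof -
      have "lim_cov (\<lambda>_. 0) = \<Gamma>"
        using lim_cov_eq(1)[of "\<lambda>_. 0" 0] by (simp add: expect_const vec_eq_iff)
      \<comment> \<open>A one-point parameter set specialises the uniform law to the covariance of
        the noise alone.\<close>
      moreover have "asymptotically_certain (\<lambda>n \<omega>. \<forall>W\<in>{0::real}. norm (emp_cov n (\<lambda>_. 0) \<omega> - lim_cov (\<lambda>_. 0)) \<le> e0)"
        by (rule uniform_weak_law_cov(1)[where c = 0]) (use e in auto)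
      ultimately show ?thesis by simp
    qed
    have c2: "asymptotically_certain (\<lambda>n \<omega>. \<forall>p\<in>UNIV. \<forall>u\<in>cball 0 1. \<bar>emp n (\<lambda>x. fst x $ fst p * Q u (snd x) $ snd p) \<omega>\<bar> \<le> e1)"
    proof (rule asymptotically_certain_ball)
      fix p :: "'d \<times> 'd"
      have Q0: "Q 0 z = 0" for z using Q_scale[of 0 0 z] by simp
      have Qb: "\<bar>Q u z $ j\<bar> \<le> C * w z ^ 3" if "u \<in> cball 0 1" for u z j
      proof -
        have "\<bar>Q u z $ j\<bar> \<le> norm (Q u z)" by (rule component_le_norm_cart)
        also have "\<dots> \<le> C * (w z)\<^sup>2 * norm u" using Q_lipschitz[of u 0 z] that by (simp add: Q0)
        also have "\<dots> \<le> C * (w z)\<^sup>2 * 1" using that weight_bounds_nonneg(2) by (intro mult_left_mono) auto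
        also have "\<dots> \<le> C * w z ^ 3" using mult_left_mono[OF w_power_le(2) C_nonneg] by simp
        finally show ?thesis .
      qed
      have Qm: "(\<lambda>z. Q u z $ j) \<in> borel_measurable borel" for u j by measurable
      have "asymptotically_certain (\<lambda>n \<omega>. \<forall>u\<in>cball 0 1. \<bar>emp n (\<lambda>x. fst x $ fst p * Q u (snd x) $ snd p) \<omega>
          - expect (\<lambda>x. fst x $ fst p * Q u (snd x) $ snd p)\<bar> \<le> e1)"
      proof (rule uniform_weak_law[OF compact_cball _ _ _ _ \<open>e1 > 0\<close>])
        show "integ (\<lambda>x. fst x $ fst p * Q u (snd x) $ snd p)" if "u \<in> cball 0 1" for u
          by (rule noise_design_product(1)[OF Qm Qb[OF that]])
        show "integ (\<lambda>x. C * (norm (fst x) * (w (snd x))\<^sup>2))"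
        proof (rule integ_cmult)
          have "(\<lambda>z. (w z)\<^sup>2) \<in> borel_measurable borel" by measurable
          moreover have "\<bar>(w z)\<^sup>2\<bar> \<le> 1 * w z ^ 3" for z using w_power_le(2) by simp
          ultimately show "integ (\<lambda>x. norm (fst x) * (w (snd x))\<^sup>2)"
            by (rule noise_design_product(3)[of "\<lambda>z. (w z)\<^sup>2" 1])
        qed
        show "0 \<le> C * (norm (fst y) * (w (snd y))\<^sup>2)" for y :: "(real ^ 'd) \<times> 'z"
          using C_nonneg by simp
        fix u v :: "real ^ 'k" and y :: "(real ^ 'd) \<times> 'z" assume u: "u \<in> cball 0 1" and v: "v \<in> cball 0 1"
        have "\<bar>fst y $ fst p * Q u (snd y) $ snd p - fst y $ fst p * Q v (snd y) $ snd p\<bar> =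
          \<bar>fst y $ fst p\<bar> * \<bar>(Q u (snd y) - Q v (snd y)) $ snd p\<bar>"
          by (simp add: abs_mult[symmetric] right_diff_distrib)
        also have "\<dots> \<le> norm (fst y) * (C * (w (snd y))\<^sup>2 * norm (u - v))"
          using u v by (intro mult_mono component_le_norm_cart order_trans[OF component_le_norm_cart Q_lipschitz]) auto
        finally show "\<bar>fst y $ fst p * Q u (snd y) $ snd p - fst y $ fst p * Q v (snd y) $ snd p\<bar>
          \<le> C * (norm (fst y) * (w (snd y))\<^sup>2) * dist u v"
          by (simp add: dist_norm mult_ac)
      qed
      moreover have "expect (\<lambda>x. fst x $ fst p * Q u (snd x) $ snd p) = 0" if "u \<in> cball 0 1" for u
        by (rule noise_design_product(2)[OF Qm Qb[OF that]])
      ultimately show "asymptotically_certain (\<lambda>n \<omega>. \<forall>u\<in>cball 0 1. \<bar>emp n (\<lambda>x. fst x $ fst p * Q u (snd x) $ snd p) \<omega>\<bar> \<le> e1)"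
        by simp
    qed simp
    have c3: "asymptotically_certain (\<lambda>n \<omega>. emp n (\<lambda>x. norm (fst x) * w (snd x) ^ 3) \<omega> \<le> noise_moment_bound)"
    proof -
      have "integ (\<lambda>x. norm (fst x) * w (snd x) ^ 3)"
      proof (rule noise_design_product(3)[of "\<lambda>z. w z ^ 3" 1])
        show "\<bar>w z ^ 3\<bar> \<le> 1 * w z ^ 3" for z using w_nonneg[of z] by simp
      qed measurable
      from weak_law[OF this zero_less_one] show ?thesis
        by (rule asymptotically_certain_mono') (auto simp: noise_moment_bound_def)
    qed
    have c4: "asymptotically_certain (\<lambda>n \<omega>. emp n (\<lambda>x. w (snd x) ^ 3) \<omega> \<le> design_moment_bound)"
      by (rule asymptotically_certain_mono'[OF weak_law[OF w_cube zero_less_one]]) (auto simp: design_moment_bound_def)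
    have c5: "asymptotically_certain (\<lambda>n \<omega>. \<forall>p\<in>UNIV.
      \<bar>emp n (\<lambda>x. g (fst p) (snd x) \<bullet> (P *v g (snd p) (snd x))) \<omega> - information $ fst p $ snd p\<bar> \<le> e1)"
    proof (intro asymptotically_certain_ball)
      fix p :: "'k \<times> 'k"
      show "asymptotically_certain (\<lambda>n \<omega>. \<bar>emp n (\<lambda>x. g (fst p) (snd x) \<bullet> (P *v g (snd p) (snd x))) \<omega> - information $ fst p $ snd p\<bar> \<le> e1)"
        using weak_law[OF information_summand e(2), of "fst p" "snd p"] by (simp add: information_def)
    qed simp
    have "likely (\<kappa> / 2) (\<lambda>n \<omega>. norm (emp_cov n (\<lambda>_. 0) \<omega> - \<Gamma>) \<le> e0 \<and>
       (\<forall>p\<in>UNIV. \<forall>u\<in>cball 0 1. \<bar>emp n (\<lambda>x. fst x $ fst p * Q u (snd x) $ snd p) \<omega>\<bar> \<le> e1) \<and>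
       emp n (\<lambda>x. norm (fst x) * w (snd x) ^ 3) \<omega> \<le> noise_moment_bound \<and>
       emp n (\<lambda>x. w (snd x) ^ 3) \<omega> \<le> design_moment_bound \<and>
       (\<forall>p\<in>UNIV. \<bar>emp n (\<lambda>x. g (fst p) (snd x) \<bullet> (P *v g (snd p) (snd x))) \<omega> - information $ fst p $ snd p\<bar> \<le> e1))"
      using asymptotically_certain_conj[OF c1 asymptotically_certain_conj[OF c2 asymptotically_certain_conj[OF c3 asymptotically_certain_conj[OF c4 c5]]]]
        \<open>\<kappa> / 2 > 0\<close> unfolding asymptotically_certain_def by blast
    from likely_conj[OF this K(2)] show ?thesis
    proof (rule likely_mono)
      show "\<forall>\<^sub>F n in sequentially. \<forall>\<omega>\<in>space M. (norm (emp_cov n (\<lambda>_. 0) \<omega> - \<Gamma>) \<le> e0 \<and>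
       (\<forall>p\<in>UNIV. \<forall>u\<in>cball 0 1. \<bar>emp n (\<lambda>x. fst x $ fst p * Q u (snd x) $ snd p) \<omega>\<bar> \<le> e1) \<and>
       emp n (\<lambda>x. norm (fst x) * w (snd x) ^ 3) \<omega> \<le> noise_moment_bound \<and>
       emp n (\<lambda>x. w (snd x) ^ 3) \<omega> \<le> design_moment_bound \<and>
       (\<forall>p\<in>UNIV. \<bar>emp n (\<lambda>x. g (fst p) (snd x) \<bullet> (P *v g (snd p) (snd x))) \<omega> - information $ fst p $ snd p\<bar> \<le> e1)) \<and>
       (\<Sum>p\<in>(UNIV :: ('k \<times> 'd \<times> 'd) set). ?h p n \<omega>) \<le> K \<longrightarrow> regular e0 e1 K n \<omega>"
      proof (intro always_eventually allI ballI impI, elim conjE)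
        fix n \<omega>
        assume sum: "(\<Sum>p\<in>(UNIV :: ('k \<times> 'd \<times> 'd) set). ?h p n \<omega>) \<le> K"
        have "?h p n \<omega> \<le> (\<Sum>p\<in>(UNIV :: ('k \<times> 'd \<times> 'd) set). ?h p n \<omega>)" for p
          by (rule member_le_sum) auto
        then have "?h p n \<omega> \<le> K" for p using sum order_trans by blast
        from this[of "(k, i, j)" for k i j]
        have hK: "sqrt (real n) * \<bar>emp n (\<lambda>x. fst x $ i * g k (snd x) $ j) \<omega>\<bar> \<le> K" for k i j by simp
        assume "norm (emp_cov n (\<lambda>_. 0) \<omega> - \<Gamma>) \<le> e0"
          and "emp n (\<lambda>x. norm (fst x) * w (snd x) ^ 3) \<omega> \<le> noise_moment_bound"
          and "emp n (\<lambda>x. w (snd x) ^ 3) \<omega> \<le> design_moment_bound"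
          and q: "\<forall>p\<in>UNIV. \<forall>u\<in>cball 0 1. \<bar>emp n (\<lambda>x. fst x $ fst p * Q u (snd x) $ snd p) \<omega>\<bar> \<le> e1"
          and i: "\<forall>p\<in>UNIV. \<bar>emp n (\<lambda>x. g (fst p) (snd x) \<bullet> (P *v g (snd p) (snd x))) \<omega> - information $ fst p $ snd p\<bar> \<le> e1"
        then show "regular e0 e1 K n \<omega>"
          unfolding regular_def using hK q[rule_format, of "(i, j)" for i j] i[rule_format, of "(k, l)" for k l] by simp
      qed
    qed simp
  qed
  with K(1) show ?thesis by (rule that)
qed

end

section \<open>Deterministic estimates for the terms of the expansion\<close>

lemma abs_add_mult_le: "\<bar>a * b + c * d\<bar> \<le> \<bar>a\<bar> * \<bar>b\<bar> + \<bar>c\<bar> * \<bar>d\<bar>" for a b c d :: real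
  using abs_triangle_ineq[of "a * b" "c * d"] by (simp add: abs_mult)

context smooth_regression
begin

definition pnorm :: real where "pnorm = (\<Sum>i\<in>UNIV. \<Sum>j\<in>UNIV. \<bar>P $ i $ j\<bar>)"

lemma pnorm_nonneg: "0 \<le> pnorm"
  unfolding pnorm_def by (intro sum_nonneg) auto

lemma P_weighted_bound:
  assumes "\<And>i j. \<bar>b i j\<bar> \<le> B"
  shows "\<bar>\<Sum>i\<in>UNIV. \<Sum>j\<in>UNIV. P $ i $ j * b i j\<bar> \<le> pnorm * B"
  using sum_weighted_bound[of UNIV "\<lambda>p. b (fst p) (snd p)" B "\<lambda>p. P $ fst p $ snd p"] assms
  by (simp add: pnorm_def sum.cartesian_product case_prod_unfold)

text \<open>The second-order part is handled by cancellation on the unit ball and rescaled by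
  homogeneity, which gives the small factor \<open>e1\<close>; only the third-order rest is bounded
  by absolute values.\<close>

lemma regular_cross_remainder:
  assumes reg: "regular e0 e1 K n \<omega>" and \<delta>: "norm \<delta> \<le> 1"
  shows "\<bar>emp n (\<lambda>x. fst x $ i * D \<delta> (snd x) $ j) \<omega> - emp n (\<lambda>x. fst x $ i * G \<delta> (snd x) $ j) \<omega>\<bar>
    \<le> e1 * (norm \<delta>)\<^sup>2 + C * noise_moment_bound * norm \<delta> ^ 3"
proof -
  define R where "R z = D \<delta> z - G \<delta> z - Q \<delta> z" for z
  have R: "\<bar>R z $ j\<bar> \<le> C * w z ^ 3 * norm \<delta> ^ 3" for z
    using component_le_norm_cart[of "R z" j] D_order3[OF \<delta>, of z] unfolding R_def G_def by linarith
  have split: "emp n (\<lambda>x. fst x $ i * D \<delta> (snd x) $ j) \<omega> - emp n (\<lambda>x. fst x $ i * G \<delta> (snd x) $ j) \<omega> =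
    emp n (\<lambda>x. fst x $ i * Q \<delta> (snd x) $ j) \<omega> + emp n (\<lambda>x. fst x $ i * R (snd x) $ j) \<omega>"
    unfolding emp_diff[symmetric] emp_add[symmetric] by (simp add: R_def algebra_simps)
  have "\<bar>emp n (\<lambda>x. fst x $ i * Q \<delta> (snd x) $ j) \<omega>\<bar> \<le> e1 * (norm \<delta>)\<^sup>2"
  proof -
    \<comment> \<open>For \<delta> = 0 division by zero yields u = 0, which is still in the unit
      ball and satisfies the rescaling identity.\<close>
    define u where "u = (1 / norm \<delta>) *\<^sub>R \<delta>"
    have u: "u \<in> cball 0 1" "\<delta> = norm \<delta> *\<^sub>R u" by (auto simp: u_def)
    have "Q \<delta> z = (norm \<delta>)\<^sup>2 *\<^sub>R Q u z" for z
      by (subst u(2)) (rule Q_scale)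
    then have "emp n (\<lambda>x. fst x $ i * Q \<delta> (snd x) $ j) \<omega> = (norm \<delta>)\<^sup>2 * emp n (\<lambda>x. fst x $ i * Q u (snd x) $ j) \<omega>"
      by (subst emp_cmult[symmetric]) (simp add: mult_ac)
    moreover have "\<bar>emp n (\<lambda>x. fst x $ i * Q u (snd x) $ j) \<omega>\<bar> \<le> e1"
      using reg u(1) unfolding regular_def by blast
    then have "(norm \<delta>)\<^sup>2 * \<bar>emp n (\<lambda>x. fst x $ i * Q u (snd x) $ j) \<omega>\<bar> \<le> (norm \<delta>)\<^sup>2 * e1"
      by (rule mult_left_mono) simp
    ultimately show ?thesis by (simp add: abs_mult mult.commute)
  qed
  moreover have "\<bar>emp n (\<lambda>x. fst x $ i * R (snd x) $ j) \<omega>\<bar> \<le> C * noise_moment_bound * norm \<delta> ^ 3"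
  proof -
    have "\<bar>emp n (\<lambda>x. fst x $ i * R (snd x) $ j) \<omega>\<bar> \<le> emp n (\<lambda>x. \<bar>fst x $ i * R (snd x) $ j\<bar>) \<omega>"
      using emp_norm[of n "\<lambda>x. fst x $ i * R (snd x) $ j" \<omega>] by simp
    also have "\<dots> \<le> emp n (\<lambda>x. (C * norm \<delta> ^ 3) * (norm (fst x) * w (snd x) ^ 3)) \<omega>"
    proof (rule emp_mono)
      fix y :: "(real ^ 'd) \<times> 'z"
      have "\<bar>fst y $ i * R (snd y) $ j\<bar> \<le> norm (fst y) * (C * w (snd y) ^ 3 * norm \<delta> ^ 3)"
        unfolding abs_mult by (intro mult_mono R component_le_norm_cart) auto
      then show "\<bar>fst y $ i * R (snd y) $ j\<bar> \<le> (C * norm \<delta> ^ 3) * (norm (fst y) * w (snd y) ^ 3)"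
        by (simp add: mult_ac)
    qed
    also have "\<dots> = (C * norm \<delta> ^ 3) * emp n (\<lambda>x. norm (fst x) * w (snd x) ^ 3) \<omega>" by (rule emp_cmult)
    also have "\<dots> \<le> (C * norm \<delta> ^ 3) * noise_moment_bound"
      using reg C_nonneg unfolding regular_def by (intro mult_left_mono) auto
    finally show ?thesis by (simp add: mult_ac)
  qed
  ultimately show ?thesis unfolding split by linarith
qed

lemma emp_noise_G: "emp n (\<lambda>x. fst x $ i * G \<delta> (snd x) $ j) \<omega> = (\<Sum>k\<in>UNIV. \<delta> $ k * emp n (\<lambda>x. fst x $ i * g k (snd x) $ j) \<omega>)"
  unfolding emp_cmult[symmetric] emp_sum[symmetric]
  by (simp add: G_def sum_distrib_left mult_ac)

lemma regular_linear_term: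
  assumes reg: "regular e0 e1 K n \<omega>" and "n > 0"
  shows "\<bar>emp n (\<lambda>x. fst x $ i * G \<delta> (snd x) $ j) \<omega>\<bar> \<le> real CARD('k) * K * (norm \<delta> / sqrt (real n))"
proof -
  have "\<bar>emp n (\<lambda>x. fst x $ i * G \<delta> (snd x) $ j) \<omega>\<bar> \<le> (\<Sum>k\<in>UNIV. \<bar>\<delta> $ k * emp n (\<lambda>x. fst x $ i * g k (snd x) $ j) \<omega>\<bar>)"
    unfolding emp_noise_G by (rule sum_abs)
  also have "\<dots> \<le> (\<Sum>k\<in>(UNIV :: 'k set). norm \<delta> * (K / sqrt (real n)))"
  proof (rule sum_mono)
    fix k
    have "\<bar>emp n (\<lambda>x. fst x $ i * g k (snd x) $ j) \<omega>\<bar> \<le> K / sqrt (real n)"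
      using reg \<open>n > 0\<close> unfolding regular_def by (simp add: pos_le_divide_eq mult.commute)
    then show "\<bar>\<delta> $ k * emp n (\<lambda>x. fst x $ i * g k (snd x) $ j) \<omega>\<bar> \<le> norm \<delta> * (K / sqrt (real n))"
      unfolding abs_mult by (intro mult_mono component_le_norm_cart) auto
  qed
  finally show ?thesis by (simp add: mult_ac)
qed

lemma D_nth_bound:
  assumes "norm \<delta> \<le> 1"
  shows "\<bar>D \<delta> z $ i\<bar> \<le> C * w z * norm \<delta>"
  using component_le_norm_cart[of "D \<delta> z" i] D_order1[OF assms, of z] by linarith

lemma regular_design_bound:
  assumes reg: "regular e0 e1 K n \<omega>" and \<delta>: "norm \<delta> \<le> 1"
  shows "\<bar>emp n (\<lambda>x. D \<delta> (snd x) $ i * D \<delta> (snd x) $ j) \<omega>\<bar> \<le> C\<^sup>2 * design_moment_bound * (norm \<delta>)\<^sup>2"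
proof -
  have "\<bar>emp n (\<lambda>x. D \<delta> (snd x) $ i * D \<delta> (snd x) $ j) \<omega>\<bar> \<le> emp n (\<lambda>x. \<bar>D \<delta> (snd x) $ i * D \<delta> (snd x) $ j\<bar>) \<omega>"
    using emp_norm[of n "\<lambda>x. D \<delta> (snd x) $ i * D \<delta> (snd x) $ j" \<omega>] by simp
  also have "\<dots> \<le> emp n (\<lambda>x. (C\<^sup>2 * (norm \<delta>)\<^sup>2) * w (snd x) ^ 3) \<omega>"
  proof (rule emp_mono)
    fix y :: "(real ^ 'd) \<times> 'z"
    let ?z = "snd y"
    have "\<bar>D \<delta> ?z $ i * D \<delta> ?z $ j\<bar> \<le> (C * w ?z * norm \<delta>) * (C * w ?z * norm \<delta>)"
      unfolding abs_mult using weight_bounds_nonneg(1) by (intro mult_mono D_nth_bound \<delta>) auto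
    also have "\<dots> = (C\<^sup>2 * (norm \<delta>)\<^sup>2) * (w ?z)\<^sup>2" by (simp add: power2_eq_square)
    also have "\<dots> \<le> (C\<^sup>2 * (norm \<delta>)\<^sup>2) * w ?z ^ 3" by (intro mult_left_mono w_power_le) auto
    finally show "\<bar>D \<delta> ?z $ i * D \<delta> ?z $ j\<bar> \<le> (C\<^sup>2 * (norm \<delta>)\<^sup>2) * w ?z ^ 3" .
  qed
  also have "\<dots> = (C\<^sup>2 * (norm \<delta>)\<^sup>2) * emp n (\<lambda>x. w (snd x) ^ 3) \<omega>" by (rule emp_cmult)
  also have "\<dots> \<le> (C\<^sup>2 * (norm \<delta>)\<^sup>2) * design_moment_bound"
    using reg unfolding regular_def by (intro mult_left_mono) auto
  finally show ?thesis by (simp add: mult_ac)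
qed

text \<open>A difference of products has one second-order factor of weight w^2 and one first-order
  factor of weight w, so the cube of the weight suffices. The 1 comes from the bound on
  \<open>D\<close>, the number of parameters from the bound on \<open>G\<close>.\<close>

lemma regular_design_remainder:
  assumes reg: "regular e0 e1 K n \<omega>" and \<delta>: "norm \<delta> \<le> 1"
  shows "\<bar>emp n (\<lambda>x. D \<delta> (snd x) $ i * D \<delta> (snd x) $ j) \<omega> - emp n (\<lambda>x. G \<delta> (snd x) $ i * G \<delta> (snd x) $ j) \<omega>\<bar>
    \<le> (1 + real CARD('k)) * C\<^sup>2 * design_moment_bound * norm \<delta> ^ 3"
proof -
  let ?c = "(1 + real CARD('k)) * C\<^sup>2 * norm \<delta> ^ 3"
  have "\<bar>emp n (\<lambda>x. D \<delta> (snd x) $ i * D \<delta> (snd x) $ j) \<omega> - emp n (\<lambda>x. G \<delta> (snd x) $ i * G \<delta> (snd x) $ j) \<omega>\<bar>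
    \<le> emp n (\<lambda>x. \<bar>D \<delta> (snd x) $ i * D \<delta> (snd x) $ j - G \<delta> (snd x) $ i * G \<delta> (snd x) $ j\<bar>) \<omega>"
    unfolding emp_diff[symmetric]
    using emp_norm[of n "\<lambda>x. D \<delta> (snd x) $ i * D \<delta> (snd x) $ j - G \<delta> (snd x) $ i * G \<delta> (snd x) $ j" \<omega>] by simp
  also have "\<dots> \<le> emp n (\<lambda>x. ?c * w (snd x) ^ 3) \<omega>"
  proof (rule emp_mono)
    fix y :: "(real ^ 'd) \<times> 'z"
    let ?z = "snd y"
    have d: "\<bar>D \<delta> ?z $ i - G \<delta> ?z $ i\<bar> \<le> C * (w ?z)\<^sup>2 * (norm \<delta>)\<^sup>2" for i
      using component_le_norm_cart[of "D \<delta> ?z - G \<delta> ?z" i] D_order2[OF \<delta>, of ?z] unfolding G_def by simp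
    have "D \<delta> ?z $ i * D \<delta> ?z $ j - G \<delta> ?z $ i * G \<delta> ?z $ j =
      (D \<delta> ?z $ i - G \<delta> ?z $ i) * D \<delta> ?z $ j + G \<delta> ?z $ i * (D \<delta> ?z $ j - G \<delta> ?z $ j)"
      by (simp add: algebra_simps)
    also have "\<bar>\<dots>\<bar> \<le> \<bar>D \<delta> ?z $ i - G \<delta> ?z $ i\<bar> * \<bar>D \<delta> ?z $ j\<bar> + \<bar>G \<delta> ?z $ i\<bar> * \<bar>D \<delta> ?z $ j - G \<delta> ?z $ j\<bar>"
      by (rule abs_add_mult_le)
    also have "\<dots> \<le> (C * (w ?z)\<^sup>2 * (norm \<delta>)\<^sup>2) * (C * w ?z * norm \<delta>) + (real CARD('k) * C * w ?z * norm \<delta>) * (C * (w ?z)\<^sup>2 * (norm \<delta>)\<^sup>2)"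
      using C_nonneg w_nonneg by (intro add_mono mult_mono d D_nth_bound \<delta> G_nth_bound) auto
    also have "\<dots> = ?c * w ?z ^ 3" by (simp add: power2_eq_square power3_eq_cube algebra_simps)
    finally show "\<bar>D \<delta> ?z $ i * D \<delta> ?z $ j - G \<delta> ?z $ i * G \<delta> ?z $ j\<bar> \<le> ?c * w ?z ^ 3" .
  qed
  also have "\<dots> = ?c * emp n (\<lambda>x. w (snd x) ^ 3) \<omega>" by (rule emp_cmult)
  also have "\<dots> \<le> ?c * design_moment_bound"
    using reg unfolding regular_def by (intro mult_left_mono) auto
  finally show ?thesis by (simp add: mult_ac)
qed

lemma score_inner:
  "score n \<omega> \<bullet> \<delta> = sqrt (real n) * (\<Sum>i\<in>UNIV. \<Sum>j\<in>UNIV. P $ i $ j * emp n (\<lambda>x. fst x $ i * G \<delta> (snd x) $ j) \<omega>)"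
proof -
  have s: "score n \<omega> $ k = sqrt (real n) * (\<Sum>i\<in>UNIV. \<Sum>j\<in>UNIV. P $ i $ j * emp n (\<lambda>x. fst x $ i * g k (snd x) $ j) \<omega>)" for k
    by (simp add: score_def inner_matrix_vector_sum emp_sum emp_cmult)
  have "score n \<omega> \<bullet> \<delta> = (\<Sum>k\<in>UNIV. \<Sum>i\<in>UNIV. \<Sum>j\<in>UNIV. sqrt (real n) * (P $ i $ j * (\<delta> $ k * emp n (\<lambda>x. fst x $ i * g k (snd x) $ j) \<omega>)))"
    by (simp add: inner_vec_def s sum_distrib_left sum_distrib_right mult_ac)
  also have "\<dots> = (\<Sum>i\<in>UNIV. \<Sum>k\<in>UNIV. \<Sum>j\<in>UNIV. sqrt (real n) * (P $ i $ j * (\<delta> $ k * emp n (\<lambda>x. fst x $ i * g k (snd x) $ j) \<omega>)))"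
    by (rule sum.swap)
  also have "\<dots> = (\<Sum>i\<in>UNIV. \<Sum>j\<in>UNIV. \<Sum>k\<in>UNIV. sqrt (real n) * (P $ i $ j * (\<delta> $ k * emp n (\<lambda>x. fst x $ i * g k (snd x) $ j) \<omega>)))"
    by (intro sum.cong refl sum.swap)
  finally show ?thesis by (simp add: emp_noise_G sum_distrib_left)
qed

lemma G_quadratic:
  "G \<delta> z \<bullet> (P *v G \<delta> z) = (\<Sum>k\<in>UNIV. \<Sum>l\<in>UNIV. (\<delta> $ k * \<delta> $ l) * (g k z \<bullet> (P *v g l z)))"
proof -
  have A: "v \<bullet> (P *v G \<delta> z) = (\<Sum>l\<in>UNIV. \<delta> $ l * (v \<bullet> (P *v g l z)))" for v
    by (simp add: G_def linear_sum[OF matrix_vector_mul_linear] matrix_vector_mult_scaleR inner_sum_right)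
  have B: "G \<delta> z \<bullet> v = (\<Sum>k\<in>UNIV. \<delta> $ k * (g k z \<bullet> v))" for v
    by (simp add: G_def inner_sum_left)
  show ?thesis
    unfolding B[of "P *v G \<delta> z"] by (simp add: A sum_distrib_left mult_ac)
qed

lemma regular_quadratic_term:
  assumes reg: "regular e0 e1 K n \<omega>"
  shows "\<bar>(\<Sum>i\<in>UNIV. \<Sum>j\<in>UNIV. P $ i $ j * emp n (\<lambda>x. G \<delta> (snd x) $ i * G \<delta> (snd x) $ j) \<omega>) - \<delta> \<bullet> (information *v \<delta>)\<bar>
    \<le> (real CARD('k))\<^sup>2 * e1 * (norm \<delta>)\<^sup>2"
proof -
  let ?m = "\<lambda>k l. emp n (\<lambda>x. g k (snd x) \<bullet> (P *v g l (snd x))) \<omega>"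
  have "(\<Sum>i\<in>UNIV. \<Sum>j\<in>UNIV. P $ i $ j * emp n (\<lambda>x. G \<delta> (snd x) $ i * G \<delta> (snd x) $ j) \<omega>) =
    emp n (\<lambda>x. G \<delta> (snd x) \<bullet> (P *v G \<delta> (snd x))) \<omega>"
    by (simp add: inner_matrix_vector_sum emp_sum emp_cmult)
  also have "(\<lambda>x :: (real ^ 'd) \<times> 'z. G \<delta> (snd x) \<bullet> (P *v G \<delta> (snd x))) =
    (\<lambda>x. \<Sum>k\<in>UNIV. \<Sum>l\<in>UNIV. (\<delta> $ k * \<delta> $ l) * (g k (snd x) \<bullet> (P *v g l (snd x))))"
    unfolding G_quadratic ..
  also have "emp n \<dots> \<omega> = (\<Sum>k\<in>UNIV. \<Sum>l\<in>UNIV. (\<delta> $ k * \<delta> $ l) * ?m k l)"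
    by (simp add: emp_sum emp_cmult)
  finally have eq: "(\<Sum>i\<in>UNIV. \<Sum>j\<in>UNIV. P $ i $ j * emp n (\<lambda>x. G \<delta> (snd x) $ i * G \<delta> (snd x) $ j) \<omega>) - \<delta> \<bullet> (information *v \<delta>)
    = (\<Sum>k\<in>UNIV. \<Sum>l\<in>UNIV. (\<delta> $ k * \<delta> $ l) * (?m k l - information $ k $ l))"
    by (simp add: inner_matrix_vector_sum right_diff_distrib sum_subtractf mult_ac)
  have "\<bar>\<Sum>k\<in>UNIV. \<Sum>l\<in>UNIV. (\<delta> $ k * \<delta> $ l) * (?m k l - information $ k $ l)\<bar>
     \<le> (\<Sum>k\<in>(UNIV :: 'k set). \<Sum>l\<in>(UNIV :: 'k set). (norm \<delta> * norm \<delta>) * e1)"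
  proof (intro order_trans[OF sum_abs] sum_mono)
    fix k l
    have "\<bar>?m k l - information $ k $ l\<bar> \<le> e1" using reg unfolding regular_def by blast
    then show "\<bar>(\<delta> $ k * \<delta> $ l) * (?m k l - information $ k $ l)\<bar> \<le> (norm \<delta> * norm \<delta>) * e1"
      unfolding abs_mult by (intro mult_mono component_le_norm_cart) auto
  qed
  then show ?thesis unfolding eq by (simp add: power2_eq_square mult_ac)
qed

lemma emp_cov_increment:
  "(emp_cov n (D \<delta>) \<omega> - emp_cov n (\<lambda>_. 0) \<omega>) $ i $ j =
     emp n (\<lambda>x. D \<delta> (snd x) $ i * D \<delta> (snd x) $ j) \<omega>
     - emp n (\<lambda>x. fst x $ i * D \<delta> (snd x) $ j) \<omega> - emp n (\<lambda>x. fst x $ j * D \<delta> (snd x) $ i) \<omega>"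
  unfolding vector_minus_component emp_cov_nth emp_diff[symmetric]
  by (simp add: residual_def algebra_simps)

text \<open>The products of noise with noise cancel in the increment, and the symmetry of
  \<open>P\<close> merges the two transposed cross terms into a factor 2.\<close>

lemma trace_increment:
  "trace (P ** (emp_cov n (D \<delta>) \<omega> - emp_cov n (\<lambda>_. 0) \<omega>)) =
     (\<Sum>i\<in>UNIV. \<Sum>j\<in>UNIV. P $ i $ j * emp n (\<lambda>x. D \<delta> (snd x) $ i * D \<delta> (snd x) $ j) \<omega>)
     - 2 * (\<Sum>i\<in>UNIV. \<Sum>j\<in>UNIV. P $ i $ j * emp n (\<lambda>x. fst x $ i * D \<delta> (snd x) $ j) \<omega>)"
proof -
  let ?A = "emp_cov n (D \<delta>) \<omega> - emp_cov n (\<lambda>_. 0) \<omega>"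
  let ?b = "\<lambda>i j. emp n (\<lambda>x. fst x $ i * D \<delta> (snd x) $ j) \<omega>"
  have "(\<Sum>i\<in>UNIV. \<Sum>j\<in>UNIV. P $ i $ j * ?b j i) = (\<Sum>j\<in>UNIV. \<Sum>i\<in>UNIV. P $ i $ j * ?b j i)"
    by (rule sum.swap)
  also have "\<dots> = (\<Sum>i\<in>UNIV. \<Sum>j\<in>UNIV. P $ i $ j * ?b i j)"
    by (intro sum.cong refl) (simp add: P_nth_commute)
  finally have swap: "(\<Sum>i\<in>UNIV. \<Sum>j\<in>UNIV. P $ i $ j * ?b j i) = (\<Sum>i\<in>UNIV. \<Sum>j\<in>UNIV. P $ i $ j * ?b i j)" .
  have "trace (P ** ?A) = (\<Sum>i\<in>UNIV. \<Sum>j\<in>UNIV. P $ i $ j * ?A $ j $ i)"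
    by (simp add: trace_def matrix_matrix_mult_def)
  also have "\<dots> = (\<Sum>i\<in>UNIV. \<Sum>j\<in>UNIV. P $ i $ j * emp n (\<lambda>x. D \<delta> (snd x) $ i * D \<delta> (snd x) $ j) \<omega>)
      - (\<Sum>i\<in>UNIV. \<Sum>j\<in>UNIV. P $ i $ j * ?b j i) - (\<Sum>i\<in>UNIV. \<Sum>j\<in>UNIV. P $ i $ j * ?b i j)"
    unfolding emp_cov_increment by (simp add: right_diff_distrib sum_subtractf mult.commute[of "D \<delta> _ $ _" "D \<delta> _ $ _"])
  finally show ?thesis unfolding swap by simp
qed

text \<open>Positivity is secured on the same neighbourhood because minimality of the cost yields a
  comparison only with parameters of positive determinant.\<close>

lemma det_strict_expansion:
  assumes "e > 0"
  obtains d where "d > 0" "\<forall>A B. norm (A - \<Gamma>) < d \<longrightarrow> norm (B - \<Gamma>) < d \<longrightarrow> 0 < det A \<and>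
     \<bar>det A - det B - det \<Gamma> * trace (P ** (A - B))\<bar> \<le> e * norm (A - B)"
proof -
  note inv = positive_definite_imp_invertible[OF cov_pd]
  note strict = has_strict_derivative_det[OF inv]
  obtain d1 where d1: "d1 > 0" "\<forall>A B. norm (A - \<Gamma>) < d1 \<longrightarrow> norm (B - \<Gamma>) < d1 \<longrightarrow>
     \<bar>det A - det B - det \<Gamma> * trace (P ** (A - B))\<bar> \<le> e * norm (A - B)"
    by (rule has_strict_derivativeD[OF strict assms])
  have "isCont det \<Gamma>"
    using has_strict_derivative_imp_has_derivative[OF strict] by (rule has_derivative_continuous)
  then have "\<forall>\<^sub>F A in nhds \<Gamma>. det A > 0"
    using positive_definite_det_pos[OF cov_pd] by (auto simp: isCont_def tendsto_at_iff_tendsto_nhds intro: order_tendstoD)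
  then obtain d2 where d2: "d2 > 0" "\<forall>A. dist A \<Gamma> < d2 \<longrightarrow> det A > 0"
    unfolding eventually_nhds_metric by blast
  show ?thesis
    using d1 d2 by (intro that[of "min d1 d2"]) (auto simp: dist_norm)
qed

text \<open>The error scale is the size of the matrix increment: the linear term is of order
  |\<delta>| / sqrt n, the rest of order |\<delta>|^2. The radius \<eta> is free of n.\<close>

definition quadratic_expansion :: "real \<Rightarrow> real \<Rightarrow> nat \<Rightarrow> 'w \<Rightarrow> bool" where
  "quadratic_expansion \<rho> \<eta> n \<omega> \<longleftrightarrow> (\<forall>\<delta>. norm \<delta> \<le> \<eta> \<longrightarrow> 0 < det (emp_cov n (D \<delta>) \<omega>) \<and>
    \<bar>(det (emp_cov n (D \<delta>) \<omega>) - det (emp_cov n (\<lambda>_. 0) \<omega>)) / det \<Gamma>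
       + 2 * (score n \<omega> \<bullet> \<delta>) / sqrt (real n) - \<delta> \<bullet> (information *v \<delta>)\<bar>
      \<le> \<rho> * (norm \<delta> / sqrt (real n) + (norm \<delta>)\<^sup>2))"

text \<open>The error \<rho> is spent in thirds: on the nonlinearity of the determinant, on the
  averages bounded by \<open>e1\<close>, and on the cubic remainders. Dependencies run from \<kappa>
  to \<open>K\<close>, then \<open>L\<close>, \<open>e2\<close> and the neighbourhood radius
  \<open>d\<close>, and last \<eta>.\<close>

theorem local_expansion:
  assumes "\<rho> > 0" "\<kappa> > 0"
  obtains \<eta> where "0 < \<eta>" "likely \<kappa> (quadratic_expansion \<rho> \<eta>)"
proof -
  obtain K where K: "K > 0" "\<And>e0 e1. e0 > 0 \<Longrightarrow> e1 > 0 \<Longrightarrow> likely \<kappa> (regular e0 e1 K)"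
    using regular_likely[OF \<open>\<kappa> > 0\<close>] by metis
  define k where "k = real CARD('k)"
  define N where "N = C * noise_moment_bound"
  define N2 where "N2 = C\<^sup>2 * design_moment_bound"
  define d2 where "d2 = real (CARD('d) * CARD('d))"
  \<comment> \<open>A constant with norm (A - B) \<le> L * s: per matrix entry there are two cross
    terms and one design term. The 1 in \<open>1 + N\<close> is the bound for
    \<open>e1\<close>.\<close>
  define L where "L = d2 * (2 * (k * K) + 2 * (1 + N) + N2)"
  have nn: "k \<ge> 0" "N \<ge> 0" "N2 \<ge> 0" "d2 \<ge> 0" "pnorm \<ge> 0"
    using C_nonneg moment_bound_pos pnorm_nonneg by (auto simp: k_def N_def N2_def d2_def)
  have "L \<ge> 0" using nn K(1) by (simp add: L_def)
  have dG: "det \<Gamma> > 0" by (rule positive_definite_det_pos[OF cov_pd])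
  \<comment> \<open>Division by det \<Gamma> and multiplication by \<open>L + 1\<close> turn this
    into \<rho> / 3; the added 1 covers L = 0.\<close>
  define e2 where "e2 = \<rho> * det \<Gamma> / (3 * (L + 1))"
  have "e2 > 0" using \<open>\<rho> > 0\<close> dG \<open>L \<ge> 0\<close> by (simp add: e2_def)
  obtain d where d: "d > 0" "\<forall>A B. norm (A - \<Gamma>) < d \<longrightarrow> norm (B - \<Gamma>) < d \<longrightarrow> 0 < det A \<and>
     \<bar>det A - det B - det \<Gamma> * trace (P ** (A - B))\<bar> \<le> e2 * norm (A - B)"
    by (rule det_strict_expansion[OF \<open>e2 > 0\<close>])
  \<comment> \<open>The coefficient of \<open>e1\<close> is \<open>2 * pnorm\<close> from the
    doubled cross term and k^2 from the convergence of the quadratic form to the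
    information.\<close>
  define e1 where "e1 = min 1 (\<rho> / (3 * (2 * pnorm + k\<^sup>2 + 1)))"
  have den: "2 * pnorm + k\<^sup>2 + 1 > 0" using nn by (intro add_nonneg_pos add_nonneg_nonneg) auto
  have e1: "e1 > 0" "e1 \<le> 1" "(2 * pnorm + k\<^sup>2) * e1 \<le> \<rho> / 3"
  proof -
    show "e1 > 0" "e1 \<le> 1" using \<open>\<rho> > 0\<close> den by (auto simp: e1_def)
    then have "(2 * pnorm + k\<^sup>2) * e1 \<le> (2 * pnorm + k\<^sup>2 + 1) * e1" by simp
    also have "\<dots> \<le> (2 * pnorm + k\<^sup>2 + 1) * (\<rho> / (3 * (2 * pnorm + k\<^sup>2 + 1)))"
      using den by (intro mult_left_mono) (auto simp: e1_def)
    also have "\<dots> = \<rho> / 3" using den by (simp add: field_simps)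
    finally show "(2 * pnorm + k\<^sup>2) * e1 \<le> \<rho> / 3" .
  qed
  \<comment> \<open>The coefficient of |\<delta>|^3: twice the noise remainder and once the design
    remainder.\<close>
  define c where "c = pnorm * (2 * N + (1 + k) * N2)"
  have "c \<ge> 0" using nn by (simp add: c_def)
  \<comment> \<open>The bound 1 admits the Taylor estimates; the second bound makes the matrix
    increment at most d / 4, so that both matrices are within \<open>d\<close> of \<Gamma>; the
    third turns the cubic term into \<rho> / 3 times |\<delta>|^2.\<close>
  define \<eta> where "\<eta> = Min {1, d / (8 * (L + 1)), \<rho> / (3 * (c + 1))}"
  have eta: "\<eta> > 0" using d(1) \<open>L \<ge> 0\<close> \<open>\<rho> > 0\<close> \<open>c \<ge> 0\<close> by (simp add: \<eta>_def)
  have eta_le: "\<eta> \<le> 1" "\<eta> \<le> d / (8 * (L + 1))" "\<eta> \<le> \<rho> / (3 * (c + 1))"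
    unfolding \<eta>_def by (rule Min_le; simp)+
  have "likely \<kappa> (regular (d / 2) e1 K)" using d(1) e1(1) by (intro K(2)) auto
  then have "likely \<kappa> (quadratic_expansion \<rho> \<eta>)"
  proof (rule likely_mono)
    show "\<forall>\<^sub>F n in sequentially. \<forall>\<omega>\<in>space M. regular (d / 2) e1 K n \<omega> \<longrightarrow>
      quadratic_expansion \<rho> \<eta> n \<omega>"
      using eventually_gt_at_top[of 0]
    proof eventually_elim
      case (elim n)
      show ?case
        unfolding quadratic_expansion_def
      proof (intro ballI impI allI)
        fix \<omega> and \<delta> :: "real ^ 'k" assume reg: "regular (d / 2) e1 K n \<omega>" and le: "norm \<delta> \<le> \<eta>"
        have \<delta>1: "norm \<delta> \<le> 1" using le eta_le(1) by linarith
        define s where "s = norm \<delta> / sqrt (real n) + (norm \<delta>)\<^sup>2"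
        define A where "A = emp_cov n (D \<delta>) \<omega>"
        define B where "B = emp_cov n (\<lambda>_. 0) \<omega>"
        have sq: "sqrt (real n) \<ge> 1" using elim by simp
        have dn: "norm \<delta> / sqrt (real n) \<le> norm \<delta>" using sq by (simp add: divide_le_eq mult_left_mono mult_le_cancel_left1)
        have d2le: "(norm \<delta>)\<^sup>2 \<le> norm \<delta>" using \<delta>1 by (simp add: power2_eq_square mult_left_le)
        have d3le: "norm \<delta> ^ 3 \<le> (norm \<delta>)\<^sup>2" "norm \<delta> ^ 3 \<le> \<eta> * (norm \<delta>)\<^sup>2"
        proof -
          have "norm \<delta> * (norm \<delta> * norm \<delta>) \<le> c * (norm \<delta> * norm \<delta>)" if "norm \<delta> \<le> c" for c
            using that by (intro mult_right_mono) auto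
          from this[OF \<delta>1] this[OF le] show "norm \<delta> ^ 3 \<le> (norm \<delta>)\<^sup>2" "norm \<delta> ^ 3 \<le> \<eta> * (norm \<delta>)\<^sup>2"
            by (simp_all add: power2_eq_square power3_eq_cube mult.assoc)
        qed
        have s0: "0 \<le> norm \<delta> / sqrt (real n)" "0 \<le> s" by (simp_all add: s_def)
        let ?b = "\<lambda>i j. emp n (\<lambda>x. fst x $ i * D \<delta> (snd x) $ j) \<omega>"
        let ?bG = "\<lambda>i j. emp n (\<lambda>x. fst x $ i * G \<delta> (snd x) $ j) \<omega>"
        let ?q = "\<lambda>i j. emp n (\<lambda>x. D \<delta> (snd x) $ i * D \<delta> (snd x) $ j) \<omega>"
        let ?qG = "\<lambda>i j. emp n (\<lambda>x. G \<delta> (snd x) $ i * G \<delta> (snd x) $ j) \<omega>"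
        have b1: "\<bar>?b i j - ?bG i j\<bar> \<le> e1 * (norm \<delta>)\<^sup>2 + N * norm \<delta> ^ 3" for i j
          using regular_cross_remainder[OF reg \<delta>1, of i j] by (simp add: N_def)
        have b2: "\<bar>?b i j\<bar> \<le> k * K * s + (1 + N) * s" for i j
        proof -
          have "\<bar>?bG i j\<bar> \<le> k * K * (norm \<delta> / sqrt (real n))"
            using regular_linear_term[OF reg elim, of i \<delta> j] by (simp add: k_def)
          also have "\<dots> \<le> k * K * s" using nn K(1) by (intro mult_left_mono) (auto simp: s_def)
          finally have 1: "\<bar>?bG i j\<bar> \<le> k * K * s" .
          have "e1 * (norm \<delta>)\<^sup>2 + N * norm \<delta> ^ 3 \<le> 1 * (norm \<delta>)\<^sup>2 + N * (norm \<delta>)\<^sup>2"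
            using e1(2) nn d3le by (intro add_mono mult_mono) auto
          also have "\<dots> = (1 + N) * (norm \<delta>)\<^sup>2" by (simp add: algebra_simps)
          also have "\<dots> \<le> (1 + N) * s" using nn s0(1) by (intro mult_left_mono) (auto simp: s_def)
          finally show ?thesis using 1 b1[of i j] by linarith
        qed
        have q1: "\<bar>?q i j\<bar> \<le> N2 * s" for i j
        proof -
          have "\<bar>?q i j\<bar> \<le> N2 * (norm \<delta>)\<^sup>2"
            using regular_design_bound[OF reg \<delta>1, of i j] by (simp add: N2_def)
          also have "\<dots> \<le> N2 * s" using nn s0(1) by (intro mult_left_mono) (auto simp: s_def)
          finally show ?thesis .
        qed
        have q2: "\<bar>?q i j - ?qG i j\<bar> \<le> (1 + k) * N2 * norm \<delta> ^ 3" for i j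
          using regular_design_remainder[OF reg \<delta>1, of i j] by (simp add: N2_def k_def mult.assoc)
        have AB: "norm (A - B) \<le> L * s"
        proof -
          have "norm (A - B) \<le> (\<Sum>i\<in>UNIV. \<Sum>j\<in>UNIV. \<bar>(A - B) $ i $ j\<bar>)" by (rule norm_matrix_le_sum_entries)
          also have "\<dots> \<le> (\<Sum>i\<in>(UNIV::'d set). \<Sum>j\<in>(UNIV::'d set). N2 * s + 2 * (k * K * s + (1 + N) * s))"
          proof (intro sum_mono)
            fix i j
            show "\<bar>(A - B) $ i $ j\<bar> \<le> N2 * s + 2 * (k * K * s + (1 + N) * s)"
            proof -
              have tri: "\<bar>q - b - b'\<bar> \<le> a + 2 * c" if "\<bar>q\<bar> \<le> a" "\<bar>b\<bar> \<le> c" "\<bar>b'\<bar> \<le> c" for q b b' a c :: real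
                using that by linarith
              show ?thesis unfolding A_def B_def emp_cov_increment by (rule tri[OF q1 b2 b2])
            qed
          qed
          also have "\<dots> = L * s" by (simp add: L_def d2_def algebra_simps)
          finally show ?thesis .
        qed
        have BG: "norm (B - \<Gamma>) \<le> d / 2" using reg unfolding regular_def B_def by blast
        have "norm (A - B) < d / 2"
        proof -
          have "L * s \<le> L * (2 * norm \<delta>)" using \<open>L \<ge> 0\<close> dn d2le by (intro mult_left_mono) (auto simp: s_def)
          also have "\<dots> \<le> (L + 1) * (2 * \<eta>)" using \<open>L \<ge> 0\<close> le by (intro mult_mono) auto
          also have "\<dots> \<le> (L + 1) * (2 * (d / (8 * (L + 1))))" using \<open>L \<ge> 0\<close> eta_le(2) by (intro mult_left_mono) auto
          also have "\<dots> = d / 4" using \<open>L \<ge> 0\<close> by (simp add: field_simps)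
          finally show ?thesis using AB d(1) by linarith
        qed
        then have "norm (A - \<Gamma>) < d" using BG norm_triangle_ineq[of "A - B" "B - \<Gamma>"] by simp
        moreover have "norm (B - \<Gamma>) < d" using BG d(1) by linarith
        ultimately have pos: "0 < det A"
          and ex: "\<bar>det A - det B - det \<Gamma> * trace (P ** (A - B))\<bar> \<le> e2 * norm (A - B)"
          using d(2) by blast+
        have E1: "\<bar>(det A - det B) / det \<Gamma> - trace (P ** (A - B))\<bar> \<le> \<rho> / 3 * s"
        proof -
          have "(det A - det B) / det \<Gamma> - trace (P ** (A - B)) = (det A - det B - det \<Gamma> * trace (P ** (A - B))) / det \<Gamma>"
            using dG by (simp add: field_simps)
          then have "\<bar>(det A - det B) / det \<Gamma> - trace (P ** (A - B))\<bar> = \<bar>det A - det B - det \<Gamma> * trace (P ** (A - B))\<bar> / det \<Gamma>"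
            using dG by (simp add: abs_divide)
          also have "\<dots> \<le> e2 * (L * s) / det \<Gamma>"
            using ex AB \<open>e2 > 0\<close> dG by (intro divide_right_mono order_trans[OF ex] mult_left_mono) auto
          also have "\<dots> \<le> e2 * ((L + 1) * s) / det \<Gamma>"
            using \<open>e2 > 0\<close> dG s0(2) by (intro divide_right_mono mult_left_mono mult_right_mono) auto
          also have "\<dots> = \<rho> / 3 * s"
          proof -
            have "\<rho> * r / (3 * c) * (c * s) / r = \<rho> / 3 * s" if "r \<noteq> 0" "c \<noteq> 0" for r c :: real
              using that by simp
            from this[of "det \<Gamma>" "L + 1"] show ?thesis using dG \<open>L \<ge> 0\<close> by (simp add: e2_def)
          qed
          finally show ?thesis .
        qed
        have tr: "trace (P ** (A - B)) = (\<Sum>i\<in>UNIV. \<Sum>j\<in>UNIV. P $ i $ j * ?q i j) - 2 * (\<Sum>i\<in>UNIV. \<Sum>j\<in>UNIV. P $ i $ j * ?b i j)"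
          unfolding A_def B_def by (rule trace_increment)
        have sc: "2 * (score n \<omega> \<bullet> \<delta>) / sqrt (real n) = 2 * (\<Sum>i\<in>UNIV. \<Sum>j\<in>UNIV. P $ i $ j * ?bG i j)"
          unfolding score_inner using elim by simp
        have T1: "\<bar>(\<Sum>i\<in>UNIV. \<Sum>j\<in>UNIV. P $ i $ j * ?b i j) - (\<Sum>i\<in>UNIV. \<Sum>j\<in>UNIV. P $ i $ j * ?bG i j)\<bar>
           \<le> pnorm * (e1 * (norm \<delta>)\<^sup>2 + N * norm \<delta> ^ 3)"
          using P_weighted_bound[OF b1] by (simp add: right_diff_distrib sum_subtractf)
        have T2: "\<bar>(\<Sum>i\<in>UNIV. \<Sum>j\<in>UNIV. P $ i $ j * ?q i j) - (\<Sum>i\<in>UNIV. \<Sum>j\<in>UNIV. P $ i $ j * ?qG i j)\<bar>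
           \<le> pnorm * ((1 + k) * N2 * norm \<delta> ^ 3)"
          using P_weighted_bound[OF q2] by (simp add: right_diff_distrib sum_subtractf)
        have T3: "\<bar>(\<Sum>i\<in>UNIV. \<Sum>j\<in>UNIV. P $ i $ j * ?qG i j) - \<delta> \<bullet> (information *v \<delta>)\<bar> \<le> k\<^sup>2 * e1 * (norm \<delta>)\<^sup>2"
          using regular_quadratic_term[OF reg] by (simp add: k_def)
        have "\<bar>trace (P ** (A - B)) + 2 * (score n \<omega> \<bullet> \<delta>) / sqrt (real n) - \<delta> \<bullet> (information *v \<delta>)\<bar>
          \<le> 2 * (pnorm * (e1 * (norm \<delta>)\<^sup>2 + N * norm \<delta> ^ 3)) + pnorm * ((1 + k) * N2 * norm \<delta> ^ 3) + k\<^sup>2 * e1 * (norm \<delta>)\<^sup>2"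
          unfolding tr sc using T1 T2 T3 by linarith
        also have "\<dots> = (2 * pnorm + k\<^sup>2) * e1 * (norm \<delta>)\<^sup>2 + c * norm \<delta> ^ 3"
          by (simp add: c_def algebra_simps)
        also have "\<dots> \<le> \<rho> / 3 * (norm \<delta>)\<^sup>2 + \<rho> / 3 * (norm \<delta>)\<^sup>2"
        proof (intro add_mono mult_right_mono e1(3))
          have "c * norm \<delta> ^ 3 \<le> c * (\<eta> * (norm \<delta>)\<^sup>2)" using \<open>c \<ge> 0\<close> d3le(2) by (intro mult_left_mono)
          also have "\<dots> \<le> (c + 1) * (\<rho> / (3 * (c + 1)) * (norm \<delta>)\<^sup>2)"
            using \<open>c \<ge> 0\<close> eta_le(3) eta by (intro mult_mono mult_right_mono) auto
          also have "\<dots> = \<rho> / 3 * (norm \<delta>)\<^sup>2"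
          proof -
            have "r * (\<rho> / (3 * r) * t) = \<rho> / 3 * t" if "r \<noteq> 0" for r t :: real
              using that by simp
            from this[of "c + 1"] show ?thesis using \<open>c \<ge> 0\<close> by simp
          qed
          finally show "c * norm \<delta> ^ 3 \<le> \<rho> / 3 * (norm \<delta>)\<^sup>2" .
        qed simp
        also have "\<dots> \<le> \<rho> / 3 * s + \<rho> / 3 * s"
          using \<open>\<rho> > 0\<close> s0(1) by (intro add_mono mult_left_mono) (auto simp: s_def)
        finally have "\<bar>trace (P ** (A - B)) + 2 * (score n \<omega> \<bullet> \<delta>) / sqrt (real n) - \<delta> \<bullet> (information *v \<delta>)\<bar> \<le> \<rho> / 3 * s + \<rho> / 3 * s" .
        moreover have "\<rho> / 3 * s + \<rho> / 3 * s + \<rho> / 3 * s = \<rho> * s" by simp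
        ultimately have "\<bar>(det A - det B) / det \<Gamma> + 2 * (score n \<omega> \<bullet> \<delta>) / sqrt (real n) - \<delta> \<bullet> (information *v \<delta>)\<bar> \<le> \<rho> * s"
          using E1 by linarith
        then show "0 < det (emp_cov n (D \<delta>) \<omega>) \<and>
          \<bar>(det (emp_cov n (D \<delta>) \<omega>) - det (emp_cov n (\<lambda>_. 0) \<omega>)) / det \<Gamma>
           + 2 * (score n \<omega> \<bullet> \<delta>) / sqrt (real n) - \<delta> \<bullet> (information *v \<delta>)\<bar>
            \<le> \<rho> * (norm \<delta> / sqrt (real n) + (norm \<delta>)\<^sup>2)"
          using pos by (simp only: A_def B_def s_def)
      qed
    qed
  qed simp
  with eta show ?thesis by (rule that)
qed

end

section \<open>Asymptotic normality of the minimiser\<close>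

text \<open>In the coordinates v = B y the form is |y|^2, and the operator bound of \<open>B\<close>
  gives |v| \<le> K |y|.\<close>

lemma positive_definite_lower_bound:
  fixes A :: "real ^ 'n ^ 'n"
  assumes "positive_definite A"
  obtains c where "c > 0" "\<And>v. c * (norm v)\<^sup>2 \<le> v \<bullet> (A *v v)"
proof -
  obtain B :: "real ^ 'n ^ 'n" where B: "transpose B ** A ** B = mat 1"
    by (rule positive_definite_factorization[OF assms])
  have BB: "B ** (transpose B ** A) = mat 1" by (rule matrix_left_right_inverse1[OF B])
  obtain K where K: "K > 0" "\<And>y. norm (B *v y) \<le> norm y * K"
    using bounded_linear.pos_bounded[OF matrix_vector_mul_bounded_linear[of B]] by blast
  show ?thesis
  proof (rule that[of "1 / K\<^sup>2"])
    fix v :: "real ^ 'n"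
    define y where "y = (transpose B ** A) *v v"
    have v: "v = B *v y" unfolding y_def matrix_vector_mul_assoc BB by simp
    have "v \<bullet> (A *v v) = y \<bullet> ((transpose B ** A ** B) *v y)"
      unfolding v by (simp add: inner_matrix_vector_mult_left flip: matrix_vector_mul_assoc)
    then have eq: "v \<bullet> (A *v v) = (norm y)\<^sup>2" by (simp add: B power2_norm_eq_inner)
    have "(norm v)\<^sup>2 \<le> (norm y * K)\<^sup>2" using K(2)[of y] v by (intro power_mono) auto
    then show "1 / K\<^sup>2 * (norm v)\<^sup>2 \<le> v \<bullet> (A *v v)"
      using K(1) by (simp add: eq power_mult_distrib divide_le_eq)
  qed (use K(1) in simp)
qed

lemma abs_cos_diff_le: "\<bar>cos a - cos b\<bar> \<le> \<bar>a - b\<bar>" for a b :: real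
proof -
  have "\<bar>cos a - cos b\<bar> = 2 * (\<bar>sin ((a + b) / 2)\<bar> * \<bar>sin ((b - a) / 2)\<bar>)"
    unfolding cos_diff_cos by (simp add: abs_mult)
  also have "\<dots> \<le> 2 * (1 * \<bar>(b - a) / 2\<bar>)"
    by (intro mult_left_mono mult_mono abs_sin_le_one abs_sin_x_le_abs_x) auto
  finally show ?thesis by simp
qed

text \<open>The cosine is bounded and 1-Lipschitz, so closeness in probability transfers to its
  expectations.\<close>

lemma (in prob_space) slutsky_cos:
  fixes X Y :: "nat \<Rightarrow> 'a \<Rightarrow> real"
  assumes [measurable]: "\<And>n. X n \<in> borel_measurable M" "\<And>n. Y n \<in> borel_measurable M"
    and close: "\<And>e. e > 0 \<Longrightarrow> asymptotically_certain (\<lambda>n \<omega>. \<bar>X n \<omega> - Y n \<omega>\<bar> \<le> e)"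
    and lim: "(\<lambda>n. LINT \<omega>|M. cos (Y n \<omega> + b)) \<longlonglongrightarrow> l"
  shows "(\<lambda>n. LINT \<omega>|M. cos (X n \<omega> + b)) \<longlonglongrightarrow> l"
proof -
  have "(\<lambda>n. (LINT \<omega>|M. cos (X n \<omega> + b)) - (LINT \<omega>|M. cos (Y n \<omega> + b))) \<longlonglongrightarrow> 0"
  proof (rule LIMSEQ_I)
    fix r :: real assume "r > 0"
    \<comment> \<open>Off the exceptional set the cosines differ by at most r / 4; on it by at most
      2, contributing 2 * (r / 8). The total is r / 2.\<close>
    then have "likely (r / 8) (\<lambda>n \<omega>. \<bar>X n \<omega> - Y n \<omega>\<bar> \<le> r / 4)"
      using close[of "r / 4"] by (simp add: asymptotically_certain_def)
    then have "\<forall>\<^sub>F n in sequentially. norm ((LINT \<omega>|M. cos (X n \<omega> + b)) - (LINT \<omega>|M. cos (Y n \<omega> + b)) - 0) < r"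
      unfolding likely_def
    proof eventually_elim
      case (elim n)
      then obtain A where A: "A \<in> events" "prob A \<le> r / 8" "\<And>\<omega>. \<omega> \<in> space M - A \<Longrightarrow> \<bar>X n \<omega> - Y n \<omega>\<bar> \<le> r / 4" by blast
      note [measurable] = A(1)
      have int: "integrable M (\<lambda>\<omega>. cos (X n \<omega> + b))" "integrable M (\<lambda>\<omega>. cos (Y n \<omega> + b))"
        by (auto intro!: integrable_const_bound[of _ 1])
      have "\<bar>(LINT \<omega>|M. cos (X n \<omega> + b)) - (LINT \<omega>|M. cos (Y n \<omega> + b))\<bar> = \<bar>LINT \<omega>|M. cos (X n \<omega> + b) - cos (Y n \<omega> + b)\<bar>"
        using int by simp
      also have "\<dots> \<le> (LINT \<omega>|M. \<bar>cos (X n \<omega> + b) - cos (Y n \<omega> + b)\<bar>)" by (rule integral_abs_bound)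
      also have "\<dots> \<le> (LINT \<omega>|M. r / 4 + 2 * indicator A \<omega>)"
      proof (intro integral_mono)
        show "integrable M (\<lambda>\<omega>. r / 4 + 2 * indicator A \<omega>)"
          by (intro Bochner_Integration.integrable_add integrable_mult_right integrable_const integrable_real_indicator)
             (auto simp: emeasure_eq_measure)
        fix \<omega> assume \<omega>: "\<omega> \<in> space M"
        show "\<bar>cos (X n \<omega> + b) - cos (Y n \<omega> + b)\<bar> \<le> r / 4 + 2 * indicator A \<omega>"
        proof (cases "\<omega> \<in> A")
          case True
          have "\<bar>cos (X n \<omega> + b) - cos (Y n \<omega> + b)\<bar> \<le> 2"
            using abs_cos_le_one[of "X n \<omega> + b"] abs_cos_le_one[of "Y n \<omega> + b"] by linarith
          then show ?thesis using True \<open>r > 0\<close> by simp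
        next
          case False
          then show ?thesis
            using abs_cos_diff_le[of "X n \<omega> + b" "Y n \<omega> + b"] A(3)[of \<omega>] \<omega> by simp
        qed
      qed (use int in auto)
      also have "\<dots> = r / 4 + 2 * prob A"
        using prob_space by (subst Bochner_Integration.integral_add) (auto simp: emeasure_eq_measure)
      also have "\<dots> \<le> r / 2" using A(2) by linarith
      also have "\<dots> < r" using \<open>r > 0\<close> by simp
      finally show ?case by simp
    qed
    then show "\<exists>N. \<forall>n\<ge>N. norm ((LINT \<omega>|M. cos (X n \<omega> + b)) - (LINT \<omega>|M. cos (Y n \<omega> + b)) - 0) < r"
      by (simp add: eventually_sequentially)
  qed
  from tendsto_add[OF this lim] show ?thesis by simp
qed

section \<open>The score as an empirical mean, and the limit of the minimiser\<close>

context smooth_regression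
begin

text \<open>The summand of the score in direction \<open>v\<close>; as a scalar function of one
  observation it is accessible to the one-dimensional central limit theorem.\<close>

definition influence :: "real ^ 'k \<Rightarrow> (real ^ 'd) \<times> 'z \<Rightarrow> real" where
  "influence v y = fst y \<bullet> (P *v G v (snd y))"

lemma P_G_measurable [measurable]: "(\<lambda>z. (P *v G v z) $ i) \<in> borel_measurable borel"
  unfolding matrix_vector_mult_def by simp

lemma influence_measurable [measurable]: "influence v \<in> borel_measurable borel"
  unfolding influence_def inner_matrix_vector_sum by measurable

lemma score_influence: "score n \<omega> \<bullet> v = sqrt (real n) * emp n (influence v) \<omega>"
  unfolding score_inner by (simp add: influence_def[abs_def] inner_matrix_vector_sum emp_sum emp_cmult)

lemma P_G_bound: "\<bar>(P *v G v z) $ i\<bar> \<le> pnorm * (real CARD('k) * C * w z * norm v)"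
proof -
  have "\<bar>(P *v G v z) $ i\<bar> \<le> (\<Sum>j\<in>UNIV. \<bar>P $ i $ j\<bar>) * (real CARD('k) * C * w z * norm v)"
    unfolding matrix_vector_mult_def by (simp, rule sum_weighted_bound, rule G_nth_bound)
  also have "\<dots> \<le> pnorm * (real CARD('k) * C * w z * norm v)"
  proof (rule mult_right_mono)
    show "(\<Sum>j\<in>UNIV. \<bar>P $ i $ j\<bar>) \<le> pnorm"
      unfolding pnorm_def by (rule member_le_sum[of i UNIV "\<lambda>i. \<Sum>j\<in>UNIV. \<bar>P $ i $ j\<bar>"]) (auto intro: sum_nonneg)
  qed (use C_nonneg w_nonneg in simp)
  finally show ?thesis .
qed

text \<open>The noise enters the variance through \<Gamma>, which cancels one of the two factors
  \<open>P\<close>: the conditional variance given Z is G \<bullet> \<Gamma>^-1 G, with expectation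
  the information form. Score covariance and curvature therefore coincide.\<close>

lemma influence_moments:
  shows "integ (\<lambda>y. (influence v y)\<^sup>2)" "expect (influence v) = 0"
    "expect (\<lambda>y. (influence v y)\<^sup>2) = v \<bullet> (information *v v)"
proof -
  let ?q = "\<lambda>z i. (P *v G v z) $ i"
  define c where "c = pnorm * (real CARD('k) * C * norm v)"
  have "c \<ge> 0" using pnorm_nonneg C_nonneg by (simp add: c_def)
  have b1: "\<bar>?q z i\<bar> \<le> c * w z" for z i
    using P_G_bound[of v z i] by (simp add: c_def mult_ac)
  have b1': "\<bar>?q z i\<bar> \<le> c * w z ^ 3" for z i
    using b1[of z i] mult_left_mono[OF w_power_le(1) \<open>c \<ge> 0\<close>, of z] by linarith
  have b2: "\<bar>?q z i * ?q z j\<bar> \<le> c\<^sup>2 * w z ^ 3" for z i j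
  proof -
    have "\<bar>?q z i * ?q z j\<bar> \<le> (c * w z) * (c * w z)"
      unfolding abs_mult using \<open>c \<ge> 0\<close> w_nonneg by (intro mult_mono b1) auto
    also have "\<dots> = c\<^sup>2 * (w z)\<^sup>2" by (simp add: power2_eq_square)
    also have "\<dots> \<le> c\<^sup>2 * w z ^ 3" by (intro mult_left_mono w_power_le) auto
    finally show ?thesis .
  qed
  have m2: "(\<lambda>z. ?q z i * ?q z j) \<in> borel_measurable borel" for i j by measurable
  have f1: "influence v = (\<lambda>y. \<Sum>i\<in>UNIV. fst y $ i * ?q (snd y) i)"
    by (simp add: fun_eq_iff influence_def inner_vec_def)
  have f2: "(\<lambda>y. (influence v y)\<^sup>2) = (\<lambda>y. \<Sum>i\<in>UNIV. \<Sum>j\<in>UNIV. (fst y $ i * fst y $ j) * (?q (snd y) i * ?q (snd y) j))"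
    unfolding f1 by (simp add: fun_eq_iff power2_eq_square sum_product mult_ac)
  note p = noise_design_product(4,5)[OF m2 b2]
  show "integ (\<lambda>y. (influence v y)\<^sup>2)" unfolding f2 by (intro integ_sum p(1))
  note p1 = noise_design_product(1,2)[OF P_G_measurable b1']
  show "expect (influence v) = 0" unfolding f1 by (subst expect_sum) (simp_all add: p1)
  have "expect (\<lambda>y. (influence v y)\<^sup>2) = (\<Sum>i\<in>UNIV. \<Sum>j\<in>UNIV. \<Gamma> $ i $ j * expect (\<lambda>y. ?q (snd y) i * ?q (snd y) j))"
    unfolding f2 by (simp add: expect_sum integ_sum p)
  also have "\<dots> = expect (\<lambda>y. \<Sum>i\<in>UNIV. \<Sum>j\<in>UNIV. \<Gamma> $ i $ j * (?q (snd y) i * ?q (snd y) j))"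
    by (simp add: expect_sum integ_sum integ_cmult expect_cmult integ_design[OF m2 b2])
  also have "(\<lambda>y :: (real ^ 'd) \<times> 'z. \<Sum>i\<in>UNIV. \<Sum>j\<in>UNIV. \<Gamma> $ i $ j * (?q (snd y) i * ?q (snd y) j)) =
      (\<lambda>y. \<Sum>k\<in>UNIV. \<Sum>l\<in>UNIV. (v $ k * v $ l) * (g k (snd y) \<bullet> (P *v g l (snd y))))"
  proof
    fix y :: "(real ^ 'd) \<times> 'z"
    have "\<Gamma> ** P = mat 1"
    proof -
      obtain B where B: "\<Gamma> ** B = mat 1"
        using positive_definite_imp_invertible[OF cov_pd] by (auto simp: invertible_def)
      then show ?thesis using matrix_inverse_unique[OF B] by simp
    qed
    then have "\<Gamma> *v (P *v G v (snd y)) = G v (snd y)" by (simp add: matrix_vector_mul_assoc)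
    then have "(\<Sum>i\<in>UNIV. \<Sum>j\<in>UNIV. \<Gamma> $ i $ j * (?q (snd y) i * ?q (snd y) j)) = (P *v G v (snd y)) \<bullet> G v (snd y)"
      by (simp add: inner_matrix_vector_sum[symmetric])
    also have "\<dots> = G v (snd y) \<bullet> (P *v G v (snd y))" by (rule inner_commute)
    finally show "(\<Sum>i\<in>UNIV. \<Sum>j\<in>UNIV. \<Gamma> $ i $ j * (?q (snd y) i * ?q (snd y) j)) =
      (\<Sum>k\<in>UNIV. \<Sum>l\<in>UNIV. (v $ k * v $ l) * (g k (snd y) \<bullet> (P *v g l (snd y))))"
      by (simp only: G_quadratic)
  qed
  also have "expect \<dots> = (\<Sum>k\<in>UNIV. \<Sum>l\<in>UNIV. (v $ k * v $ l) * expect (\<lambda>y. g k (snd y) \<bullet> (P *v g l (snd y))))"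
    by (simp add: expect_sum integ_sum integ_cmult expect_cmult information_summand)
  also have "\<dots> = v \<bullet> (information *v v)"
    by (simp add: inner_matrix_vector_sum information_def mult_ac)
  finally show "expect (\<lambda>y. (influence v y)\<^sup>2) = v \<bullet> (information *v v)" .
qed

lemma bounded_in_prob_score: "bounded_in_prob (\<lambda>n \<omega>. norm (score n \<omega>))"
proof (rule bounded_in_prob_mono)
  show "bounded_in_prob (\<lambda>n \<omega>. \<Sum>k\<in>(UNIV :: 'k set). sqrt (real n) * \<bar>emp n (influence (axis k 1)) \<omega>\<bar>)"
    by (intro bounded_in_prob_sum bounded_in_prob_emp influence_moments influence_measurable) simp
  fix n \<omega>
  have "\<bar>score n \<omega> $ k\<bar> = sqrt (real n) * \<bar>emp n (influence (axis k 1)) \<omega>\<bar>" for k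
    using score_influence[of n \<omega> "axis k 1"] by (simp add: inner_axis abs_mult)
  then show "norm (score n \<omega>) \<le> (\<Sum>k\<in>UNIV. sqrt (real n) * \<bar>emp n (influence (axis k 1)) \<omega>\<bar>)"
    using norm_le_l1_cart[of "score n \<omega>"] by simp
qed

text \<open>Adding \<open>\<xi> \<bullet> (J *v \<xi>)\<close>, \<open>J\<close> the inverse of the information, completes the square in \<open>cmp\<close>.\<close>

lemma quadratic_minimiser_close:
  fixes h hs \<xi> :: "real ^ 'k"
  assumes pd: "positive_definite information"
    and c: "c > 0" "\<And>v. c * (norm v)\<^sup>2 \<le> v \<bullet> (information *v v)"
    and hs: "information *v hs = \<xi>" "norm hs \<le> B"
    and \<rho>: "0 < \<rho>" "\<rho> \<le> c / 6" "\<rho> * (1 + 2 * B + 3 * B\<^sup>2) \<le> c * e\<^sup>2 / 2" and "e > 0"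
    and cmp: "h \<bullet> (information *v h) - 2 * (\<xi> \<bullet> h) - \<rho> * (norm h + (norm h)\<^sup>2)
      \<le> hs \<bullet> (information *v hs) - 2 * (\<xi> \<bullet> hs) + \<rho> * (norm hs + (norm hs)\<^sup>2)"
  shows "norm (h - hs) \<le> e"
proof -
  define v where "v = h - hs"
  have sym: "x \<bullet> (information *v y) = y \<bullet> (information *v x)" for x y
    using pd by (intro inner_matrix_vector_mult_commute) (simp add: positive_definite_def)
  have h: "h = v + hs" by (simp add: v_def)
  \<comment> \<open>Expanding around \<open>hs\<close>, the terms linear in \<open>v\<close> cancel
    because \<open>hs\<close> solves the linear system.\<close>
  have quad: "h \<bullet> (information *v h) - 2 * (\<xi> \<bullet> h) = v \<bullet> (information *v v) + (hs \<bullet> (information *v hs) - 2 * (\<xi> \<bullet> hs))"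
    unfolding h using sym[of hs v] hs(1)
    by (simp add: matrix_vector_right_distrib inner_add_left inner_add_right inner_commute)
  have "B \<ge> 0" using hs(2) norm_ge_zero[of hs] by linarith
  have nh: "norm h \<le> norm v + B" using norm_triangle_ineq[of v hs] hs(2) unfolding h by linarith
  have nh2: "(norm h)\<^sup>2 \<le> 2 * (norm v)\<^sup>2 + 2 * B\<^sup>2"
  proof -
    have "(norm h)\<^sup>2 \<le> (norm v + B)\<^sup>2" using nh by (intro power_mono) auto
    moreover have "0 \<le> (norm v - B)\<^sup>2" by simp
    ultimately show ?thesis by (simp add: power2_sum power2_diff)
  qed
  have nhs2: "(norm hs)\<^sup>2 \<le> B\<^sup>2" using hs(2) by (intro power_mono) auto
  have nv: "norm v \<le> 1 + (norm v)\<^sup>2" by (rule norm_le_1_plus_square)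
  have "c * (norm v)\<^sup>2 \<le> \<rho> * (norm h + (norm h)\<^sup>2) + \<rho> * (norm hs + (norm hs)\<^sup>2)"
    using c(2)[of v] cmp unfolding quad by linarith
  also have "\<dots> = \<rho> * (norm h + (norm h)\<^sup>2 + norm hs + (norm hs)\<^sup>2)" by (simp add: algebra_simps)
  \<comment> \<open>Uses |h| \<le> 1 + |v|^2 + B and |h|^2 \<le> 2 |v|^2 + 2 B^2, besides B + B^2
    for \<open>hs\<close>. The factor 3 is why \<rho> \<le> c / 6: half of the form absorbs the
    |v|^2 part.\<close>
  also have "\<dots> \<le> \<rho> * (3 * (norm v)\<^sup>2 + (1 + 2 * B + 3 * B\<^sup>2))"
    using \<rho>(1) nh nh2 nhs2 nv hs(2) by (intro mult_left_mono) auto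
  also have "\<dots> = 3 * \<rho> * (norm v)\<^sup>2 + \<rho> * (1 + 2 * B + 3 * B\<^sup>2)" by (simp add: algebra_simps)
  also have "\<dots> \<le> c / 2 * (norm v)\<^sup>2 + c * e\<^sup>2 / 2"
    using \<rho> by (intro add_mono mult_right_mono) auto
  finally have "c * (norm v)\<^sup>2 \<le> c * e\<^sup>2" by simp
  then have "(norm v)\<^sup>2 \<le> e\<^sup>2" using c(1) by simp
  then show ?thesis using \<open>e > 0\<close> by (simp add: v_def power2_le_iff_abs_le abs_le_square_iff[symmetric] flip: power2_eq_square)
qed

text \<open>The minimiser is compared with an explicit competitor, the minimiser of the quadratic
  approximation. Both lie where the expansion is valid, one by consistency, the other because the
  score is tight; definiteness then forces them together at scale 1 / sqrt n.\<close>

theorem asymptotic_linearity: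
  fixes d :: "nat \<Rightarrow> 'w \<Rightarrow> real ^ 'k"
  assumes pd: "positive_definite information"
    and consistent: "\<And>\<eta>. \<eta> > 0 \<Longrightarrow> asymptotically_certain (\<lambda>n \<omega>. norm (d n \<omega>) \<le> \<eta>)"
    and "r > 0"
    and minimal: "\<And>n \<omega> \<delta>. \<omega> \<in> space M \<Longrightarrow> n > 0 \<Longrightarrow> norm \<delta> \<le> r \<Longrightarrow> 0 < det (emp_cov n (D \<delta>) \<omega>) \<Longrightarrow>
      det (emp_cov n (D (d n \<omega>)) \<omega>) \<le> det (emp_cov n (D \<delta>) \<omega>)"
    and "e > 0"
  shows "asymptotically_certain (\<lambda>n \<omega>. norm (sqrt (real n) *\<^sub>R d n \<omega> - matrix_inv information *v score n \<omega>) \<le> e)"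
  unfolding asymptotically_certain_def
proof (intro allI impI)
  fix \<kappa> :: real assume "\<kappa> > 0"
  define J where "J = matrix_inv information"
  have IJ: "information ** J = mat 1"
  proof -
    obtain B where B: "information ** B = mat 1"
      using positive_definite_imp_invertible[OF pd] by (auto simp: invertible_def)
    then show ?thesis using matrix_inverse_unique[OF B] by (simp add: J_def)
  qed
  obtain c where c: "c > 0" "\<And>v. c * (norm v)\<^sup>2 \<le> v \<bullet> (information *v v)"
    using positive_definite_lower_bound[OF pd] by metis
  obtain KJ where KJ: "KJ > 0" "\<And>y. norm (J *v y) \<le> norm y * KJ"
    using bounded_linear.pos_bounded[OF matrix_vector_mul_bounded_linear[of J]] by blast
  have \<kappa>3: "\<kappa> / 3 > 0" using \<open>\<kappa> > 0\<close> by simp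
  obtain Ks where Ks: "Ks > 0" "likely (\<kappa> / 3) (\<lambda>n \<omega>. norm (score n \<omega>) \<le> Ks)"
    using bounded_in_prob_score \<kappa>3 unfolding bounded_in_prob_def by blast
  \<comment> \<open>A bound for the rescaled competitor on the event where the score is bounded by
    \<open>Ks\<close>; \<rho> is chosen from it before the radius \<eta>.\<close>
  define B where "B = Ks * KJ"
  have "B > 0" using Ks(1) KJ(1) by (simp add: B_def)
  have den: "1 + 2 * B + 3 * B\<^sup>2 > 0" using \<open>B > 0\<close> by (intro add_pos_pos) auto
  define \<rho> where "\<rho> = min (c / 6) (c * e\<^sup>2 / 2 / (1 + 2 * B + 3 * B\<^sup>2))"
  have \<rho>: "0 < \<rho>" "\<rho> \<le> c / 6" "\<rho> * (1 + 2 * B + 3 * B\<^sup>2) \<le> c * e\<^sup>2 / 2"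
  proof -
    show "0 < \<rho>" using c(1) \<open>e > 0\<close> den by (auto simp: \<rho>_def)
    show "\<rho> \<le> c / 6" unfolding \<rho>_def by (rule min.cobounded1)
    have "\<rho> \<le> c * e\<^sup>2 / 2 / (1 + 2 * B + 3 * B\<^sup>2)" by (simp add: \<rho>_def)
    then show "\<rho> * (1 + 2 * B + 3 * B\<^sup>2) \<le> c * e\<^sup>2 / 2" unfolding pos_le_divide_eq[OF den] .
  qed
  obtain \<eta> where \<eta>: "0 < \<eta>" and exp: "likely (\<kappa> / 3) (quadratic_expansion \<rho> \<eta>)"
    by (rule local_expansion[OF \<rho>(1) \<kappa>3])
  have cons: "likely (\<kappa> / 3) (\<lambda>n \<omega>. norm (d n \<omega>) \<le> \<eta>)"
    using consistent[OF \<eta>] \<kappa>3 by (simp add: asymptotically_certain_def)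
  have "(\<lambda>n. B / sqrt (real n)) \<longlonglongrightarrow> 0" by real_asymp
  then have small: "\<forall>\<^sub>F n in sequentially. B / sqrt (real n) < min \<eta> r"
    using \<eta> \<open>r > 0\<close> by (intro order_tendstoD) auto
  have dG: "det \<Gamma> > 0" by (rule positive_definite_det_pos[OF cov_pd])
  show "likely \<kappa> (\<lambda>n \<omega>. norm (sqrt (real n) *\<^sub>R d n \<omega> - matrix_inv information *v score n \<omega>) \<le> e)"
    unfolding J_def[symmetric]
  proof (rule likely_mono[OF likely_conj[OF Ks(2) likely_conj[OF exp cons]]])
    show "\<forall>\<^sub>F n in sequentially. \<forall>\<omega>\<in>space M. norm (score n \<omega>) \<le> Ks \<and> quadratic_expansion \<rho> \<eta> n \<omega> \<and> norm (d n \<omega>) \<le> \<eta> \<longrightarrow>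
      norm (sqrt (real n) *\<^sub>R d n \<omega> - J *v score n \<omega>) \<le> e"
      using small eventually_gt_at_top[of 0]
    proof eventually_elim
      case (elim n)
      show ?case
      proof (intro ballI impI, elim conjE)
        fix \<omega> assume \<omega>: "\<omega> \<in> space M" and s: "norm (score n \<omega>) \<le> Ks" and dle: "norm (d n \<omega>) \<le> \<eta>"
          and "quadratic_expansion \<rho> \<eta> n \<omega>"
        note ex = this(4)[unfolded quadratic_expansion_def]
        define q where "q = sqrt (real n)"
        have q: "q > 0" using elim(2) by (simp add: q_def)
        define hs where "hs = J *v score n \<omega>"
        have hsB: "norm hs \<le> B"
          unfolding hs_def B_def using KJ(1) by (intro order_trans[OF KJ(2) mult_right_mono[OF s]]) simp
        \<comment> \<open>The competitor on the original scale. It has norm at most B / sqrt n, so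
          for large n it is inside both the expansion ball and the ball of admissible
          displacements.\<close>
        define \<delta>s where "\<delta>s = (1 / q) *\<^sub>R hs"
        have "norm \<delta>s \<le> B / q" using hsB q by (simp add: \<delta>s_def divide_right_mono)
        then have \<delta>s: "norm \<delta>s \<le> \<eta>" "norm \<delta>s \<le> r" using elim(1) by (auto simp: q_def)
        define \<Phi> where "\<Phi> \<delta> = (det (emp_cov n (D \<delta>) \<omega>) - det (emp_cov n (\<lambda>_. 0) \<omega>)) / det \<Gamma>" for \<delta>
        have "\<Phi> (d n \<omega>) \<le> \<Phi> \<delta>s"
          unfolding \<Phi>_def using minimal[OF \<omega> elim(2) \<delta>s(2)] ex \<delta>s(1) dG by (intro divide_right_mono) auto
        \<comment> \<open>Multiplication by q^2 = n turns the error |\<delta>| / sqrt n +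
          |\<delta>|^2 into |h| + |h|^2.\<close>
        have key: "\<bar>q\<^sup>2 * \<Phi> \<delta> - (h \<bullet> (information *v h) - 2 * (score n \<omega> \<bullet> h))\<bar> \<le> \<rho> * (norm h + (norm h)\<^sup>2)"
          if \<delta>: "norm \<delta> \<le> \<eta>" and h: "h = q *\<^sub>R \<delta>" for \<delta> h
        proof -
          have "\<bar>\<Phi> \<delta> + 2 * (score n \<omega> \<bullet> \<delta>) / q - \<delta> \<bullet> (information *v \<delta>)\<bar> \<le> \<rho> * (norm \<delta> / q + (norm \<delta>)\<^sup>2)"
            using ex \<delta> unfolding \<Phi>_def q_def by blast
          then have "q\<^sup>2 * \<bar>\<Phi> \<delta> + 2 * (score n \<omega> \<bullet> \<delta>) / q - \<delta> \<bullet> (information *v \<delta>)\<bar> \<le> q\<^sup>2 * (\<rho> * (norm \<delta> / q + (norm \<delta>)\<^sup>2))"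
            by (rule mult_left_mono) simp
          also have "q\<^sup>2 * (\<rho> * (norm \<delta> / q + (norm \<delta>)\<^sup>2)) = \<rho> * (norm h + (norm h)\<^sup>2)"
            using q by (simp add: h power2_eq_square field_simps)
          also have "q\<^sup>2 * \<bar>\<Phi> \<delta> + 2 * (score n \<omega> \<bullet> \<delta>) / q - \<delta> \<bullet> (information *v \<delta>)\<bar> =
             \<bar>q\<^sup>2 * (\<Phi> \<delta> + 2 * (score n \<omega> \<bullet> \<delta>) / q - \<delta> \<bullet> (information *v \<delta>))\<bar>"
            by (simp add: abs_mult)
          also have "q\<^sup>2 * (\<Phi> \<delta> + 2 * (score n \<omega> \<bullet> \<delta>) / q - \<delta> \<bullet> (information *v \<delta>)) =
            q\<^sup>2 * \<Phi> \<delta> - (h \<bullet> (information *v h) - 2 * (score n \<omega> \<bullet> h))"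
            using q by (simp add: h matrix_vector_mult_scaleR power2_eq_square algebra_simps)
          finally show ?thesis .
        qed
        have hs\<delta>: "hs = q *\<^sub>R \<delta>s" using q by (simp add: \<delta>s_def)
        have "q\<^sup>2 * \<Phi> (d n \<omega>) \<le> q\<^sup>2 * \<Phi> \<delta>s"
          using \<open>\<Phi> (d n \<omega>) \<le> \<Phi> \<delta>s\<close> by (rule mult_left_mono) simp
        then have cmp: "(q *\<^sub>R d n \<omega>) \<bullet> (information *v (q *\<^sub>R d n \<omega>)) - 2 * (score n \<omega> \<bullet> (q *\<^sub>R d n \<omega>)) - \<rho> * (norm (q *\<^sub>R d n \<omega>) + (norm (q *\<^sub>R d n \<omega>))\<^sup>2)
          \<le> hs \<bullet> (information *v hs) - 2 * (score n \<omega> \<bullet> hs) + \<rho> * (norm hs + (norm hs)\<^sup>2)"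
          using key[OF dle refl] key[OF \<delta>s(1) hs\<delta>] by linarith
        have "information *v hs = score n \<omega>" by (simp add: hs_def matrix_vector_mul_assoc IJ)
        from quadratic_minimiser_close[OF pd c this hsB \<rho> \<open>e > 0\<close> cmp]
        show "norm (sqrt (real n) *\<^sub>R d n \<omega> - J *v score n \<omega>) \<le> e" by (simp only: q_def hs_def)
      qed
    qed
  qed simp
qed

text \<open>Projected on \<open>u\<close>, the linear approximation of the estimator is the score in
  direction \<open>J *v u\<close>, by symmetry of \<open>J\<close>; it is a normalised empirical
  mean of a scalar.\<close>

theorem asymptotic_normality:
  fixes d :: "nat \<Rightarrow> 'w \<Rightarrow> real ^ 'k"
  assumes pd: "positive_definite information"
    and d_measurable [measurable]: "\<And>n. d n \<in> borel_measurable M"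
    and consistent: "\<And>\<eta>. \<eta> > 0 \<Longrightarrow> asymptotically_certain (\<lambda>n \<omega>. norm (d n \<omega>) \<le> \<eta>)"
    and "r > 0"
    and minimal: "\<And>n \<omega> \<delta>. \<omega> \<in> space M \<Longrightarrow> n > 0 \<Longrightarrow> norm \<delta> \<le> r \<Longrightarrow> 0 < det (emp_cov n (D \<delta>) \<omega>) \<Longrightarrow>
      det (emp_cov n (D (d n \<omega>)) \<omega>) \<le> det (emp_cov n (D \<delta>) \<omega>)"
  shows "converges_in_law M (\<lambda>n \<omega>. sqrt (real n) *\<^sub>R d n \<omega>) (multivariate_normal 0 (matrix_inv information))"
proof (rule converges_in_law_cos)
  define J where "J = matrix_inv information"
  have IJ: "information ** J = mat 1"
  proof -
    obtain B where B: "information ** B = mat 1"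
      using positive_definite_imp_invertible[OF pd] by (auto simp: invertible_def)
    then show ?thesis using matrix_inverse_unique[OF B] by (simp add: J_def)
  qed
  have Jsym: "transpose J = J"
    unfolding J_def using pd by (intro matrix_inv_symmetric positive_definite_imp_invertible) (auto simp: positive_definite_def)
  show "prob_space M" by (rule prob_space_axioms)
  show "(\<lambda>\<omega>. sqrt (real n) *\<^sub>R d n \<omega>) \<in> borel_measurable M" for n by measurable
  show "prob_space (multivariate_normal 0 (matrix_inv information))"
    by (rule multivariate_normal_inverse(1)[OF pd])
  show "sets (multivariate_normal 0 (matrix_inv information)) = sets borel"
    by (simp add: multivariate_normal_def)
  fix u :: "real ^ 'k" and b :: real
  have val: "(LINT x|multivariate_normal 0 (matrix_inv information). cos (u \<bullet> x + b)) = cos b * exp (- (u \<bullet> (J *v u)) / 2)"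
    unfolding J_def by (rule multivariate_normal_inverse(2)[OF pd])
  show "(\<lambda>n. LINT \<omega>|M. cos (u \<bullet> sqrt (real n) *\<^sub>R d n \<omega> + b)) \<longlonglongrightarrow>
    (LINT x|multivariate_normal 0 (matrix_inv information). cos (u \<bullet> x + b))"
    unfolding val
  proof (rule slutsky_cos)
    show "(\<lambda>\<omega>. u \<bullet> sqrt (real n) *\<^sub>R d n \<omega>) \<in> borel_measurable M" for n by measurable
    show "(\<lambda>\<omega>. sqrt (real n) * emp n (influence (J *v u)) \<omega>) \<in> borel_measurable M" for n by measurable
    \<comment> \<open>One of the two factors \<open>J\<close> cancels against the information, which
      leaves the covariance of the limit law.\<close>
    have "(J *v u) \<bullet> (information *v (J *v u)) = u \<bullet> (J *v u)"
      by (simp add: matrix_vector_mul_assoc IJ inner_commute)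
    then show "(\<lambda>n. LINT \<omega>|M. cos (sqrt (real n) * emp n (influence (J *v u)) \<omega> + b)) \<longlonglongrightarrow> cos b * exp (- (u \<bullet> (J *v u)) / 2)"
      using central_limit_cos[OF influence_measurable influence_moments(1,2), of "J *v u" b]
      by (simp add: influence_moments(3))
    fix e :: real assume "e > 0"
    \<comment> \<open>The added 1 covers u = 0; Cauchy-Schwarz then gives an error of at most
      e.\<close>
    define e' where "e' = e / (norm u + 1)"
    have nu: "norm u + 1 > 0" by (simp add: add_nonneg_pos)
    have e': "e' > 0" "norm u * e' \<le> e"
    proof -
      show "e' > 0" using \<open>e > 0\<close> nu by (simp add: e'_def)
      then have "norm u * e' \<le> (norm u + 1) * e'" by simp
      also have "\<dots> = e" using nu by (simp add: e'_def)
      finally show "norm u * e' \<le> e" .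
    qed
    show "asymptotically_certain (\<lambda>n \<omega>. \<bar>u \<bullet> sqrt (real n) *\<^sub>R d n \<omega> - sqrt (real n) * emp n (influence (J *v u)) \<omega>\<bar> \<le> e)"
    proof (rule asymptotically_certain_mono'[OF asymptotic_linearity[OF pd consistent \<open>r > 0\<close> minimal e'(1)]])
      fix n \<omega> assume le: "norm (sqrt (real n) *\<^sub>R d n \<omega> - matrix_inv information *v score n \<omega>) \<le> e'"
      have "sqrt (real n) * emp n (influence (J *v u)) \<omega> = (J *v u) \<bullet> score n \<omega>"
        unfolding score_influence[symmetric] by (rule inner_commute)
      also have "\<dots> = u \<bullet> (J *v score n \<omega>)"
        by (simp add: inner_matrix_vector_mult_left Jsym)
      finally have "\<bar>u \<bullet> sqrt (real n) *\<^sub>R d n \<omega> - sqrt (real n) * emp n (influence (J *v u)) \<omega>\<bar> =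
        \<bar>u \<bullet> (sqrt (real n) *\<^sub>R d n \<omega> - J *v score n \<omega>)\<bar>"
        by (simp add: inner_diff_right)
      also have "\<dots> \<le> norm u * norm (sqrt (real n) *\<^sub>R d n \<omega> - J *v score n \<omega>)" by (rule Cauchy_Schwarz_ineq2)
      also have "\<dots> \<le> norm u * e'" using le by (intro mult_left_mono) (auto simp: J_def)
      also have "\<dots> \<le> e" by (rule e'(2))
      finally show "\<bar>u \<bullet> sqrt (real n) *\<^sub>R d n \<omega> - sqrt (real n) * emp n (influence (J *v u)) \<omega>\<bar> \<le> e" .
    qed
  qed
qed

end

section \<open>Perceptrons: symmetries and Taylor estimates\<close>

text \<open>Oddness of \<open>tanh\<close>: the sign of the incoming weights passes through the unit
  and meets the flipped sign of the outgoing ones.\<close>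

lemma mlp_flip_unit: "mlp (flip_unit j W) z = mlp W z"
proof -
  have "flip_unit j W $ Inl (i, Some j') *
      tanh ((\<Sum>k\<in>UNIV. flip_unit j W $ Inr (j', Some k) * z $ k) + flip_unit j W $ Inr (j', None)) =
    W $ Inl (i, Some j') * tanh ((\<Sum>k\<in>UNIV. W $ Inr (j', Some k) * z $ k) + W $ Inr (j', None))" for i j'
  proof (cases "j' = j")
    case True
    have "(\<Sum>k\<in>UNIV. flip_unit j W $ Inr (j, Some k) * z $ k) + flip_unit j W $ Inr (j, None) =
      - ((\<Sum>k\<in>UNIV. W $ Inr (j, Some k) * z $ k) + W $ Inr (j, None))"
      by (simp add: flip_unit_def sum_negf)
    moreover have "flip_unit j W $ Inl (i, Some j) = - W $ Inl (i, Some j)"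
      by (simp add: flip_unit_def)
    ultimately show ?thesis unfolding True by (simp only: tanh_minus minus_mult_minus)
  qed (simp add: flip_unit_def)
  then show ?thesis by (simp add: mlp_def flip_unit_def)
qed

lemma mlp_permute_units:
  assumes "bij \<pi>"
  shows "mlp (permute_units \<pi> W) z = mlp W z"
proof -
  have "(\<Sum>j\<in>UNIV. W $ Inl (i, Some (\<pi> j)) * tanh ((\<Sum>k\<in>UNIV. W $ Inr (\<pi> j, Some k) * z $ k) + W $ Inr (\<pi> j, None))) =
    (\<Sum>j\<in>UNIV. W $ Inl (i, Some j) * tanh ((\<Sum>k\<in>UNIV. W $ Inr (j, Some k) * z $ k) + W $ Inr (j, None)))" for i
    by (rule sum.reindex_bij_betw[OF assms])
  then show ?thesis by (simp add: mlp_def permute_units_def)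
qed

lemma dist_flip_unit: "dist (flip_unit j V) (flip_unit j W) = dist V W"
  unfolding dist_vec_def
  by (rule L2_set_cong) (auto simp: flip_unit_def dist_real_def split: sum.split prod.split)

lemma dist_permute_units:
  fixes V W :: "('d::finite, 'h::finite, 'l::finite) weights"
  assumes "bij \<pi>"
  shows "dist (permute_units \<pi> V) (permute_units \<pi> W) = dist V W"
proof -
  \<comment> \<open>Permuting hidden units permutes the coordinates of the weight vector; on the
    finite index type injectivity of \<sigma> already gives bijectivity.\<close>
  define \<sigma> :: "('d, 'h, 'l) weight_index \<Rightarrow> ('d, 'h, 'l) weight_index" where
    "\<sigma> p = (case p of Inl (i, m) \<Rightarrow> Inl (i, map_option \<pi> m) | Inr (j, m) \<Rightarrow> Inr (\<pi> j, m))" for p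
  have p: "permute_units \<pi> U $ p = U $ \<sigma> p" for U :: "('d, 'h, 'l) weights" and p
    by (simp add: permute_units_def \<sigma>_def split: sum.split prod.split)
  have "inj \<sigma>"
  proof (rule injI)
    have opt: "map_option \<pi> m = map_option \<pi> m' \<Longrightarrow> m = m'" for m m'
      using option.inj_map[OF bij_is_inj[OF assms]] by (auto dest: injD)
    fix p q assume "\<sigma> p = \<sigma> q"
    then show "p = q"
      using bij_is_inj[OF assms] by (auto simp: \<sigma>_def split: sum.splits prod.splits dest: injD opt)
  qed
  then have bij: "bij \<sigma>" by (simp add: finite_UNIV_inj_surj bij_def)
  have "(\<Sum>p\<in>UNIV. (dist (V $ \<sigma> p) (W $ \<sigma> p))\<^sup>2) = (\<Sum>p\<in>UNIV. (dist (V $ p) (W $ p))\<^sup>2)"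
    by (rule sum.reindex_bij_betw[OF bij])
  then show ?thesis by (simp add: dist_vec_def L2_set_def p)
qed

lemma mlp_symmetries_isometry:
  assumes "g \<in> mlp_symmetries"
  shows "mlp (g W) z = mlp W z" "dist (g V) (g W) = dist V W"
proof -
  have "(\<forall>W z. mlp (g W) z = mlp W z) \<and> (\<forall>V W. dist (g V) (g W) = dist V W)"
    using assms
    by induction (auto simp: mlp_flip_unit mlp_permute_units dist_flip_unit dist_permute_units)
  then show "mlp (g W) z = mlp W z" "dist (g V) (g W) = dist V W" by auto
qed

lemma mlp_symmetries_comp:
  assumes "g \<in> mlp_symmetries" "h \<in> mlp_symmetries"
  shows "g \<circ> h \<in> mlp_symmetries"
  using assms by induction (auto simp: comp_assoc intro: mlp_symmetries.intros)

lemma flip_unit_involution: "flip_unit j \<circ> flip_unit j = id"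
  by (auto simp: fun_eq_iff flip_unit_def vec_eq_iff split: sum.split)

lemma permute_units_inverse:
  assumes "bij \<pi>"
  shows "permute_units (inv \<pi>) \<circ> permute_units \<pi> = id"
proof -
  have "\<pi> (inv \<pi> j) = j" for j using assms by (simp add: bij_is_surj surj_f_inv_f)
  then show ?thesis
    by (auto simp: fun_eq_iff permute_units_def vec_eq_iff option.map_comp comp_def option.map_ident split: sum.split)
qed

text \<open>The inductive set adds generators on the left, whereas the inverse of a composite has
  the inverted generator on the right; closure under composition repairs the order.\<close>

lemma mlp_symmetries_inverse:
  assumes "g \<in> mlp_symmetries"
  shows "\<exists>h\<in>mlp_symmetries. h \<circ> g = id"
  using assms
proof induction
  case id
  then show ?case by (intro bexI[of _ id]) (auto intro: mlp_symmetries.id)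
next
  case (flip g j)
  then obtain h where h: "h \<in> mlp_symmetries" "h \<circ> g = id" by blast
  have "flip_unit j \<in> mlp_symmetries" using mlp_symmetries.flip[OF mlp_symmetries.id, of j] by simp
  then have "h \<circ> flip_unit j \<in> mlp_symmetries" by (rule mlp_symmetries_comp[OF h(1)])
  moreover have "(h \<circ> flip_unit j) \<circ> (flip_unit j \<circ> g) = h \<circ> (flip_unit j \<circ> flip_unit j) \<circ> g"
    by (simp only: comp_assoc)
  ultimately show ?case using h(2) by (intro bexI[of _ "h \<circ> flip_unit j"]) (simp_all only: flip_unit_involution comp_id)
next
  case (permute g \<pi>)
  then obtain h where h: "h \<in> mlp_symmetries" "h \<circ> g = id" by blast
  have "permute_units (inv \<pi>) \<in> mlp_symmetries"
    using mlp_symmetries.permute[OF mlp_symmetries.id bij_imp_bij_inv[OF permute.hyps(2)]] by simp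
  then have "h \<circ> permute_units (inv \<pi>) \<in> mlp_symmetries" by (rule mlp_symmetries_comp[OF h(1)])
  moreover have "(h \<circ> permute_units (inv \<pi>)) \<circ> (permute_units \<pi> \<circ> g) = h \<circ> (permute_units (inv \<pi>) \<circ> permute_units \<pi>) \<circ> g"
    by (simp only: comp_assoc)
  ultimately show ?case using h(2)
    by (intro bexI[of _ "h \<circ> permute_units (inv \<pi>)"]) (simp_all only: permute_units_inverse[OF permute.hyps(2)] comp_id)
qed

lemma mlp_equiv_mlp: "mlp_equiv V W \<Longrightarrow> mlp W z = mlp V z"
  by (auto simp: mlp_equiv_def mlp_symmetries_isometry)

lemma mlp_equiv_sym:
  assumes "mlp_equiv V W"
  shows "mlp_equiv W V"
proof -
  obtain g where g: "g \<in> mlp_symmetries" "W = g V" using assms by (auto simp: mlp_equiv_def)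
  then obtain h where "h \<in> mlp_symmetries" "h \<circ> g = id" using mlp_symmetries_inverse by blast
  then show ?thesis using g(2) by (auto simp: mlp_equiv_def fun_eq_iff intro!: bexI[of _ h])
qed

lemma mlp_equiv_trans:
  assumes "mlp_equiv U V" "mlp_equiv V W"
  shows "mlp_equiv U W"
  using assms mlp_symmetries_comp unfolding mlp_equiv_def by (metis comp_apply)

text \<open>The representative closest to \<open>W\<^sub>0\<close> is at most as far from \<open>W\<^sub>0\<close> as any member of the class
  is from the class of \<open>W\<^sub>0\<close>, since the symmetries are isometries.\<close>

lemma closest_representative_dist:
  assumes "closest_representative W\<^sub>0 W" "mlp_equiv V W" "mlp_equiv V' W\<^sub>0"
  shows "dist W W\<^sub>0 \<le> dist V V'"
proof -
  obtain g where g: "g \<in> mlp_symmetries" "W\<^sub>0 = g V'" using assms(3) by (auto simp: mlp_equiv_def)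
  then have "mlp_equiv V (g V)" by (auto simp: mlp_equiv_def)
  then have "mlp_equiv W (g V)" using mlp_equiv_sym[OF assms(2)] mlp_equiv_trans by blast
  then have "dist W W\<^sub>0 \<le> dist (g V) W\<^sub>0" using assms(1) by (simp add: closest_representative_def)
  also have "\<dots> = dist V V'" unfolding g(2) by (rule mlp_symmetries_isometry(2)[OF g(1)])
  finally show ?thesis .
qed

section \<open>Derivatives of \<open>tanh\<close> and the Taylor expansion of a single unit\<close>

definition tanh1 :: "real \<Rightarrow> real" where "tanh1 u = 1 - (tanh u)\<^sup>2"
definition tanh2 :: "real \<Rightarrow> real" where "tanh2 u = - 2 * tanh u * tanh1 u"
definition tanh3 :: "real \<Rightarrow> real" where "tanh3 u = - 2 * (tanh1 u * tanh1 u + tanh u * tanh2 u)"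

lemma DERIV_tanh:
  "(tanh has_real_derivative tanh1 u) (at u)"
  "(tanh1 has_real_derivative tanh2 u) (at u)"
  "(tanh2 has_real_derivative tanh3 u) (at u)"
proof -
  show 1: "(tanh has_real_derivative tanh1 u) (at u)" for u :: real
    by (auto intro!: derivative_eq_intros simp: tanh1_def)
  show 2: "(tanh1 has_real_derivative tanh2 u) (at u)" for u
    unfolding tanh1_def[abs_def]
    by (rule derivative_eq_intros 1 refl)+ (simp add: tanh2_def tanh1_def)
  show "(tanh2 has_real_derivative tanh3 u) (at u)"
    unfolding tanh2_def[abs_def]
    by (rule derivative_eq_intros 1 2 refl)+ (simp add: tanh3_def algebra_simps)
qed

lemma tanh_bounds: "\<bar>tanh u\<bar> \<le> 1" "\<bar>tanh1 u\<bar> \<le> 1" "\<bar>tanh2 u\<bar> \<le> 2" "\<bar>tanh3 u\<bar> \<le> 6" for u :: real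
proof -
  show 0: "\<bar>tanh u\<bar> \<le> 1" using tanh_real_abs[of u] tanh_real_lt_1[of "\<bar>u\<bar>"] by simp
  then have "(tanh u)\<^sup>2 \<le> 1" by (simp add: abs_square_le_1)
  then show 1: "\<bar>tanh1 u\<bar> \<le> 1" unfolding tanh1_def by (simp add: abs_le_iff)
  have "\<bar>tanh u\<bar> * \<bar>tanh1 u\<bar> \<le> 1 * 1" using 0 1 by (intro mult_mono) auto
  then show 2: "\<bar>tanh2 u\<bar> \<le> 2" by (simp add: tanh2_def abs_mult)
  have a: "\<bar>tanh1 u * tanh1 u\<bar> \<le> 1 * 1" unfolding abs_mult using 1 by (intro mult_mono) auto
  have b: "\<bar>tanh u * tanh2 u\<bar> \<le> 1 * 2" unfolding abs_mult using 0 2 by (intro mult_mono) auto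
  have "\<bar>tanh1 u * tanh1 u + tanh u * tanh2 u\<bar> \<le> 3" using a b by linarith
  then show "\<bar>tanh3 u\<bar> \<le> 6" unfolding tanh3_def abs_mult[of "- 2"] by simp
qed

lemma tanh_lipschitz: "\<bar>tanh u - tanh v\<bar> \<le> \<bar>u - v\<bar>" for u v :: real
  using field_differentiable_bound[of UNIV tanh tanh1 1 u v] DERIV_tanh(1) tanh_bounds(2) by simp

text \<open>Maclaurin's formula along the segment t \<mapsto> (a + t \<alpha>) tanh (u + t s).
  Differentiating the amplitude costs a factor n, differentiating the argument a factor n w, hence
  order m is bounded by n^m w^m.\<close>

lemma unit_taylor:
  fixes a \<alpha> u s n :: real
  assumes \<alpha>: "\<bar>\<alpha>\<bar> \<le> n" and s: "\<bar>s\<bar> \<le> n * w" and a: "\<bar>a\<bar> \<le> A" and n: "0 \<le> n" "n \<le> 1" and w: "1 \<le> w"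
  shows "\<bar>(a + \<alpha>) * tanh (u + s) - a * tanh u - (\<alpha> * tanh u + a * s * tanh1 u)\<bar> \<le> (6 * A + 12) * w\<^sup>2 * n\<^sup>2"
    and "\<bar>(a + \<alpha>) * tanh (u + s) - a * tanh u - (\<alpha> * tanh u + a * s * tanh1 u)
       - (\<alpha> * s * tanh1 u + a * s\<^sup>2 * tanh2 u / 2)\<bar> \<le> (6 * A + 12) * w ^ 3 * n ^ 3"
proof -
  define \<phi> where "\<phi> t = (a + t * \<alpha>) * tanh (u + t * s)" for t
  define \<phi>1 where "\<phi>1 t = \<alpha> * tanh (u + t * s) + (a + t * \<alpha>) * (s * tanh1 (u + t * s))" for t
  define \<phi>2 where "\<phi>2 t = 2 * \<alpha> * s * tanh1 (u + t * s) + (a + t * \<alpha>) * (s\<^sup>2 * tanh2 (u + t * s))" for t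
  define \<phi>3 where "\<phi>3 t = 3 * \<alpha> * s\<^sup>2 * tanh2 (u + t * s) + (a + t * \<alpha>) * (s ^ 3 * tanh3 (u + t * s))" for t
  have lin: "((\<lambda>t. u + t * s) has_real_derivative s) (at t)" for t
    by (auto intro!: derivative_eq_intros)
  note T = DERIV_chain2[OF DERIV_tanh(1) lin] DERIV_chain2[OF DERIV_tanh(2) lin] DERIV_chain2[OF DERIV_tanh(3) lin]
  have d: "(\<phi> has_real_derivative \<phi>1 t) (at t)" "(\<phi>1 has_real_derivative \<phi>2 t) (at t)" "(\<phi>2 has_real_derivative \<phi>3 t) (at t)" for t
    unfolding \<phi>_def[abs_def] \<phi>1_def[abs_def] \<phi>2_def[abs_def] \<phi>3_def
    by ((rule derivative_eq_intros T refl)+, simp add: power2_eq_square power3_eq_cube algebra_simps)+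
  define diff where "diff m = (if m = 0 then \<phi> else if m = 1 then \<phi>1 else if m = 2 then \<phi>2 else \<phi>3)" for m :: nat
  have A: "\<bar>a + t * \<alpha>\<bar> \<le> A + 1" if "0 \<le> t" "t \<le> 1" for t
  proof -
    have "\<bar>t * \<alpha>\<bar> \<le> 1 * 1" unfolding abs_mult using that \<alpha> n by (intro mult_mono) auto
    then show ?thesis using a by linarith
  qed
  have A0: "0 \<le> A" using a by linarith
  have nw: "0 \<le> n * w" using n w by simp
  have s2: "s\<^sup>2 \<le> (n * w)\<^sup>2" using power_mono[OF s, of 2] by simp
  have s3: "\<bar>s ^ 3\<bar> \<le> (n * w) ^ 3" using power_mono[OF s, of 3] by (simp add: power_abs)
  have w2: "w \<le> w\<^sup>2" using w by (simp add: power2_eq_square)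
  have w3: "w\<^sup>2 \<le> w ^ 3" using w by (simp add: power2_eq_square power3_eq_cube)
  \<comment> \<open>The constant \<open>6 * A + 12\<close> is dictated by the third order, 6 from
    the mixed term and 6 A + 6 from the bound for \<open>tanh3\<close>; the second order is enlarged
    to the same value.\<close>
  have b2: "\<bar>\<phi>2 t\<bar> \<le> (6 * A + 12) * w\<^sup>2 * n\<^sup>2" if t: "0 \<le> t" "t \<le> 1" for t
  proof -
    have "\<bar>2 * \<alpha> * s * tanh1 (u + t * s)\<bar> \<le> 2 * n * (n * w) * 1"
      unfolding abs_mult using \<alpha> s n nw tanh_bounds(2) by (intro mult_mono) auto
    moreover have "\<bar>(a + t * \<alpha>) * (s\<^sup>2 * tanh2 (u + t * s))\<bar> \<le> (A + 1) * ((n * w)\<^sup>2 * 2)"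
      unfolding abs_mult using A[OF t] s2 tanh_bounds(3) A0 by (intro mult_mono) auto
    ultimately have "\<bar>\<phi>2 t\<bar> \<le> 2 * n * (n * w) * 1 + (A + 1) * ((n * w)\<^sup>2 * 2)" unfolding \<phi>2_def by linarith
    also have "\<dots> = (2 * n\<^sup>2) * w + (2 * A + 2) * (w\<^sup>2 * n\<^sup>2)" by (simp add: power2_eq_square algebra_simps)
    also have "\<dots> \<le> (2 * n\<^sup>2) * w\<^sup>2 + (6 * A + 10) * (w\<^sup>2 * n\<^sup>2)"
      using w2 A0 by (intro add_mono mult_left_mono mult_right_mono) auto
    finally show ?thesis by (simp add: algebra_simps)
  qed
  have b3: "\<bar>\<phi>3 t\<bar> \<le> (6 * A + 12) * w ^ 3 * n ^ 3" if t: "0 \<le> t" "t \<le> 1" for t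
  proof -
    have "\<bar>3 * \<alpha> * s\<^sup>2 * tanh2 (u + t * s)\<bar> \<le> 3 * n * (n * w)\<^sup>2 * 2"
      unfolding abs_mult using \<alpha> s2 n nw tanh_bounds(3) by (intro mult_mono) auto
    moreover have "\<bar>(a + t * \<alpha>) * (s ^ 3 * tanh3 (u + t * s))\<bar> \<le> (A + 1) * ((n * w) ^ 3 * 6)"
      unfolding abs_mult using A[OF t] s3 tanh_bounds(4) A0 nw by (intro mult_mono) (auto simp: abs_mult[symmetric])
    ultimately have "\<bar>\<phi>3 t\<bar> \<le> 3 * n * (n * w)\<^sup>2 * 2 + (A + 1) * ((n * w) ^ 3 * 6)" unfolding \<phi>3_def by linarith
    also have "\<dots> = (6 * n ^ 3) * w\<^sup>2 + (6 * A + 6) * (w ^ 3 * n ^ 3)" by (simp add: power2_eq_square power3_eq_cube algebra_simps)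
    also have "\<dots> \<le> (6 * n ^ 3) * w ^ 3 + (6 * A + 6) * (w ^ 3 * n ^ 3)"
      using w3 n A0 w by (intro add_mono mult_left_mono mult_right_mono) auto
    finally show ?thesis by (simp add: algebra_simps)
  qed
  have D: "DERIV (diff m) t :> diff (Suc m) t" if "m < 3" for m t
    using that d by (auto simp: diff_def less_Suc_eq numeral_3_eq_3 numeral_2_eq_2)
  have "\<exists>t>0. t < 1 \<and> \<phi> 1 = (\<Sum>m<2. diff m 0 / fact m * 1 ^ m) + diff 2 t / fact 2 * 1 ^ 2"
    by (rule Maclaurin) (use D in \<open>auto simp: diff_def\<close>)
  then obtain t where t: "0 < t" "t < 1" "\<phi> 1 = \<phi> 0 + \<phi>1 0 + \<phi>2 t / 2"
    by (auto simp: diff_def numeral_2_eq_2)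
  have "\<exists>t>0. t < 1 \<and> \<phi> 1 = (\<Sum>m<3. diff m 0 / fact m * 1 ^ m) + diff 3 t / fact 3 * 1 ^ 3"
    by (rule Maclaurin) (use D in \<open>auto simp: diff_def\<close>)
  then obtain r where r: "0 < r" "r < 1" "\<phi> 1 = \<phi> 0 + \<phi>1 0 + \<phi>2 0 / 2 + \<phi>3 r / 6"
    by (auto simp: diff_def numeral_3_eq_3 numeral_2_eq_2 fact_numeral)
  show "\<bar>(a + \<alpha>) * tanh (u + s) - a * tanh u - (\<alpha> * tanh u + a * s * tanh1 u)\<bar> \<le> (6 * A + 12) * w\<^sup>2 * n\<^sup>2"
    using t(3) b2[of t] t(1,2) by (simp add: \<phi>_def \<phi>1_def mult.assoc)
  show "\<bar>(a + \<alpha>) * tanh (u + s) - a * tanh u - (\<alpha> * tanh u + a * s * tanh1 u)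
       - (\<alpha> * s * tanh1 u + a * s\<^sup>2 * tanh2 u / 2)\<bar> \<le> (6 * A + 12) * w ^ 3 * n ^ 3"
    using r(3) b3[of r] r(1,2) by (simp add: \<phi>_def \<phi>1_def \<phi>2_def mult.assoc add_divide_distrib)
qed

section \<open>From unit estimates to network estimates\<close>

definition preact :: "('d::finite, 'h::finite, 'l::finite) weights \<Rightarrow> 'h \<Rightarrow> real ^ 'l \<Rightarrow> real" where
  "preact W j z = (\<Sum>k\<in>UNIV. W $ Inr (j, Some k) * z $ k) + W $ Inr (j, None)"

text \<open>Bounding every product of a weight and an input by the norms gives one |z| per input;
  the bias of the unit contributes the 1.\<close>

definition input_weight :: "real ^ 'l \<Rightarrow> real" where
  "input_weight z = 1 + real CARD('l) * norm z"

lemma input_weight_ge_1: "1 \<le> input_weight z"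
  by (simp add: input_weight_def)

lemma mlp_nth: "mlp W z $ i = (\<Sum>j\<in>UNIV. W $ Inl (i, Some j) * tanh (preact W j z)) + W $ Inl (i, None)"
  by (simp add: mlp_def preact_def)

lemma preact_add: "preact (V + W) j z = preact V j z + preact W j z"
  by (simp add: preact_def distrib_right sum.distrib)

lemma preact_scale: "preact (t *\<^sub>R W) j z = t * preact W j z"
  by (simp add: preact_def sum_distrib_left distrib_left mult.assoc)

lemma preact_diff: "preact (V - W) j z = preact V j z - preact W j z"
  by (simp add: preact_def left_diff_distrib sum_subtractf)

lemma preact_bound: "\<bar>preact W j z\<bar> \<le> norm W * input_weight z" for z :: "real ^ 'l"
proof -
  have "\<bar>\<Sum>k\<in>UNIV. W $ Inr (j, Some k) * z $ k\<bar> \<le> (\<Sum>k\<in>(UNIV :: 'l set). norm W * norm z)"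
  proof (intro order_trans[OF sum_abs] sum_mono)
    show "\<bar>W $ Inr (j, Some k) * z $ k\<bar> \<le> norm W * norm z" for k
      unfolding abs_mult by (intro mult_mono component_le_norm_cart) auto
  qed
  moreover have "\<bar>W $ Inr (j, None)\<bar> \<le> norm W" by (rule component_le_norm_cart)
  ultimately show ?thesis by (simp add: preact_def input_weight_def algebra_simps)
qed

lemma norm_vec_le_card_mult:
  fixes v :: "real ^ 'n"
  assumes "\<And>i. \<bar>v $ i\<bar> \<le> B"
  shows "norm v \<le> real CARD('n) * B"
proof -
  have "norm v \<le> (\<Sum>i\<in>UNIV. \<bar>v $ i\<bar>)" by (rule norm_le_l1_cart)
  also have "\<dots> \<le> (\<Sum>i\<in>(UNIV :: 'n set). B)" by (intro sum_mono assms)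
  finally show ?thesis by simp
qed

text \<open>Every network estimate has the same shape, a sum over hidden units plus an output bias;
  the dimension counts are collected once.\<close>

lemma norm_layer_le:
  fixes v :: "real ^ 'd"
  assumes v: "\<And>i. v $ i = (\<Sum>j\<in>UNIV. p i j) + q i"
    and p: "\<And>i (j :: 'h). \<bar>p i j\<bar> \<le> b * r" and q: "\<And>i. \<bar>q i\<bar> \<le> r"
    and c: "real CARD('d) * (real CARD('h::finite) * b + 1) \<le> c" and "0 \<le> r"
  shows "norm v \<le> c * r"
proof -
  have "\<bar>v $ i\<bar> \<le> (real CARD('h) * b + 1) * r" for i
  proof -
    have "\<bar>\<Sum>j\<in>UNIV. p i j\<bar> \<le> (\<Sum>j\<in>(UNIV :: 'h set). b * r)"
      by (intro order_trans[OF sum_abs] sum_mono p)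
    then show ?thesis using q[of i] unfolding v by (simp add: algebra_simps)
  qed
  then have "norm v \<le> real CARD('d) * ((real CARD('h) * b + 1) * r)" by (rule norm_vec_le_card_mult)
  also have "\<dots> \<le> c * r" using mult_right_mono[OF c \<open>0 \<le> r\<close>] by (simp add: mult.assoc)
  finally show ?thesis .
qed

text \<open>Only \<open>V\<close> is bounded. Splitting the difference of products puts the
  amplitudes of \<open>V\<close> on the difference of the \<open>tanh\<close> values, while
  \<open>W\<close> enters otherwise only under a bounded \<open>tanh\<close>.\<close>

lemma mlp_lipschitz:
  fixes V W :: "('d::finite, 'h::finite, 'l::finite) weights"
  assumes V: "norm V \<le> R" and c: "real CARD('d) * (real CARD('h) * (1 + R) + 1) \<le> c"
  shows "norm (mlp W z - mlp V z) \<le> c * input_weight z * norm (W - V)"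
proof -
  have w: "1 \<le> input_weight z" by (rule input_weight_ge_1)
  have "0 \<le> R" using V norm_ge_zero[of V] by linarith
  have "norm (mlp W z - mlp V z) \<le> c * (input_weight z * norm (W - V))"
  proof (rule norm_layer_le[OF _ _ _ c])
    show "(mlp W z - mlp V z) $ i = (\<Sum>j\<in>UNIV. W $ Inl (i, Some j) * tanh (preact W j z) - V $ Inl (i, Some j) * tanh (preact V j z))
       + (W $ Inl (i, None) - V $ Inl (i, None))" for i
      by (simp add: mlp_nth sum_subtractf)
    show "\<bar>W $ Inl (i, Some j) * tanh (preact W j z) - V $ Inl (i, Some j) * tanh (preact V j z)\<bar>
      \<le> (1 + R) * (input_weight z * norm (W - V))" for i j
    proof -
      have "W $ Inl (i, Some j) * tanh (preact W j z) - V $ Inl (i, Some j) * tanh (preact V j z) =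
        (W - V) $ Inl (i, Some j) * tanh (preact W j z) + V $ Inl (i, Some j) * (tanh (preact W j z) - tanh (preact V j z))"
        by (simp add: algebra_simps)
      moreover have "\<bar>(W - V) $ Inl (i, Some j) * tanh (preact W j z)\<bar> \<le> norm (W - V) * 1"
        unfolding abs_mult by (intro mult_mono component_le_norm_cart tanh_bounds) auto
      moreover have "\<bar>V $ Inl (i, Some j) * (tanh (preact W j z) - tanh (preact V j z))\<bar> \<le> R * (norm (W - V) * input_weight z)"
        unfolding abs_mult using \<open>0 \<le> R\<close> V
        by (intro mult_mono order_trans[OF component_le_norm_cart] order_trans[OF tanh_lipschitz])
           (auto simp: preact_diff[symmetric] preact_bound)
      moreover have "norm (W - V) * 1 \<le> norm (W - V) * input_weight z" using w by (intro mult_left_mono) auto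
      ultimately show ?thesis by (simp add: algebra_simps)
    qed
    show "\<bar>W $ Inl (i, None) - V $ Inl (i, None)\<bar> \<le> input_weight z * norm (W - V)" for i
    proof -
      have "\<bar>W $ Inl (i, None) - V $ Inl (i, None)\<bar> \<le> 1 * norm (W - V)"
        using component_le_norm_cart[of "W - V" "Inl (i, None)"] by simp
      also have "\<dots> \<le> input_weight z * norm (W - V)" using w by (intro mult_right_mono) auto
      finally show ?thesis .
    qed
    show "0 \<le> input_weight z * norm (W - V)" using w by simp
  qed
  then show ?thesis by (simp add: mult.assoc)
qed

definition mlp_lin :: "('d::finite, 'h::finite, 'l::finite) weights \<Rightarrow> ('d, 'h, 'l) weights \<Rightarrow> real ^ 'l \<Rightarrow> real ^ 'd" where
  "mlp_lin W \<delta> z = (\<chi> i. (\<Sum>j\<in>UNIV. \<delta> $ Inl (i, Some j) * tanh (preact W j z)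
     + W $ Inl (i, Some j) * preact \<delta> j z * tanh1 (preact W j z)) + \<delta> $ Inl (i, None))"

text \<open>Half of the second derivative along \<delta>. The network is linear in its output layer,
  so what remains is the product of amplitude and argument increments and the square of the argument
  increment.\<close>

definition mlp_quad :: "('d::finite, 'h::finite, 'l::finite) weights \<Rightarrow> ('d, 'h, 'l) weights \<Rightarrow> real ^ 'l \<Rightarrow> real ^ 'd" where
  "mlp_quad W \<delta> z = (\<chi> i. \<Sum>j\<in>UNIV. \<delta> $ Inl (i, Some j) * preact \<delta> j z * tanh1 (preact W j z)
     + W $ Inl (i, Some j) * (preact \<delta> j z)\<^sup>2 * tanh2 (preact W j z) / 2)"

lemma mlp_partial_eq: "mlp_partial W k z = mlp_lin W (axis k 1) z"
proof -
  have "deriv (\<lambda>t. mlp (W + t *\<^sub>R \<delta>) z $ i) 0 = mlp_lin W \<delta> z $ i" for \<delta> i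
  proof (rule DERIV_imp_deriv)
    have lin: "((\<lambda>t. preact (W + t *\<^sub>R \<delta>) j z) has_real_derivative preact \<delta> j z) (at 0)" for j
      unfolding preact_add preact_scale by (auto intro!: derivative_eq_intros)
    have comp: "((\<lambda>t. (W + t *\<^sub>R \<delta>) $ p) has_real_derivative \<delta> $ p) (at 0)" for p
      by (auto intro!: derivative_eq_intros)
    have T: "((\<lambda>t. tanh (preact (W + t *\<^sub>R \<delta>) j z)) has_real_derivative tanh1 (preact W j z) * preact \<delta> j z) (at 0)" for j
      using DERIV_chain2[OF DERIV_tanh(1) lin[of j]] by simp
    show "((\<lambda>t. mlp (W + t *\<^sub>R \<delta>) z $ i) has_real_derivative mlp_lin W \<delta> z $ i) (at 0)"
      unfolding mlp_nth
      by (rule DERIV_cong, rule DERIV_add, rule DERIV_sum, rule DERIV_mult, rule comp, rule T, rule comp)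
         (simp add: mlp_lin_def mult_ac)
  qed
  then show ?thesis by (simp add: mlp_partial_def vec_eq_iff)
qed

lemma linear_mlp_lin: "linear (\<lambda>\<delta>. mlp_lin W \<delta> z)"
  by (rule linearI)
     (simp_all add: mlp_lin_def vec_eq_iff preact_add preact_scale sum_distrib_left sum.distrib[symmetric] algebra_simps)

lemma mlp_lin_partial: "mlp_lin W \<delta> z = (\<Sum>k\<in>UNIV. \<delta> $ k *\<^sub>R mlp_partial W k z)"
proof -
  have "mlp_lin W \<delta> z = mlp_lin W (\<Sum>k\<in>UNIV. \<delta> $ k *\<^sub>R axis k 1) z"
    using basis_expansion[of \<delta>] by (simp add: scalar_mult_eq_scaleR)
  also have "\<dots> = (\<Sum>k\<in>UNIV. \<delta> $ k *\<^sub>R mlp_lin W (axis k 1) z)"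
    unfolding linear_sum[OF linear_mlp_lin] linear_scale[OF linear_mlp_lin] ..
  finally show ?thesis by (simp add: mlp_partial_eq)
qed

text \<open>One constant for all network estimates: the unit constant with amplitudes bounded by
  \<open>norm W\<close>, inserted into the layer bound.\<close>

definition taylor_const :: "('d::finite, 'h::finite, 'l::finite) weights \<Rightarrow> real" where
  "taylor_const W = real CARD('d) * (real CARD('h) * (6 * norm W + 12) + 1)"

lemma taylor_const_nonneg: "0 \<le> taylor_const W"
  by (simp add: taylor_const_def)

lemma taylor_const_le:
  fixes W :: "('d::finite, 'h::finite, 'l::finite) weights"
  assumes "b \<le> 6 * norm W + 12"
  shows "real CARD('d) * (real CARD('h) * b + 1) \<le> taylor_const W"
  unfolding taylor_const_def using assms by (intro mult_left_mono add_right_mono) auto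

lemma mlp_order1:
  "norm (mlp (W + \<delta>) z - mlp W z) \<le> taylor_const W * input_weight z * norm \<delta>"
proof -
  have "norm (mlp (W + \<delta>) z - mlp W z) \<le> taylor_const W * input_weight z * norm (W + \<delta> - W)"
    by (rule mlp_lipschitz[OF order_refl taylor_const_le]) simp
  then show ?thesis by simp
qed

lemma mlp_order2:
  assumes \<delta>: "norm \<delta> \<le> 1"
  shows "norm (mlp (W + \<delta>) z - mlp W z - mlp_lin W \<delta> z) \<le> taylor_const W * (input_weight z)\<^sup>2 * (norm \<delta>)\<^sup>2"
proof -
  let ?w = "input_weight z" and ?n = "norm \<delta>"
  have "norm (mlp (W + \<delta>) z - mlp W z - mlp_lin W \<delta> z) \<le> taylor_const W * (?w\<^sup>2 * ?n\<^sup>2)"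
  proof (rule norm_layer_le[OF _ _ _ taylor_const_le[OF order_refl]])
    show "(mlp (W + \<delta>) z - mlp W z - mlp_lin W \<delta> z) $ i =
      (\<Sum>j\<in>UNIV. (W $ Inl (i, Some j) + \<delta> $ Inl (i, Some j)) * tanh (preact W j z + preact \<delta> j z) - W $ Inl (i, Some j) * tanh (preact W j z)
        - (\<delta> $ Inl (i, Some j) * tanh (preact W j z) + W $ Inl (i, Some j) * preact \<delta> j z * tanh1 (preact W j z))) + 0" for i
      by (simp add: mlp_nth mlp_lin_def preact_add sum_subtractf)
    show "\<bar>(W $ Inl (i, Some j) + \<delta> $ Inl (i, Some j)) * tanh (preact W j z + preact \<delta> j z) - W $ Inl (i, Some j) * tanh (preact W j z)
        - (\<delta> $ Inl (i, Some j) * tanh (preact W j z) + W $ Inl (i, Some j) * preact \<delta> j z * tanh1 (preact W j z))\<bar>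
      \<le> (6 * norm W + 12) * (?w\<^sup>2 * ?n\<^sup>2)" for i j
      using unit_taylor(1)[OF component_le_norm_cart preact_bound component_le_norm_cart norm_ge_zero \<delta> input_weight_ge_1] by (simp add: mult.assoc)
  qed auto
  then show ?thesis by (simp add: mult.assoc)
qed

lemma mlp_order3:
  assumes \<delta>: "norm \<delta> \<le> 1"
  shows "norm (mlp (W + \<delta>) z - mlp W z - mlp_lin W \<delta> z - mlp_quad W \<delta> z) \<le> taylor_const W * input_weight z ^ 3 * norm \<delta> ^ 3"
proof -
  let ?w = "input_weight z" and ?n = "norm \<delta>"
  have "norm (mlp (W + \<delta>) z - mlp W z - mlp_lin W \<delta> z - mlp_quad W \<delta> z) \<le> taylor_const W * (?w ^ 3 * ?n ^ 3)"
  proof (rule norm_layer_le[OF _ _ _ taylor_const_le[OF order_refl]])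
    show "(mlp (W + \<delta>) z - mlp W z - mlp_lin W \<delta> z - mlp_quad W \<delta> z) $ i =
      (\<Sum>j\<in>UNIV. (W $ Inl (i, Some j) + \<delta> $ Inl (i, Some j)) * tanh (preact W j z + preact \<delta> j z) - W $ Inl (i, Some j) * tanh (preact W j z)
        - (\<delta> $ Inl (i, Some j) * tanh (preact W j z) + W $ Inl (i, Some j) * preact \<delta> j z * tanh1 (preact W j z))
        - (\<delta> $ Inl (i, Some j) * preact \<delta> j z * tanh1 (preact W j z) + W $ Inl (i, Some j) * (preact \<delta> j z)\<^sup>2 * tanh2 (preact W j z) / 2)) + 0" for i
      by (simp add: mlp_nth mlp_lin_def mlp_quad_def preact_add sum_subtractf)
    show "\<bar>(W $ Inl (i, Some j) + \<delta> $ Inl (i, Some j)) * tanh (preact W j z + preact \<delta> j z) - W $ Inl (i, Some j) * tanh (preact W j z)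
        - (\<delta> $ Inl (i, Some j) * tanh (preact W j z) + W $ Inl (i, Some j) * preact \<delta> j z * tanh1 (preact W j z))
        - (\<delta> $ Inl (i, Some j) * preact \<delta> j z * tanh1 (preact W j z) + W $ Inl (i, Some j) * (preact \<delta> j z)\<^sup>2 * tanh2 (preact W j z) / 2)\<bar>
      \<le> (6 * norm W + 12) * (?w ^ 3 * ?n ^ 3)" for i j
      using unit_taylor(2)[OF component_le_norm_cart preact_bound component_le_norm_cart norm_ge_zero \<delta> input_weight_ge_1] by (simp add: mult.assoc)
    show "0 \<le> ?w ^ 3 * ?n ^ 3" using input_weight_ge_1[of z] by simp
    then show "\<bar>0\<bar> \<le> ?w ^ 3 * ?n ^ 3" by simp
  qed
  then show ?thesis by (simp add: mult.assoc)
qed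

lemma mlp_quad_scale: "mlp_quad W (t *\<^sub>R \<delta>) z = t\<^sup>2 *\<^sub>R mlp_quad W \<delta> z"
  by (simp add: mlp_quad_def vec_eq_iff preact_scale sum_distrib_left power2_eq_square algebra_simps)

text \<open>On the unit ball the argument increments are at most w. A difference of products or of
  squares of two such quantities is then at most a multiple of w^2 times the distance.\<close>

lemma mlp_quad_lipschitz:
  assumes \<delta>: "norm \<delta> \<le> 1" and \<delta>': "norm \<delta>' \<le> 1"
  shows "norm (mlp_quad W \<delta> z - mlp_quad W \<delta>' z) \<le> taylor_const W * (input_weight z)\<^sup>2 * norm (\<delta> - \<delta>')"
proof -
  let ?w = "input_weight z" and ?n = "norm (\<delta> - \<delta>')"
  have w: "1 \<le> ?w" by (rule input_weight_ge_1)
  have w2: "?w \<le> ?w\<^sup>2" using w by (simp add: power2_eq_square)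
  have "norm (mlp_quad W \<delta> z - mlp_quad W \<delta>' z) \<le> taylor_const W * (?w\<^sup>2 * ?n)"
  proof (rule norm_layer_le[OF _ _ _ taylor_const_le[of "2 + 2 * norm W"]])
    let ?p = "\<lambda>i j. (\<delta> $ Inl (i, Some j) * preact \<delta> j z - \<delta>' $ Inl (i, Some j) * preact \<delta>' j z) * tanh1 (preact W j z)
      + W $ Inl (i, Some j) * (((preact \<delta> j z)\<^sup>2 - (preact \<delta>' j z)\<^sup>2) * tanh2 (preact W j z) / 2)"
    show "(mlp_quad W \<delta> z - mlp_quad W \<delta>' z) $ i = (\<Sum>j\<in>UNIV. ?p i j) + 0" for i
      unfolding mlp_quad_def vector_minus_component vec_lambda_beta sum_subtractf[symmetric] add_0_right
      by (intro sum.cong refl) (simp add: algebra_simps diff_divide_distrib)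
    fix i j
    let ?s = "preact \<delta> j z" and ?s' = "preact \<delta>' j z" and ?a = "\<delta> $ Inl (i, Some j)" and ?a' = "\<delta>' $ Inl (i, Some j)"
    have s: "\<bar>?s\<bar> \<le> ?w" "\<bar>?s'\<bar> \<le> ?w"
    proof -
      have "norm \<delta> * ?w \<le> 1 * ?w" "norm \<delta>' * ?w \<le> 1 * ?w"
        using \<delta> \<delta>' w by (intro mult_right_mono; simp)+
      then show "\<bar>?s\<bar> \<le> ?w" "\<bar>?s'\<bar> \<le> ?w"
        using preact_bound[of \<delta> j z] preact_bound[of \<delta>' j z] by linarith+
    qed
    have ds: "\<bar>?s - ?s'\<bar> \<le> ?n * ?w" using preact_bound[of "\<delta> - \<delta>'" j z] by (simp add: preact_diff)
    have da: "\<bar>?a - ?a'\<bar> \<le> ?n" using component_le_norm_cart[of "\<delta> - \<delta>'"] by simp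
    have a: "\<bar>?a\<bar> \<le> 1" using component_le_norm_cart[of \<delta>] \<delta> order_trans by blast
    have "\<bar>?a * ?s - ?a' * ?s'\<bar> \<le> 2 * (?n * ?w)"
    proof -
      have "?a * ?s - ?a' * ?s' = ?a * (?s - ?s') + (?a - ?a') * ?s'" by (simp add: algebra_simps)
      moreover have "\<bar>?a * (?s - ?s')\<bar> \<le> 1 * (?n * ?w)" unfolding abs_mult using a ds by (intro mult_mono) auto
      moreover have "\<bar>(?a - ?a') * ?s'\<bar> \<le> ?n * ?w" unfolding abs_mult using da s by (intro mult_mono) auto
      ultimately show ?thesis by linarith
    qed
    then have 1: "\<bar>(?a * ?s - ?a' * ?s') * tanh1 (preact W j z)\<bar> \<le> 2 * (?n * ?w) * 1"
      unfolding abs_mult[of "_ - _"] using w by (intro mult_mono tanh_bounds) auto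
    have "\<bar>?s\<^sup>2 - ?s'\<^sup>2\<bar> \<le> (?n * ?w) * (2 * ?w)"
    proof -
      have "?s\<^sup>2 - ?s'\<^sup>2 = (?s - ?s') * (?s + ?s')" by (simp add: power2_eq_square algebra_simps)
      moreover have "\<bar>?s + ?s'\<bar> \<le> 2 * ?w" using s by linarith
      ultimately show ?thesis unfolding abs_mult using ds w by (simp only: abs_mult) (intro mult_mono, auto)
    qed
    then have "\<bar>(?s\<^sup>2 - ?s'\<^sup>2) * tanh2 (preact W j z)\<bar> \<le> (?n * ?w) * (2 * ?w) * 2"
      unfolding abs_mult[of "_ - _"] using w by (intro mult_mono tanh_bounds) auto
    then have "\<bar>W $ Inl (i, Some j) * ((?s\<^sup>2 - ?s'\<^sup>2) * tanh2 (preact W j z) / 2)\<bar> \<le> norm W * ((?n * ?w) * (2 * ?w))"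
      unfolding abs_mult[of "W $ _"] by (intro mult_mono component_le_norm_cart) auto
    then have "\<bar>?p i j\<bar> \<le> 2 * (?n * ?w) * 1 + norm W * ((?n * ?w) * (2 * ?w))" using 1 by linarith
    also have "\<dots> \<le> 2 * (?n * ?w\<^sup>2) * 1 + norm W * ((?n * ?w) * (2 * ?w))"
      using w2 w by (intro add_mono mult_right_mono mult_left_mono) auto
    also have "\<dots> = (2 + 2 * norm W) * (?w\<^sup>2 * ?n)" by (simp add: power2_eq_square algebra_simps)
    finally show "\<bar>?p i j\<bar> \<le> (2 + 2 * norm W) * (?w\<^sup>2 * ?n)" .
  qed auto
  then show ?thesis by (simp add: mult.assoc)
qed

lemma mlp_partial_bound: "norm (mlp_partial W k z) \<le> taylor_const W * input_weight z"
  unfolding mlp_partial_eq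
proof (rule norm_layer_le[OF _ _ _ taylor_const_le[of "1 + norm W"]])
  let ?w = "input_weight z"
  have w: "1 \<le> ?w" by (rule input_weight_ge_1)
  let ?\<delta> = "axis k 1 :: ('a, 'b, 'c) weights"
  have n: "norm ?\<delta> = 1" by simp
  let ?p = "\<lambda>i j. ?\<delta> $ Inl (i, Some j) * tanh (preact W j z) + W $ Inl (i, Some j) * preact ?\<delta> j z * tanh1 (preact W j z)"
  show "mlp_lin W ?\<delta> z $ i = (\<Sum>j\<in>UNIV. ?p i j) + ?\<delta> $ Inl (i, None)" for i
    by (simp add: mlp_lin_def)
  have c: "\<bar>?\<delta> $ q\<bar> \<le> 1" for q using component_le_norm_cart[of ?\<delta> q] by simp
  then show "\<bar>?\<delta> $ Inl (i, None)\<bar> \<le> ?w" for i using w order_trans by blast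
  show "\<bar>?p i j\<bar> \<le> (1 + norm W) * ?w" for i j
  proof -
    have "\<bar>?\<delta> $ Inl (i, Some j) * tanh (preact W j z)\<bar> \<le> 1 * 1"
      unfolding abs_mult by (intro mult_mono c tanh_bounds) auto
    moreover have "\<bar>W $ Inl (i, Some j) * preact ?\<delta> j z * tanh1 (preact W j z)\<bar> \<le> norm W * ?w * 1"
      unfolding abs_mult using w preact_bound[of ?\<delta> j z] by (intro mult_mono component_le_norm_cart tanh_bounds) auto
    ultimately show ?thesis using w by (simp add: algebra_simps)
  qed
  show "0 \<le> ?w" using w by simp
qed simp

section \<open>Measurability in the input\<close>

lemma continuous_on_preact: "continuous_on UNIV (preact W j)"
  unfolding preact_def by (intro continuous_intros)

lemma continuous_on_vecI: "(\<And>i. continuous_on S (\<lambda>x. f x $ i)) \<Longrightarrow> continuous_on S f"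
  using continuous_on_vec_lambda[of S "\<lambda>i x. f x $ i"] by simp

lemma mlp_measurable [measurable]: "mlp W \<in> borel_measurable borel"
  by (intro borel_measurable_continuous_onI continuous_on_vecI, unfold mlp_nth)
     (auto intro!: continuous_intros continuous_on_preact)

lemma continuous_on_tanh_derivatives: "continuous_on UNIV tanh1" "continuous_on UNIV tanh2"
  by (auto simp: tanh1_def[abs_def] tanh2_def[abs_def] intro!: continuous_intros)

lemma mlp_lin_measurable [measurable]: "mlp_lin W \<delta> \<in> borel_measurable borel"
proof (intro borel_measurable_continuous_onI continuous_on_vecI)
  show "continuous_on UNIV (\<lambda>z. mlp_lin W \<delta> z $ i)" for i
    unfolding mlp_lin_def vec_lambda_beta
    by (intro continuous_intros continuous_on_preact
        continuous_on_compose2[OF continuous_on_tanh_derivatives(1)]) auto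
qed

lemma mlp_quad_measurable [measurable]: "mlp_quad W \<delta> \<in> borel_measurable borel"
proof (intro borel_measurable_continuous_onI continuous_on_vecI)
  show "continuous_on UNIV (\<lambda>z. mlp_quad W \<delta> z $ i)" for i
    unfolding mlp_quad_def vec_lambda_beta
    by (intro continuous_intros continuous_on_preact
        continuous_on_compose2[OF continuous_on_tanh_derivatives(1)]
        continuous_on_compose2[OF continuous_on_tanh_derivatives(2)]) auto
qed

lemma mlp_partial_measurable [measurable]: "mlp_partial W k \<in> borel_measurable borel"
proof -
  have "mlp_partial W k = mlp_lin W (axis k 1)" by (simp add: fun_eq_iff mlp_partial_eq)
  then show ?thesis by simp
qed

lemma input_weight_measurable [measurable]: "input_weight \<in> borel_measurable borel"
  unfolding input_weight_def by measurable

section \<open>Estimation of perceptrons\<close>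

text \<open>Real images of the two variables generate smaller sigma-algebras, which inherit
  independence; for these two real variables the product rule for expectations is available,
  although \<open>X\<close> and \<open>Y\<close> have different types.\<close>

lemma (in prob_space) independent_rvs_product:
  fixes a :: "'b::topological_space \<Rightarrow> real" and b :: "'c::topological_space \<Rightarrow> real"
  assumes ind: "independent_rvs M X Y" and a: "a \<in> borel_measurable borel" and b: "b \<in> borel_measurable borel"
    and "integrable M (\<lambda>\<omega>. a (X \<omega>))" "integrable M (\<lambda>\<omega>. b (Y \<omega>))"
  shows "integrable M (\<lambda>\<omega>. a (X \<omega>) * b (Y \<omega>))"
    and "(LINT \<omega>|M. a (X \<omega>) * b (Y \<omega>)) = (LINT \<omega>|M. a (X \<omega>)) * (LINT \<omega>|M. b (Y \<omega>))"
proof -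
  have sub: "sigma_sets (space M) {(\<lambda>\<omega>. c (V \<omega>)) -` A \<inter> space M |A. A \<in> sets borel} \<subseteq> sets (vimage_algebra (space M) V borel)"
    if c: "c \<in> borel_measurable borel" for c :: "'v::topological_space \<Rightarrow> real" and V
  proof (rule sets.sigma_sets_subset')
    show "{(\<lambda>\<omega>. c (V \<omega>)) -` A \<inter> space M |A. A \<in> sets borel} \<subseteq> sets (vimage_algebra (space M) V borel)"
    proof clarify
      fix A :: "real set" assume "A \<in> sets borel"
      then have "c -` A \<in> sets borel" using measurable_sets[OF c] by simp
      from in_vimage_algebra[OF this, of V "space M"]
      show "(\<lambda>\<omega>. c (V \<omega>)) -` A \<inter> space M \<in> sets (vimage_algebra (space M) V borel)"
        by (simp add: vimage_def)
    qed
    show "space M \<in> sets (vimage_algebra (space M) V borel)"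
      using sets.top[of "vimage_algebra (space M) V borel"] by simp
  qed
  have ms: "X \<in> borel_measurable M" "Y \<in> borel_measurable M"
    and ind': "indep_set (sets (vimage_algebra (space M) X borel)) (sets (vimage_algebra (space M) Y borel))"
    using ind by (auto simp: independent_rvs_def)
  have "indep_var borel (\<lambda>\<omega>. a (X \<omega>)) borel (\<lambda>\<omega>. b (Y \<omega>))"
    unfolding indep_var_eq
  proof (intro conjI)
    show "(\<lambda>\<omega>. a (X \<omega>)) \<in> borel_measurable M" "(\<lambda>\<omega>. b (Y \<omega>)) \<in> borel_measurable M"
      using ms a b by measurable
    show "indep_set (sigma_sets (space M) {(\<lambda>\<omega>. a (X \<omega>)) -` A \<inter> space M |A. A \<in> sets borel})
      (sigma_sets (space M) {(\<lambda>\<omega>. b (Y \<omega>)) -` A \<inter> space M |A. A \<in> sets borel})"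
      unfolding indep_set_def
      by (rule indep_sets_mono_sets[OF ind'[unfolded indep_set_def]])
         (use sub[OF a, of X] sub[OF b, of Y] in \<open>auto split: bool.split\<close>)
  qed
  from indep_var_integrable[OF this assms(4,5)] indep_var_lebesgue_integral[OF this assms(4,5)]
  show "integrable M (\<lambda>\<omega>. a (X \<omega>) * b (Y \<omega>))"
    and "(LINT \<omega>|M. a (X \<omega>) * b (Y \<omega>)) = (LINT \<omega>|M. a (X \<omega>)) * (LINT \<omega>|M. b (Y \<omega>))" .
qed

lemma integrable_vecI:
  fixes f :: "'a \<Rightarrow> 'b::euclidean_space ^ 'n"
  assumes "\<And>i. integrable M (\<lambda>x. f x $ i)"
  shows "integrable M f"
proof -
  have eq: "f = (\<lambda>x. \<Sum>i\<in>UNIV. axis i (f x $ i))"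
    by (simp add: fun_eq_iff vec_eq_iff axis_def)
  have lin: "bounded_linear (axis i :: 'b \<Rightarrow> 'b ^ 'n)" for i
    by (intro linear_conv_bounded_linear[THEN iffD1] linearI) (auto simp: vec_eq_iff axis_def)
  show ?thesis
    by (subst eq) (rule Bochner_Integration.integrable_sum, rule integrable_bounded_linear[OF lin assms])
qed

lemma integral_vec_nth: "integrable M f \<Longrightarrow> (LINT x|M. f x) $ i = (LINT x|M. f x $ i)"
  for f :: "'a \<Rightarrow> 'b::euclidean_space ^ 'n"
  using integral_bounded_linear[OF bounded_linear_vec_nth, of M f i] by simp

lemma integral_outer_nth:
  fixes u :: "'a \<Rightarrow> real ^ 'm" and v :: "'a \<Rightarrow> real ^ 'n"
  assumes "\<And>i j. integrable M (\<lambda>x. u x $ i * v x $ j)"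
  shows "(LINT x|M. outer (u x) (v x)) $ i $ j = (LINT x|M. u x $ i * v x $ j)"
proof -
  have 1: "integrable M (\<lambda>x. outer (u x) (v x) $ i)" for i
    by (rule integrable_vecI) (simp add: outer_def assms)
  then have "integrable M (\<lambda>x. outer (u x) (v x))" by (rule integrable_vecI)
  then show ?thesis by (simp add: integral_vec_nth 1) (simp add: outer_def)
qed

lemma (in prob_space) square_integrable_vec:
  fixes X :: "'a \<Rightarrow> real ^ 'n"
  assumes [measurable]: "X \<in> borel_measurable M" and sq: "integrable M (\<lambda>\<omega>. (norm (X \<omega>))\<^sup>2)"
  shows "integrable M X" "integrable M (\<lambda>\<omega>. X \<omega> $ i * X \<omega> $ j)"
proof -
  have "integrable M (\<lambda>\<omega>. norm (X \<omega>))"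
    by (rule square_integrable_imp_integrable[OF _ sq]) measurable
  then show "integrable M X" by (simp add: integrable_norm_iff)
  show "integrable M (\<lambda>\<omega>. X \<omega> $ i * X \<omega> $ j)"
  proof (rule Bochner_Integration.integrable_bound[OF sq])
    show "AE \<omega> in M. norm (X \<omega> $ i * X \<omega> $ j) \<le> norm ((norm (X \<omega>))\<^sup>2)"
      unfolding real_norm_def abs_mult power2_eq_square
      by (intro AE_I2) (simp add: mult_mono component_le_norm_cart)
  qed measurable
qed

lemma (in prob_space) covariance_matrix_centered:
  fixes X :: "'a \<Rightarrow> real ^ 'n"
  assumes "X \<in> borel_measurable M" "integrable M (\<lambda>\<omega>. (norm (X \<omega>))\<^sup>2)" "(LINT \<omega>|M. X \<omega>) = 0"
  shows "covariance_matrix M X $ i $ j = (LINT \<omega>|M. X \<omega> $ i * X \<omega> $ j)"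
  using assms(3) square_integrable_vec(2)[OF assms(1,2)]
  by (simp add: covariance_matrix_def Let_def integral_outer_nth)

text \<open>The form at v is the expectation of (v \<bullet> X)^2, hence nonnegative. A zero value
  puts v into the kernel of a semidefinite matrix, which invertibility excludes.\<close>

lemma (in prob_space) covariance_matrix_positive_definite:
  fixes X :: "'a \<Rightarrow> real ^ 'n"
  assumes X: "X \<in> borel_measurable M" "integrable M (\<lambda>\<omega>. (norm (X \<omega>))\<^sup>2)" "(LINT \<omega>|M. X \<omega>) = 0"
    and inv: "invertible (covariance_matrix M X)"
  shows "positive_definite (covariance_matrix M X)"
proof -
  let ?A = "covariance_matrix M X"
  note entry = covariance_matrix_centered[OF X]
  note int = square_integrable_vec(2)[OF X(1,2)]
  have sym: "transpose ?A = ?A" by (simp add: transpose_def vec_eq_iff entry mult.commute)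
  have psd: "0 \<le> v \<bullet> (?A *v v)" for v
  proof -
    have "v \<bullet> (?A *v v) = (\<Sum>i\<in>UNIV. \<Sum>j\<in>UNIV. (v $ i * v $ j) * (LINT \<omega>|M. X \<omega> $ i * X \<omega> $ j))"
      by (simp add: inner_matrix_vector_sum entry mult.commute)
    also have "\<dots> = (LINT \<omega>|M. (\<Sum>i\<in>UNIV. \<Sum>j\<in>UNIV. (v $ i * v $ j) * (X \<omega> $ i * X \<omega> $ j)))"
      by (simp add: int)
    also have "(\<lambda>\<omega>. \<Sum>i\<in>UNIV. \<Sum>j\<in>UNIV. (v $ i * v $ j) * (X \<omega> $ i * X \<omega> $ j)) = (\<lambda>\<omega>. (v \<bullet> X \<omega>)\<^sup>2)"
      by (simp add: fun_eq_iff inner_vec_def power2_eq_square sum_product mult_ac)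
    finally show ?thesis by simp
  qed
  have "0 < v \<bullet> (?A *v v)" if "v \<noteq> 0" for v
  proof -
    have "v \<bullet> (?A *v v) \<noteq> 0"
    proof
      assume "v \<bullet> (?A *v v) = 0"
      then have "?A *v v = 0" by (rule psd_kernel[OF sym psd])
      moreover obtain B where "B ** ?A = mat 1" using inv by (auto simp: invertible_def)
      ultimately have "v = 0" by (metis matrix_vector_mul_assoc matrix_vector_mul_lid matrix_vector_mult_0_right)
      with that show False by simp
    qed
    then show ?thesis using psd[of v] by simp
  qed
  then show ?thesis using sym by (simp add: positive_definite_def)
qed

lemma input_weight_cube_le: "input_weight z ^ 3 \<le> 4 + 4 * (real CARD('l)) ^ 3 * norm z ^ 3" for z :: "real ^ 'l"
proof -
  define y where "y = real CARD('l) * norm z"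
  have "y \<ge> 0" by (simp add: y_def)
  \<comment> \<open>The difference 4 (1 + y^3) - (1 + y)^3 factors as 3 (y - 1)^2 (y + 1). This
    reduces the cube of the weight to the third moment of Z.\<close>
  have "0 \<le> 3 * ((y - 1)\<^sup>2 * (y + 1))" using \<open>y \<ge> 0\<close> by simp
  also have "\<dots> = 4 + 4 * y ^ 3 - (1 + y) ^ 3" by (simp add: power2_eq_square power3_eq_cube algebra_simps)
  finally show ?thesis by (simp add: input_weight_def y_def power_mult_distrib)
qed

text \<open>Only the determinants matter for the comparison of costs: the logarithm is monotone, and the
  value \<open>- \<infinity>\<close> is attained exactly at the nonpositive determinants.\<close>

lemma mlp_cost_argmin:
  assumes min: "is_arg_min (mlp_cost y z n) (\<lambda>W. W \<in> \<Theta>) V" and W: "W \<in> \<Theta>"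
    and S: "\<And>U. S U = det ((1 / real n) *\<^sub>R (\<Sum>t=1..n. outer (y t - mlp U (z t)) (y t - mlp U (z t))))"
    and pos: "0 < S W"
  shows "S V \<le> S W"
proof (rule ccontr)
  have cost: "mlp_cost y z n U = (if 0 < S U then ereal (ln (S U)) else - \<infinity>)" for U
    unfolding mlp_cost_def Let_def S ..
  assume "\<not> S V \<le> S W"
  then have "mlp_cost y z n W < mlp_cost y z n V"
    using pos by (simp add: cost)
  then show False using min W by (auto simp: is_arg_min_def)
qed

text \<open>The quotient is expressed through representatives: the estimator is the member of the
  minimising class nearest to \<open>W\<^sub>0\<close>, and the interior condition concerns all
  weight vectors equivalent to an admissible one. Near \<open>W\<^sub>0\<close> minimality therefore
  holds against every displacement.\<close>

theorem proposition1:
  fixes M :: "'w measure"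
    and Y \<epsilon> :: "nat \<Rightarrow> 'w \<Rightarrow> real ^ 'd::finite"
    and Z :: "nat \<Rightarrow> 'w \<Rightarrow> real ^ 'l::finite"
    and Yg :: "'w \<Rightarrow> real ^ 'd"
    and Zg :: "'w \<Rightarrow> real ^ 'l"
    and \<Gamma>\<^sub>0 :: "real ^ 'd ^ 'd"
    and \<Theta> :: "('d, 'h::finite, 'l) weights set"
    and W\<^sub>0 :: "('d, 'h, 'l) weights"
    and What :: "nat \<Rightarrow> 'w \<Rightarrow> ('d, 'h, 'l) weights"
  defines "I\<^sub>0 \<equiv> mlp_information M Zg \<Gamma>\<^sub>0 W\<^sub>0"
  assumes prob: "prob_space M"
    and data_iid: "iid M (\<lambda>t \<omega>. (Y t \<omega>, Z t \<omega>))"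
    and generic_measurable: "Yg \<in> borel_measurable M" "Zg \<in> borel_measurable M"
    and generic_law: "\<And>t. distr M borel (\<lambda>\<omega>. (Y t \<omega>, Z t \<omega>)) = distr M borel (\<lambda>\<omega>. (Yg \<omega>, Zg \<omega>))"
    and model: "\<And>t \<omega>. \<omega> \<in> space M \<Longrightarrow> Y t \<omega> = mlp W\<^sub>0 (Z t \<omega>) + \<epsilon> t \<omega>"
    and noise_iid: "iid M \<epsilon>"
    and noise_indep: "\<And>t. independent_rvs M (\<epsilon> t) (Z t)"
    and noise_square_integrable: "\<And>t. integrable M (\<lambda>\<omega>. (norm (\<epsilon> t \<omega>))^2)"
    and noise_centered: "\<And>t. (LINT \<omega>|M. \<epsilon> t \<omega>) = 0"
    and noise_covariance: "\<And>t. covariance_matrix M (\<epsilon> t) = \<Gamma>\<^sub>0"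
    and covariance_invertible: "invertible \<Gamma>\<^sub>0"
    and Z_cube_integrable: "integrable M (\<lambda>\<omega>. (norm (Zg \<omega>))^3)"
    and parameters_compact: "compact \<Theta>"
    and true_parameter: "W\<^sub>0 \<in> \<Theta>"
    and true_parameter_interior: "W\<^sub>0 \<in> interior (mlp_saturation \<Theta>)"
    and identifiable: "\<And>W. W \<in> \<Theta> \<Longrightarrow> (AE \<omega> in M. mlp W (Zg \<omega>) = mlp W\<^sub>0 (Zg \<omega>)) \<Longrightarrow> mlp_equiv W W\<^sub>0"
    and hessian_definite: "positive_definite (2 *\<^sub>R I\<^sub>0)"
    and estimator_measurable: "\<And>n. What n \<in> borel_measurable M"
    and estimator_argmin: "\<And>n \<omega>. \<omega> \<in> space M \<Longrightarrow>
      \<exists>V. is_arg_min (mlp_cost (\<lambda>t. Y t \<omega>) (\<lambda>t. Z t \<omega>) n) (\<lambda>W. W \<in> \<Theta>) V \<and> mlp_equiv V (What n \<omega>)"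
    and estimator_closest: "\<And>n \<omega>. \<omega> \<in> space M \<Longrightarrow> closest_representative W\<^sub>0 (What n \<omega>)"
  shows "converges_in_law M (\<lambda>n \<omega>. sqrt (real n) *\<^sub>R (What n \<omega> - W\<^sub>0))
           (multivariate_normal 0 (matrix_inv I\<^sub>0))"
proof -
  interpret P: prob_space M by (rule prob)
  \<comment> \<open>Subtracting the true function recovers the noise. The pairs of noise and
    regressor are thus one measurable image of the data and inherit their joint
    independence.\<close>
  define \<phi> where "\<phi> p = (fst p - mlp W\<^sub>0 (snd p), snd p)" for p :: "(real ^ 'd) \<times> (real ^ 'l)"
  have \<phi>_measurable [measurable]: "\<phi> \<in> borel_measurable borel"
    unfolding \<phi>_def by (intro borel_measurable_Pair) measurable
  define x where "x t \<omega> = \<phi> (Y t \<omega>, Z t \<omega>)" for t \<omega>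
  have YZ [measurable]: "(\<lambda>\<omega>. (Y t \<omega>, Z t \<omega>)) \<in> borel_measurable M" for t
    using data_iid unfolding iid_def P.indep_vars_def by auto
  have Y [measurable]: "Y t \<in> borel_measurable M" for t
    using measurable_compose[OF YZ measurable_fst_borel, of t] by simp
  have Z [measurable]: "Z t \<in> borel_measurable M" for t
    using measurable_compose[OF YZ measurable_snd_borel, of t] by simp
  have eps [measurable]: "\<epsilon> t \<in> borel_measurable M" for t
    using noise_indep[of t] by (simp add: independent_rvs_def)
  note generic_measurable [measurable]
  have x_eq: "x t \<omega> = (\<epsilon> t \<omega>, Z t \<omega>)" if "\<omega> \<in> space M" for t \<omega>
    using model[OF that, of t] by (simp add: x_def \<phi>_def)
  have snd_x: "snd (x t \<omega>) = Z t \<omega>" for t \<omega> by (simp add: x_def \<phi>_def)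
  have Z_law: "distr M borel (Z t) = distr M borel Zg" for t
  proof -
    have gm: "(\<lambda>\<omega>. (Yg \<omega>, Zg \<omega>)) \<in> borel_measurable M" by (intro borel_measurable_Pair) measurable
    have "distr M borel (Z t) = distr (distr M borel (\<lambda>\<omega>. (Y t \<omega>, Z t \<omega>))) borel snd"
      by (subst distr_distr) (auto simp: comp_def)
    also have "\<dots> = distr M borel Zg"
      unfolding generic_law using gm by (subst distr_distr) (auto simp: comp_def)
    finally show ?thesis .
  qed
  interpret X: iid_sequence M x
  proof
    have "P.indep_vars (\<lambda>_. borel) (\<lambda>t \<omega>. (Y t \<omega>, Z t \<omega>)) UNIV" using data_iid by (simp add: iid_def)
    from P.indep_vars_compose2[OF this, of "\<lambda>_. \<phi>" "\<lambda>_. borel"]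
    show "P.indep_vars (\<lambda>_. borel) x UNIV" by (simp add: x_def[abs_def])
    have "distr M borel (x t) = distr (distr M borel (\<lambda>\<omega>. (Y t \<omega>, Z t \<omega>))) borel \<phi>" for t
      unfolding x_def by (subst distr_distr) (auto simp: comp_def)
    then show "distr M borel (x t) = distr M borel (x 0)" for t by (simp only: generic_law)
  qed
  \<comment> \<open>The recovered noise agrees with \<epsilon> on the space of \<open>M\<close>,
    which is all that integrals see. Index 0 serves as the generic observation.\<close>
  have expect: "X.expect f = (LINT \<omega>|M. f (\<epsilon> 0 \<omega>, Z 0 \<omega>))" for f :: "(real ^ 'd) \<times> (real ^ 'l) \<Rightarrow> real"
    unfolding X.expect_def by (intro Bochner_Integration.integral_cong) (auto simp: x_eq)
  have integ: "X.integ f \<longleftrightarrow> f \<in> borel_measurable borel \<and> integrable M (\<lambda>\<omega>. f (\<epsilon> 0 \<omega>, Z 0 \<omega>))" for f :: "(real ^ 'd) \<times> (real ^ 'l) \<Rightarrow> real"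
    unfolding X.integ_def by (intro conj_cong refl Bochner_Integration.integrable_cong) (auto simp: x_eq)
  have Z_integrable: "integrable M (\<lambda>\<omega>. f (Z 0 \<omega>)) \<longleftrightarrow> integrable M (\<lambda>\<omega>. f (Zg \<omega>))"
    and Z_integral: "(LINT \<omega>|M. f (Z 0 \<omega>)) = (LINT \<omega>|M. f (Zg \<omega>))"
    if [measurable]: "f \<in> borel_measurable borel" for f :: "real ^ 'l \<Rightarrow> real"
    using integrable_distr_eq[of "Z 0" M borel f] integrable_distr_eq[of Zg M borel f]
      integral_distr[of "Z 0" M borel f] integral_distr[of Zg M borel f]
    by (simp_all add: Z_law)
  have "integrable M (\<lambda>\<omega>. input_weight (Z 0 \<omega>) ^ 3)"
  proof (rule Bochner_Integration.integrable_bound)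
    have "integrable M (\<lambda>\<omega>. norm (Z 0 \<omega>) ^ 3)"
      using Z_cube_integrable by (subst Z_integrable) auto
    then show "integrable M (\<lambda>\<omega>. 4 + 4 * (real CARD('l)) ^ 3 * norm (Z 0 \<omega>) ^ 3)" by simp
    show "AE \<omega> in M. norm (input_weight (Z 0 \<omega>) ^ 3) \<le> norm (4 + 4 * (real CARD('l)) ^ 3 * norm (Z 0 \<omega>) ^ 3)"
    proof (rule AE_I2)
      fix \<omega>
      have "0 \<le> input_weight (Z 0 \<omega>)" using input_weight_ge_1[of "Z 0 \<omega>"] by linarith
      then show "norm (input_weight (Z 0 \<omega>) ^ 3) \<le> norm (4 + 4 * (real CARD('l)) ^ 3 * norm (Z 0 \<omega>) ^ 3)"
        using input_weight_cube_le[of "Z 0 \<omega>"] by simp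
    qed
  qed measurable
  then have weight_cube: "X.integ (\<lambda>p. input_weight (snd p) ^ 3)" by (simp add: integ)
  have mean: "(LINT \<omega>|M. \<epsilon> 0 \<omega> $ i) = 0" for i
    using integral_vec_nth[OF P.square_integrable_vec(1)[OF eps noise_square_integrable], of 0 i] noise_centered[of 0] by simp
  have cov: "(LINT \<omega>|M. \<epsilon> 0 \<omega> $ i * \<epsilon> 0 \<omega> $ j) = \<Gamma>\<^sub>0 $ i $ j" for i j
    using P.covariance_matrix_centered[OF eps noise_square_integrable noise_centered, of 0 i j] noise_covariance[of 0] by simp
  have \<Gamma>_pd: "positive_definite \<Gamma>\<^sub>0"
    using P.covariance_matrix_positive_definite[OF eps noise_square_integrable noise_centered, of 0]
      covariance_invertible noise_covariance[of 0] by simp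
  \<comment> \<open>Displacements are measured from \<open>W\<^sub>0\<close>, which turns the truth
    into \<delta> = 0.\<close>
  define D where "D \<delta> z = mlp (W\<^sub>0 + \<delta>) z - mlp W\<^sub>0 z" for \<delta> z
  interpret R: smooth_regression M x \<Gamma>\<^sub>0 input_weight D "mlp_partial W\<^sub>0" "mlp_quad W\<^sub>0" "taylor_const W\<^sub>0"
  proof
    fix a :: "real ^ 'd \<Rightarrow> real" and b :: "real ^ 'l \<Rightarrow> real"
    assume a [measurable]: "a \<in> borel_measurable borel" and b [measurable]: "b \<in> borel_measurable borel"
      and "X.integ (\<lambda>x. a (fst x))" "X.integ (\<lambda>x. b (snd x))"
    then have i: "integrable M (\<lambda>\<omega>. a (\<epsilon> 0 \<omega>))" "integrable M (\<lambda>\<omega>. b (Z 0 \<omega>))"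
      by (simp_all add: integ)
    note p = P.independent_rvs_product[OF noise_indep[of 0] a b i]
    have "(\<lambda>x :: (real ^ 'd) \<times> (real ^ 'l). a (fst x) * b (snd x)) \<in> borel_measurable borel" by measurable
    then show "X.integ (\<lambda>x. a (fst x) * b (snd x)) \<and> X.expect (\<lambda>x. a (fst x) * b (snd x)) = X.expect (\<lambda>x. a (fst x)) * X.expect (\<lambda>x. b (snd x))"
      using p by (simp add: integ expect)
  next
    show "X.integ (\<lambda>x. (norm (fst x))\<^sup>2)"
      using noise_square_integrable[of 0] by (simp add: integ)
    show "norm (D \<delta> z) \<le> taylor_const W\<^sub>0 * input_weight z * norm \<delta>" for \<delta> z
      unfolding D_def by (rule mlp_order1)
    show "norm (D \<delta> z - (\<Sum>k\<in>UNIV. \<delta> $ k *\<^sub>R mlp_partial W\<^sub>0 k z)) \<le> taylor_const W\<^sub>0 * (input_weight z)\<^sup>2 * (norm \<delta>)\<^sup>2"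
      if "norm \<delta> \<le> 1" for \<delta> z
      unfolding D_def mlp_lin_partial[symmetric] by (rule mlp_order2[OF that])
    show "norm (D \<delta> z - (\<Sum>k\<in>UNIV. \<delta> $ k *\<^sub>R mlp_partial W\<^sub>0 k z) - mlp_quad W\<^sub>0 \<delta> z) \<le> taylor_const W\<^sub>0 * input_weight z ^ 3 * norm \<delta> ^ 3"
      if "norm \<delta> \<le> 1" for \<delta> z
      unfolding D_def mlp_lin_partial[symmetric] by (rule mlp_order3[OF that])
    show "D \<delta> \<in> borel_measurable borel" for \<delta>
      unfolding D_def[abs_def] by measurable
  qed (simp_all add: input_weight_ge_1 weight_cube expect mean cov \<Gamma>_pd taylor_const_nonneg
      mlp_partial_bound mlp_quad_scale mlp_quad_lipschitz)
  have info: "R.information = I\<^sub>0"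
  proof -
    have "R.information $ k $ l = I\<^sub>0 $ k $ l" for k l
    proof -
      let ?u = "mlp_partial W\<^sub>0 k" and ?v = "mlp_partial W\<^sub>0 l"
      have i0: "integrable M (\<lambda>\<omega>. ?u (Z 0 \<omega>) $ i * ?v (Z 0 \<omega>) $ j)" for i j
        using R.g_product[of k i l j] by (simp add: integ)
      have m: "(\<lambda>z. ?u z $ i * ?v z $ j) \<in> borel_measurable borel" for i j by measurable
      have ig: "integrable M (\<lambda>\<omega>. ?u (Zg \<omega>) $ i * ?v (Zg \<omega>) $ j)" for i j
        using i0[of i j] Z_integrable[OF m] by simp
      have eq: "(LINT \<omega>|M. ?u (Z 0 \<omega>) $ i * ?v (Z 0 \<omega>) $ j) = (LINT \<omega>|M. ?u (Zg \<omega>) $ i * ?v (Zg \<omega>) $ j)" for i j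
        by (rule Z_integral[OF m])
      have "R.information $ k $ l = (\<Sum>i\<in>UNIV. \<Sum>j\<in>UNIV. R.P $ i $ j * (LINT \<omega>|M. ?u (Zg \<omega>) $ i * ?v (Zg \<omega>) $ j))"
        by (simp add: R.information_def expect inner_matrix_vector_sum i0 eq)
      \<comment> \<open>The trace of a matrix product pairs entry (j, i) of \<open>P\<close> with
        entry (i, j) of the moment matrix; exchanging the sums and the symmetry of \<open>P\<close>
        match the two conventions.\<close>
      also have "\<dots> = (\<Sum>j\<in>UNIV. \<Sum>i\<in>UNIV. R.P $ i $ j * (LINT \<omega>|M. ?u (Zg \<omega>) $ i * ?v (Zg \<omega>) $ j))"
        by (rule sum.swap)
      also have "\<dots> = (\<Sum>j\<in>UNIV. \<Sum>i\<in>UNIV. R.P $ j $ i * (LINT \<omega>|M. ?u (Zg \<omega>) $ i * ?v (Zg \<omega>) $ j))"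
        by (intro sum.cong refl) (simp add: R.P_nth_commute)
      also have "\<dots> = I\<^sub>0 $ k $ l"
        by (simp add: I\<^sub>0_def mlp_information_def trace_def matrix_matrix_mult_def integral_outer_nth[OF ig])
      finally show ?thesis .
    qed
    then show ?thesis by (simp add: vec_eq_iff)
  qed
  \<comment> \<open>The hypothesis concerns the Hessian, which is twice the information; the factor
    is removed.\<close>
  have pd: "positive_definite R.information"
  proof -
    have "transpose (2 *\<^sub>R I\<^sub>0) = 2 *\<^sub>R transpose I\<^sub>0" by (simp add: transpose_def vec_eq_iff)
    moreover have "x \<bullet> ((2 *\<^sub>R I\<^sub>0) *v x) = 2 * (x \<bullet> (I\<^sub>0 *v x))" for x
      by (simp add: scaleR_matrix_vector_assoc[symmetric])
    ultimately show ?thesis using hessian_definite by (simp add: info positive_definite_def)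
  qed
  have emp_cov: "R.emp_cov n (\<lambda>z. mlp U z - mlp W\<^sub>0 z) \<omega> = (1 / real n) *\<^sub>R (\<Sum>t=1..n. outer (Y t \<omega> - mlp U (Z t \<omega>)) (Y t \<omega> - mlp U (Z t \<omega>)))"
    for n \<omega> and U :: "('d, 'h, 'l) weights"
    by (simp add: R.emp_cov_def R.residual_def X.emp_def x_def \<phi>_def)
  define S where "S n \<omega> U = det (R.emp_cov n (\<lambda>z. mlp U z - mlp W\<^sub>0 z) \<omega>)" for n \<omega> and U :: "('d, 'h, 'l) weights"
  have S_D: "det (R.emp_cov n (D \<delta>) \<omega>) = S n \<omega> (W\<^sub>0 + \<delta>)" for n \<omega> \<delta>
    by (simp add: S_def D_def[abs_def])
  have S_equiv: "S n \<omega> V = S n \<omega> W" if "mlp_equiv V W" for n \<omega> V W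
    using mlp_equiv_mlp[OF that] by (simp add: S_def)
  have argmin: "\<exists>V\<in>\<Theta>. mlp_equiv V (What n \<omega>) \<and> (\<forall>W\<in>\<Theta>. 0 < S n \<omega> W \<longrightarrow> S n \<omega> V \<le> S n \<omega> W)"
    if \<omega>: "\<omega> \<in> space M" for n \<omega>
  proof -
    obtain V where V: "is_arg_min (mlp_cost (\<lambda>t. Y t \<omega>) (\<lambda>t. Z t \<omega>) n) (\<lambda>W. W \<in> \<Theta>) V" "mlp_equiv V (What n \<omega>)"
      using estimator_argmin[OF \<omega>] by blast
    have "S n \<omega> V \<le> S n \<omega> W" if "W \<in> \<Theta>" "0 < S n \<omega> W" for W
      by (rule mlp_cost_argmin[where S = "S n \<omega>", OF V(1) that(1) _ that(2)]) (simp add: S_def emp_cov)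
    moreover have "V \<in> \<Theta>" using V(1) by (simp add: is_arg_min_def)
    ultimately show ?thesis using V(2) by blast
  qed
  obtain B where B: "\<And>W. W \<in> \<Theta> \<Longrightarrow> norm W \<le> B"
    using compact_imp_bounded[OF parameters_compact] by (auto simp: bounded_iff)
  have "0 \<le> B" using B[OF true_parameter] norm_ge_zero[of W\<^sub>0] by linarith
  \<comment> \<open>One constant has to serve as Lipschitz constant on \<Theta> and as bound for the
    increments themselves; the factor \<open>1 + 2 * B\<close> covers the diameter and is at least
    1.\<close>
  define c where "c = real CARD('d) * (real CARD('h) * (1 + B) + 1) * (1 + 2 * B)"
  have c0: "0 \<le> real CARD('d) * (real CARD('h) * (1 + B) + 1)" using \<open>0 \<le> B\<close> by simp
  have c_ge: "real CARD('d) * (real CARD('h) * (1 + B) + 1) \<le> c"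
    unfolding c_def using \<open>0 \<le> B\<close> mult_left_mono[OF _ c0, of 1 "1 + 2 * B"] by simp
  have "0 \<le> c" using c0 c_ge by linarith
  \<comment> \<open>Read off the expansion at \<delta> = 0, where any \<rho> will do. It makes the
    minimiser comparable with \<open>W\<^sub>0\<close>, since the cost of a singular matrix is minus
    infinity.\<close>
  have positive: "P.asymptotically_certain (\<lambda>n \<omega>. 0 < S n \<omega> W\<^sub>0)"
    unfolding P.asymptotically_certain_def
  proof (intro allI impI)
    fix \<kappa> :: real assume "\<kappa> > 0"
    obtain \<eta> where "0 < \<eta>" "P.likely \<kappa> (R.quadratic_expansion 1 \<eta>)"
      by (rule R.local_expansion[OF zero_less_one \<open>\<kappa> > 0\<close>])
    then show "P.likely \<kappa> (\<lambda>n \<omega>. 0 < S n \<omega> W\<^sub>0)"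
    proof (elim P.likely_mono)
      show "\<forall>\<^sub>F n in sequentially. \<forall>\<omega>\<in>space M. R.quadratic_expansion 1 \<eta> n \<omega> \<longrightarrow> 0 < S n \<omega> W\<^sub>0"
      proof (intro always_eventually allI ballI impI)
        fix n \<omega>
        assume *: "R.quadratic_expansion 1 \<eta> n \<omega>"
        show "0 < S n \<omega> W\<^sub>0" using *[unfolded R.quadratic_expansion_def, rule_format, of 0] \<open>0 < \<eta>\<close> by (simp add: S_D)
      qed
    qed simp
  qed
  have consistent: "P.asymptotically_certain (\<lambda>n \<omega>. norm (What n \<omega> - W\<^sub>0) \<le> \<eta>)" if "\<eta> > 0" for \<eta>
  proof -
    have "P.asymptotically_certain (\<lambda>n \<omega>. \<forall>V\<in>\<Theta>. det (R.emp_cov n (\<lambda>z. mlp V z - mlp W\<^sub>0 z) \<omega>) \<le> det (R.emp_cov n (\<lambda>z. mlp W\<^sub>0 z - mlp W\<^sub>0 z) \<omega>) \<longrightarrow>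
     (\<exists>V'\<in>\<Theta>. (AE \<omega> in M. mlp V' (snd (x 0 \<omega>)) - mlp W\<^sub>0 (snd (x 0 \<omega>)) = 0) \<and> dist V V' < \<eta>))"
    proof (rule R.consistency[OF parameters_compact _ _ \<open>0 \<le> c\<close> _ true_parameter _ \<open>\<eta> > 0\<close>])
      show "(\<lambda>z. mlp W z - mlp W\<^sub>0 z) \<in> borel_measurable borel" for W :: "('d, 'h, 'l) weights" by measurable
      show "norm (mlp W z - mlp W\<^sub>0 z) \<le> c * input_weight z" if W: "W \<in> \<Theta>" for W z
      proof -
        have "norm (mlp W z - mlp W\<^sub>0 z) \<le> real CARD('d) * (real CARD('h) * (1 + B) + 1) * input_weight z * norm (W - W\<^sub>0)"
          by (rule mlp_lipschitz[OF B[OF true_parameter] order_refl])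
        also have "\<dots> \<le> real CARD('d) * (real CARD('h) * (1 + B) + 1) * input_weight z * (1 + 2 * B)"
        proof (intro mult_left_mono mult_nonneg_nonneg[OF c0])
          show "norm (W - W\<^sub>0) \<le> 1 + 2 * B" using norm_triangle_ineq4[of W W\<^sub>0] B[OF W] B[OF true_parameter] by linarith
          show "0 \<le> input_weight z" using input_weight_ge_1[of z] by linarith
        qed
        finally show ?thesis by (simp add: c_def mult_ac)
      qed
      show "norm (mlp W z - mlp W\<^sub>0 z - (mlp V z - mlp W\<^sub>0 z)) \<le> c * input_weight z * dist W V" if "W \<in> \<Theta>" "V \<in> \<Theta>" for W V z
        using mlp_lipschitz[OF B[OF that(2)] c_ge, of W z] by (simp add: dist_norm)
    qed simp
    from P.asymptotically_certain_conj[OF this positive] show ?thesis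
    proof (rule P.asymptotically_certain_mono', elim conjE)
      fix n \<omega> assume \<omega>: "\<omega> \<in> space M" and pos: "0 < S n \<omega> W\<^sub>0"
        and near: "\<forall>V\<in>\<Theta>. det (R.emp_cov n (\<lambda>z. mlp V z - mlp W\<^sub>0 z) \<omega>) \<le> det (R.emp_cov n (\<lambda>z. mlp W\<^sub>0 z - mlp W\<^sub>0 z) \<omega>) \<longrightarrow>
     (\<exists>V'\<in>\<Theta>. (AE \<omega> in M. mlp V' (snd (x 0 \<omega>)) - mlp W\<^sub>0 (snd (x 0 \<omega>)) = 0) \<and> dist V V' < \<eta>)"
      obtain V where V: "V \<in> \<Theta>" "mlp_equiv V (What n \<omega>)" "S n \<omega> V \<le> S n \<omega> W\<^sub>0"
        using argmin[OF \<omega>, of n] true_parameter pos by blast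
      from V(3) have "det (R.emp_cov n (\<lambda>z. mlp V z - mlp W\<^sub>0 z) \<omega>) \<le> det (R.emp_cov n (\<lambda>z. mlp W\<^sub>0 z - mlp W\<^sub>0 z) \<omega>)"
        by (simp only: S_def)
      then obtain V' where V': "V' \<in> \<Theta>" "AE \<omega> in M. mlp V' (snd (x 0 \<omega>)) - mlp W\<^sub>0 (snd (x 0 \<omega>)) = 0" "dist V V' < \<eta>"
        using near V(1) by blast
      \<comment> \<open>Measurability of the coincidence set lets the almost sure equality pass from
        \<open>Z 0\<close> to the generic regressor through their common law.\<close>
      have m: "{z. mlp V' z = mlp W\<^sub>0 z} \<in> sets borel" by measurable
      have "AE \<omega> in M. mlp V' (Z 0 \<omega>) = mlp W\<^sub>0 (Z 0 \<omega>)" using V'(2) by (simp add: snd_x)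
      then have "AE z in distr M borel (Z 0). mlp V' z = mlp W\<^sub>0 z"
        using m by (subst AE_distr_iff) auto
      then have "AE \<omega> in M. mlp V' (Zg \<omega>) = mlp W\<^sub>0 (Zg \<omega>)"
        unfolding Z_law using m by (subst (asm) AE_distr_iff) auto
      \<comment> \<open>\<open>V\<close> is close to some \<open>V'\<close> equivalent to
        \<open>W\<^sub>0\<close>; a symmetry taking \<open>V'\<close> to \<open>W\<^sub>0\<close>
        moves \<open>V\<close> equally close to \<open>W\<^sub>0\<close>, and the nearest
        representative is at least as close.\<close>
      then have "mlp_equiv V' W\<^sub>0" by (rule identifiable[OF V'(1)])
      from closest_representative_dist[OF estimator_closest[OF \<omega>] V(2) this] V'(3)
      show "norm (What n \<omega> - W\<^sub>0) \<le> \<eta>" by (simp add: dist_norm)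
    qed
  qed
  \<comment> \<open>Every vector of this ball is equivalent to a member of \<Theta>, even where the
    ball itself leaves \<Theta>.\<close>
  obtain r where r: "r > 0" "cball W\<^sub>0 r \<subseteq> mlp_saturation \<Theta>"
    using true_parameter_interior by (meson mem_interior_cball)
  \<comment> \<open>The determinant depends on the equivalence class only, so minimality over
    \<Theta> passes from \<open>V\<close> to the estimator and from \<open>U\<close> to the
    displaced parameter.\<close>
  have minimal: "det (R.emp_cov n (D (What n \<omega> - W\<^sub>0)) \<omega>) \<le> det (R.emp_cov n (D \<delta>) \<omega>)"
    if \<omega>: "\<omega> \<in> space M" and \<delta>: "norm \<delta> \<le> r" and pos: "0 < det (R.emp_cov n (D \<delta>) \<omega>)" for n \<omega> \<delta>
  proof -
    have "W\<^sub>0 + \<delta> \<in> cball W\<^sub>0 r" using \<delta> by (simp add: dist_norm)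
    then obtain U where U: "U \<in> \<Theta>" "mlp_equiv U (W\<^sub>0 + \<delta>)" using r(2) by (auto simp: mlp_saturation_def)
    obtain V where V: "mlp_equiv V (What n \<omega>)" "\<forall>W\<in>\<Theta>. 0 < S n \<omega> W \<longrightarrow> S n \<omega> V \<le> S n \<omega> W"
      using argmin[OF \<omega>, of n] by blast
    have "0 < S n \<omega> U" using pos S_equiv[OF U(2), of n \<omega>] by (simp add: S_D)
    then have "S n \<omega> V \<le> S n \<omega> U" using V(2) U(1) by blast
    then show ?thesis using S_equiv[OF U(2), of n \<omega>] S_equiv[OF V(1), of n \<omega>] by (simp add: S_D)
  qed
  have "converges_in_law M (\<lambda>n \<omega>. sqrt (real n) *\<^sub>R (What n \<omega> - W\<^sub>0)) (multivariate_normal 0 (matrix_inv R.information))"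
  proof (rule R.asymptotic_normality[OF pd _ consistent r(1) minimal])
    show "(\<lambda>\<omega>. What n \<omega> - W\<^sub>0) \<in> borel_measurable M" for n using estimator_measurable[of n] by measurable
  qed
  then show ?thesis by (simp only: info)
qed

end
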